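(* Let $\pi$ be a discrete torsion-free group such that the centraliser of any nontrivial element $g\in\pi$, $g\ne1$, is infinite cyclic, and let $A$ be a left $\mathbb{Z}[\pi\times\pi]$-module. Then $$E_0^{r,s}=\mathrm{Ext}^r_{\mathbb{Z}[\pi\times\pi]}(\mathbb{Z}[\pi]\otimes_{\mathbb Z}I^s,A)=0$$ for all $r>1$ and $s\ge1$.
   Context: $\mathbb{Z}[\pi]$ is a left $\mathbb{Z}[\pi\times\pi]$-module via $(g,h)\cdot a=gah^{-1}$; $I$ is the augmentation ideal, i.e. the kernel of the augmentation $\epsilon:\mathbb{Z}[\pi]\to\mathbb{Z}$; $I^s=I\otimes_{\mathbb Z}\cdots\otimes_{\mathbb Z}I$ ($s$ factors). Tensor products over $\mathbb{Z}$ carry the diagonal action of $\pi\times\pi$. *)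

theory Defs
  imports "HOL-Algebra.Free_Abelian_Groups" "HOL-Algebra.Module"
begin

section \<open>Groups\<close>

definition torsion_free :: "('g, 'm) monoid_scheme \<Rightarrow> bool" where
  "torsion_free G \<longleftrightarrow>
     (\<forall>g\<in>carrier G. \<forall>n::nat. n > 0 \<longrightarrow> g [^]\<^bsub>G\<^esub> n = \<one>\<^bsub>G\<^esub> \<longrightarrow> g = \<one>\<^bsub>G\<^esub>)"

definition centralizer :: "('g, 'm) monoid_scheme \<Rightarrow> 'g \<Rightarrow> 'g set" where
  "centralizer G g = {x \<in> carrier G. x \<otimes>\<^bsub>G\<^esub> g = g \<otimes>\<^bsub>G\<^esub> x}"

definition infinite_cyclic_group :: "('g, 'm) monoid_scheme \<Rightarrow> bool" where
  "infinite_cyclic_group G \<longleftrightarrow> cyclic_group G \<and> infinite (carrier G)"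

section \<open>Left modules over a not necessarily commutative ring\<close>

text \<open>The library locale \<^locale>\<open>module\<close> asks for a commutative ring of scalars; here only the
  axioms are taken over. As there, the fields \<^const>\<open>monoid.mult\<close> and \<^const>\<open>one\<close> of a module
  record carry no meaning.\<close>

locale left_module = R?: ring R + M?: abelian_group M
  for R (structure) and M :: "('r, 'a, 'b) module_scheme" (structure) +
  assumes smult_closed [simp, intro]:
      "\<lbrakk>a \<in> carrier R; x \<in> carrier M\<rbrakk> \<Longrightarrow> a \<odot>\<^bsub>M\<^esub> x \<in> carrier M"
    and smult_l_distr:
      "\<lbrakk>a \<in> carrier R; b \<in> carrier R; x \<in> carrier M\<rbrakk> \<Longrightarrow>
        (a \<oplus>\<^bsub>R\<^esub> b) \<odot>\<^bsub>M\<^esub> x = a \<odot>\<^bsub>M\<^esub> x \<oplus>\<^bsub>M\<^esub> b \<odot>\<^bsub>M\<^esub> x"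
    and smult_r_distr:
      "\<lbrakk>a \<in> carrier R; x \<in> carrier M; y \<in> carrier M\<rbrakk> \<Longrightarrow>
        a \<odot>\<^bsub>M\<^esub> (x \<oplus>\<^bsub>M\<^esub> y) = a \<odot>\<^bsub>M\<^esub> x \<oplus>\<^bsub>M\<^esub> a \<odot>\<^bsub>M\<^esub> y"
    and smult_assoc1:
      "\<lbrakk>a \<in> carrier R; b \<in> carrier R; x \<in> carrier M\<rbrakk> \<Longrightarrow>
        (a \<otimes>\<^bsub>R\<^esub> b) \<odot>\<^bsub>M\<^esub> x = a \<odot>\<^bsub>M\<^esub> (b \<odot>\<^bsub>M\<^esub> x)"
    and smult_one [simp]:
      "x \<in> carrier M \<Longrightarrow> \<one>\<^bsub>R\<^esub> \<odot>\<^bsub>M\<^esub> x = x"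

definition module_hom ::
  "('r, 'x) ring_scheme \<Rightarrow> ('r, 'a, 'y) module_scheme \<Rightarrow> ('r, 'b, 'z) module_scheme \<Rightarrow> ('a \<Rightarrow> 'b) set"
where
  "module_hom R M N = {f \<in> carrier M \<rightarrow> carrier N.
     (\<forall>x\<in>carrier M. \<forall>y\<in>carrier M. f (x \<oplus>\<^bsub>M\<^esub> y) = f x \<oplus>\<^bsub>N\<^esub> f y) \<and>
     (\<forall>a\<in>carrier R. \<forall>x\<in>carrier M. f (a \<odot>\<^bsub>M\<^esub> x) = a \<odot>\<^bsub>N\<^esub> f x)}"

text \<open>Extensionality makes an element of the group \<open>Hom\<^sub>R(M, N)\<close> determined by its values on the
  carrier of \<open>M\<close>.\<close>

definition Hom_group ::
  "('r, 'x) ring_scheme \<Rightarrow> ('r, 'a, 'y) module_scheme \<Rightarrow> ('r, 'b, 'z) module_scheme \<Rightarrow> ('a \<Rightarrow> 'b) monoid"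
where
  "Hom_group R M N = \<lparr>carrier = module_hom R M N \<inter> extensional (carrier M),
     monoid.mult = (\<lambda>f g. \<lambda>x\<in>carrier M. f x \<oplus>\<^bsub>N\<^esub> g x),
     one = (\<lambda>x\<in>carrier M. \<zero>\<^bsub>N\<^esub>)\<rparr>"

section \<open>Projective resolutions and Ext\<close>

text \<open>Lifting of homomorphisms \<open>P \<rightarrow> L\<close> along epimorphisms \<open>N \<rightarrow> L\<close>. A definition cannot quantify
  over the element types of \<open>N\<close> and \<open>L\<close>. The types chosen lose nothing: the free \<open>R\<close>-module on the
  carrier of \<open>P\<close> lives on \<open>'p \<Rightarrow> 'r\<close> (finitely supported functions), so lifting the identity
  of \<open>P\<close> along its canonical projection onto \<open>P\<close> shows \<open>P\<close> to be a direct summand of a free module.\<close>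

definition projective_module :: "('r, 'x) ring_scheme \<Rightarrow> ('r, 'p) module \<Rightarrow> bool" where
  "projective_module R P \<longleftrightarrow> left_module R P \<and>
     (\<forall>(N :: ('r, 'p \<Rightarrow> 'r) module) (L :: ('r, 'p) module) e f.
        left_module R N \<and> left_module R L \<and>
        e \<in> module_hom R N L \<and> e ` carrier N = carrier L \<and> f \<in> module_hom R P L \<longrightarrow>
        (\<exists>h\<in>module_hom R P N. \<forall>x\<in>carrier P. e (h x) = f x))"

text \<open>An exact sequence \<open>\<dots> \<rightarrow> P\<^sub>2 \<rightarrow> P\<^sub>1 \<rightarrow> P\<^sub>0 \<rightarrow> M \<rightarrow> 0\<close> with \<open>d n\<close> going from \<open>P (Suc n)\<close> to \<open>P n\<close>.
  All \<open>P n\<close> share one element type \<open>'p\<close>; being arbitrary, it can be taken large enough for any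
  given resolution.\<close>

definition projective_resolution ::
  "('r, 'x) ring_scheme \<Rightarrow> ('r, 'a, 'y) module_scheme \<Rightarrow>
   (nat \<Rightarrow> ('r, 'p) module) \<Rightarrow> (nat \<Rightarrow> 'p \<Rightarrow> 'p) \<Rightarrow> ('p \<Rightarrow> 'a) \<Rightarrow> bool"
where
  "projective_resolution R M P d \<epsilon> \<longleftrightarrow>
     left_module R M \<and>
     (\<forall>n. projective_module R (P n)) \<and>
     (\<forall>n. d n \<in> module_hom R (P (Suc n)) (P n)) \<and>
     \<epsilon> \<in> module_hom R (P 0) M \<and>
     \<epsilon> ` carrier (P 0) = carrier M \<and>
     d 0 ` carrier (P (Suc 0)) = {x \<in> carrier (P 0). \<epsilon> x = \<zero>\<^bsub>M\<^esub>} \<and>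
     (\<forall>n. d (Suc n) ` carrier (P (Suc (Suc n))) =
          {x \<in> carrier (P (Suc n)). d n x = \<zero>\<^bsub>P n\<^esub>})"

definition Ext_cocycles ::
  "('r, 'x) ring_scheme \<Rightarrow> (nat \<Rightarrow> ('r, 'p) module) \<Rightarrow> (nat \<Rightarrow> 'p \<Rightarrow> 'p) \<Rightarrow> nat \<Rightarrow>
   ('r, 'a, 'y) module_scheme \<Rightarrow> ('p \<Rightarrow> 'a) set"
where
  "Ext_cocycles R P d r A =
     {f \<in> carrier (Hom_group R (P r) A). \<forall>x\<in>carrier (P (Suc r)). f (d r x) = \<zero>\<^bsub>A\<^esub>}"

definition Ext_coboundaries ::
  "('r, 'x) ring_scheme \<Rightarrow> (nat \<Rightarrow> ('r, 'p) module) \<Rightarrow> (nat \<Rightarrow> 'p \<Rightarrow> 'p) \<Rightarrow> nat \<Rightarrow>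
   ('r, 'a, 'y) module_scheme \<Rightarrow> ('p \<Rightarrow> 'a) set"
where
  "Ext_coboundaries R P d r A =
     (case r of
        0 \<Rightarrow> {\<one>\<^bsub>Hom_group R (P 0) A\<^esub>}
      | Suc q \<Rightarrow> (\<lambda>f. \<lambda>x\<in>carrier (P (Suc q)). f (d q x)) ` carrier (Hom_group R (P q) A))"

text \<open>\<open>Ext\<^sup>r\<^sub>R(M, A)\<close>, computed from a projective resolution \<open>(P, d)\<close> of \<open>M\<close> as the \<open>r\<close>-th cohomology
  group of the cochain complex \<open>Hom\<^sub>R(P, A)\<close>.\<close>

definition Ext_group ::
  "('r, 'x) ring_scheme \<Rightarrow> (nat \<Rightarrow> ('r, 'p) module) \<Rightarrow> (nat \<Rightarrow> 'p \<Rightarrow> 'p) \<Rightarrow> nat \<Rightarrow>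
   ('r, 'a, 'y) module_scheme \<Rightarrow> ('p \<Rightarrow> 'a) set monoid"
where
  "Ext_group R P d r A =
     (Hom_group R (P r) A)\<lparr>carrier := Ext_cocycles R P d r A\<rparr> Mod Ext_coboundaries R P d r A"

section \<open>Integral group rings\<close>

definition group_ring :: "('g, 'm) monoid_scheme \<Rightarrow> ('g \<Rightarrow>\<^sub>0 int) ring" where
  "group_ring G = \<lparr>carrier = carrier (free_Abelian_group (carrier G)),
     monoid.mult = (\<lambda>a b. frag_extend (\<lambda>g. frag_extend (\<lambda>h. frag_of (g \<otimes>\<^bsub>G\<^esub> h)) b) a),
     one = frag_of \<one>\<^bsub>G\<^esub>,
     zero = 0,
     add = (+)\<rparr>"

text \<open>\<open>\<int>[\<pi>]\<close> as a left \<open>\<int>[\<pi> \<times> \<pi>]\<close>-module via \<open>(g, h) \<cdot> a = g a h\<^sup>-\<^sup>1\<close>.\<close>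

definition group_ring_bimodule ::
  "('g, 'm) monoid_scheme \<Rightarrow> ('g \<times> 'g \<Rightarrow>\<^sub>0 int, 'g \<Rightarrow>\<^sub>0 int) module"
where
  "group_ring_bimodule G = \<lparr>carrier = carrier (group_ring G),
     monoid.mult = undefined, one = undefined,
     zero = 0,
     add = (+),
     smult = (\<lambda>r a. frag_extend (\<lambda>(g, h).
       frag_of g \<otimes>\<^bsub>group_ring G\<^esub> a \<otimes>\<^bsub>group_ring G\<^esub> frag_of (inv\<^bsub>G\<^esub> h)) r)\<rparr>"

definition augmentation :: "('g \<Rightarrow>\<^sub>0 int) \<Rightarrow> int" where
  "augmentation a = (\<Sum>g\<in>Poly_Mapping.keys a. Poly_Mapping.lookup a g)"

definition augmentation_ideal ::
  "('g, 'm) monoid_scheme \<Rightarrow> ('g \<times> 'g \<Rightarrow>\<^sub>0 int, 'g \<Rightarrow>\<^sub>0 int) module"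
where
  "augmentation_ideal G =
     (group_ring_bimodule G)\<lparr>carrier := {a \<in> carrier (group_ring G). augmentation a = 0}\<rparr>"

section \<open>Tensor products over the integers with diagonal action\<close>

text \<open>The abelian group with generators \<open>S\<close> and relators \<open>X\<close>, i.e. the free abelian group on \<open>S\<close>
  modulo the subgroup \<open>K\<close> generated by \<open>X\<close>, on which \<open>g \<in> G\<close> acts by \<open>act g\<close> on the generators;
  the action is extended linearly to \<open>\<int>[G]\<close> and is computed on representatives of the cosets.\<close>

definition presented_module ::
  "('b \<Rightarrow>\<^sub>0 int) set \<Rightarrow> ('g \<Rightarrow> 'b \<Rightarrow> 'b) \<Rightarrow> 'b set \<Rightarrow> ('g \<Rightarrow>\<^sub>0 int, ('b \<Rightarrow>\<^sub>0 int) set) module"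
where
  "presented_module X act S =
     (let F = free_Abelian_group S; K = generate F X in
      \<lparr>carrier = carrier (F Mod K),
       monoid.mult = undefined, one = undefined,
       zero = \<one>\<^bsub>F Mod K\<^esub>,
       add = (\<lambda>U V. U \<otimes>\<^bsub>F Mod K\<^esub> V),
       smult = (\<lambda>r U. \<Union>u\<in>U.
         K #>\<^bsub>F\<^esub> frag_extend (\<lambda>g. frag_extend (\<lambda>b. frag_of (act g b)) u) r)\<rparr>)"

text \<open>\<open>M \<otimes>\<^sub>\<int> N\<close>: biadditivity is all that is imposed, since it implies \<open>\<int>\<close>-balancedness.\<close>

definition tensor_relators ::
  "('r, 'a, 'y) module_scheme \<Rightarrow> ('r, 'b, 'z) module_scheme \<Rightarrow> ('a \<times> 'b \<Rightarrow>\<^sub>0 int) set"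
where
  "tensor_relators M N =
     {frag_of (x \<oplus>\<^bsub>M\<^esub> x', y) - frag_of (x, y) - frag_of (x', y) | x x' y.
        x \<in> carrier M \<and> x' \<in> carrier M \<and> y \<in> carrier N} \<union>
     {frag_of (x, y \<oplus>\<^bsub>N\<^esub> y') - frag_of (x, y) - frag_of (x, y') | x y y'.
        x \<in> carrier M \<and> y \<in> carrier N \<and> y' \<in> carrier N}"

definition tensor_product ::
  "('g \<Rightarrow>\<^sub>0 int, 'a, 'y) module_scheme \<Rightarrow> ('g \<Rightarrow>\<^sub>0 int, 'b, 'z) module_scheme \<Rightarrow>
   ('g \<Rightarrow>\<^sub>0 int, ('a \<times> 'b \<Rightarrow>\<^sub>0 int) set) module"
where
  "tensor_product M N =
     presented_module (tensor_relators M N)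
       (\<lambda>g (x, y). (frag_of g \<odot>\<^bsub>M\<^esub> x, frag_of g \<odot>\<^bsub>N\<^esub> y)) (carrier M \<times> carrier N)"

text \<open>\<open>M \<otimes>\<^sub>\<int> \<cdots> \<otimes>\<^sub>\<int> M\<close> with \<open>s\<close> factors. Iterating the binary product would change the type at every
  step, so the \<open>s\<close>-fold product is presented at once: the generator \<open>x\<^sub>1 \<otimes> \<cdots> \<otimes> x\<^sub>s\<close> is the list
  \<open>[x\<^sub>1, \<dots>, x\<^sub>s]\<close> and the relators express additivity in each factor.\<close>

definition tensor_power_relators ::
  "('r, 'a, 'y) module_scheme \<Rightarrow> nat \<Rightarrow> ('a list \<Rightarrow>\<^sub>0 int) set"
where
  "tensor_power_relators M s =
     {frag_of (us @ (x \<oplus>\<^bsub>M\<^esub> x') # vs) - frag_of (us @ x # vs) - frag_of (us @ x' # vs)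
        | us x x' vs.
        set us \<subseteq> carrier M \<and> x \<in> carrier M \<and> x' \<in> carrier M \<and> set vs \<subseteq> carrier M \<and>
        Suc (length us + length vs) = s}"

definition tensor_power ::
  "('g \<Rightarrow>\<^sub>0 int, 'a, 'y) module_scheme \<Rightarrow> nat \<Rightarrow> ('g \<Rightarrow>\<^sub>0 int, ('a list \<Rightarrow>\<^sub>0 int) set) module"
where
  "tensor_power M s =
     presented_module (tensor_power_relators M s)
       (\<lambda>g. map (\<lambda>x. frag_of g \<odot>\<^bsub>M\<^esub> x)) {xs. set xs \<subseteq> carrier M \<and> length xs = s}"

end

theory Submission
  imports Defs "HOL-Algebra.AbelCoset"
begin

text \<open>
Write \<open>H = \<pi> \<times> \<pi>\<close> and \<open>M = \<int>[\<pi>] \<otimes> I\<^sup>s\<close>. For each \<open>y\<close> in \<open>\<pi>\<close> the differences \<open>z - y\<close> with \<open>z \<noteq> y\<close> form an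
integral basis of \<open>I\<close>. Hence the tensors \<open>y \<otimes> (z\<^sub>1 - y) \<otimes> \<cdots> \<otimes> (z\<^sub>s - y)\<close> with all \<open>z\<^sub>i \<noteq> y\<close> form an integral basis
of \<open>M\<close>, and \<open>H\<close> permutes it through \<open>(g, h) x = g x h\<^sup>-\<^sup>1\<close> on each of \<open>y, z\<^sub>1, \<dots>, z\<^sub>s\<close> (\<open>basis_map_hom\<close>,
\<open>basis_map_bij\<close>). An element of \<open>H\<close> that fixes such a tuple is of the form \<open>(g, y\<^sup>-\<^sup>1 g y)\<close> with \<open>g\<close> in the
centralizer of \<open>z\<^sub>1 y\<^sup>-\<^sup>1 \<noteq> 1\<close>. So all stabilizers are trivial or infinite cyclic
(\<open>cyclic_stabilizers_basis\<close>), and \<open>M\<close> is a direct sum of modules induced from trivial modules of groups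
of cohomological dimension at most one.

This forces \<open>Ext\<close> to vanish above degree one. For a given projective resolution \<open>P\<close> of \<open>M\<close> it suffices
that the surjection of \<open>P\<^sub>1\<close> onto the kernel of \<open>P\<^sub>0 \<rightarrow> M\<close> splits, because then so do all later ones
(\<open>Ext_group_trivial_if_syzygy_splits\<close>). The splitting is obtained by comparing \<open>P\<^sub>0\<close> with the free
\<open>\<int>[H]\<close>-module \<open>Q\<close> on representatives of the orbits of the basis (\<open>syzygy_splits\<close>), which reduces it to
lifting homomorphisms from the kernel of \<open>Q \<rightarrow> M\<close> along epimorphisms (\<open>kernel_lift\<close>). On one orbit such a
homomorphism amounts to a derivation on the stabilizer, and a derivation on an infinite cyclic group can
be prescribed arbitrarily on the generator (\<open>inner_derivation_lifts\<close>).
\<close>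

section \<open>Homomorphisms of modules\<close>

context left_module begin

lemma smult_zero_right [simp]: "a \<in> carrier R \<Longrightarrow> a \<odot>\<^bsub>M\<^esub> \<zero>\<^bsub>M\<^esub> = \<zero>\<^bsub>M\<^esub>"
  using smult_r_distr[of a "\<zero>\<^bsub>M\<^esub>" "\<zero>\<^bsub>M\<^esub>"] M.add.l_cancel_one'[of "a \<odot>\<^bsub>M\<^esub> \<zero>\<^bsub>M\<^esub>" "a \<odot>\<^bsub>M\<^esub> \<zero>\<^bsub>M\<^esub>"]
  by simp

lemma smult_zero_left [simp]: "x \<in> carrier M \<Longrightarrow> \<zero>\<^bsub>R\<^esub> \<odot>\<^bsub>M\<^esub> x = \<zero>\<^bsub>M\<^esub>"
  using smult_l_distr[of "\<zero>\<^bsub>R\<^esub>" "\<zero>\<^bsub>R\<^esub>" x] M.add.l_cancel_one'[of "\<zero>\<^bsub>R\<^esub> \<odot>\<^bsub>M\<^esub> x" "\<zero>\<^bsub>R\<^esub> \<odot>\<^bsub>M\<^esub> x"]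
  by simp

lemma smult_uminus_right:
  "\<lbrakk>a \<in> carrier R; x \<in> carrier M\<rbrakk> \<Longrightarrow> a \<odot>\<^bsub>M\<^esub> (\<ominus>\<^bsub>M\<^esub> x) = \<ominus>\<^bsub>M\<^esub> (a \<odot>\<^bsub>M\<^esub> x)"
  using smult_r_distr[of a "\<ominus>\<^bsub>M\<^esub> x" x] M.minus_equality[of "a \<odot>\<^bsub>M\<^esub> (\<ominus>\<^bsub>M\<^esub> x)" "a \<odot>\<^bsub>M\<^esub> x"]
  by (simp add: M.l_neg)

lemma smult_finsum:
  assumes "a \<in> carrier R" "finite A" "f \<in> A \<rightarrow> carrier M"
  shows "a \<odot>\<^bsub>M\<^esub> finsum M f A = finsum M (\<lambda>i. a \<odot>\<^bsub>M\<^esub> f i) A"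
  using assms(2,3) by (induction A rule: finite_induct) (auto simp: assms(1) smult_r_distr Pi_iff)

end

lemma module_homI:
  assumes "\<And>x. x \<in> carrier M \<Longrightarrow> f x \<in> carrier N"
    and "\<And>x y. \<lbrakk>x \<in> carrier M; y \<in> carrier M\<rbrakk> \<Longrightarrow> f (x \<oplus>\<^bsub>M\<^esub> y) = f x \<oplus>\<^bsub>N\<^esub> f y"
    and "\<And>a x. \<lbrakk>a \<in> carrier R; x \<in> carrier M\<rbrakk> \<Longrightarrow> f (a \<odot>\<^bsub>M\<^esub> x) = a \<odot>\<^bsub>N\<^esub> f x"
  shows "f \<in> module_hom R M N"
  using assms by (auto simp: module_hom_def)

lemma
  assumes "f \<in> module_hom R M N" "x \<in> carrier M"
  shows module_hom_closed: "f x \<in> carrier N"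
    and module_hom_add: "y \<in> carrier M \<Longrightarrow> f (x \<oplus>\<^bsub>M\<^esub> y) = f x \<oplus>\<^bsub>N\<^esub> f y"
    and module_hom_smult: "a \<in> carrier R \<Longrightarrow> f (a \<odot>\<^bsub>M\<^esub> x) = a \<odot>\<^bsub>N\<^esub> f x"
  using assms by (auto simp: module_hom_def)

lemma module_hom_abelian_group_hom:
  assumes "f \<in> module_hom R M N" "abelian_group M" "abelian_group N"
  shows "abelian_group_hom M N f"
  using assms
  by (intro abelian_group_homI)
     (auto simp: module_hom_def group_hom_def group_hom_axioms_def hom_def abelian_group.a_group)

lemma
  assumes "f \<in> module_hom R M N" "abelian_group M" "abelian_group N"
  shows module_hom_zero: "f \<zero>\<^bsub>M\<^esub> = \<zero>\<^bsub>N\<^esub>"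
    and module_hom_minus:
      "\<lbrakk>x \<in> carrier M; y \<in> carrier M\<rbrakk> \<Longrightarrow> f (x \<ominus>\<^bsub>M\<^esub> y) = f x \<ominus>\<^bsub>N\<^esub> f y"
proof -
  interpret abelian_group_hom M N f using module_hom_abelian_group_hom[OF assms] .
  show "f \<zero>\<^bsub>M\<^esub> = \<zero>\<^bsub>N\<^esub>" by simp
  show "\<lbrakk>x \<in> carrier M; y \<in> carrier M\<rbrakk> \<Longrightarrow> f (x \<ominus>\<^bsub>M\<^esub> y) = f x \<ominus>\<^bsub>N\<^esub> f y"
    by (simp add: a_minus_def)
qed

lemma module_hom_comp:
  "\<lbrakk>f \<in> module_hom R M N; g \<in> module_hom R N L\<rbrakk> \<Longrightarrow> (\<lambda>x. g (f x)) \<in> module_hom R M L"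
  by (intro module_homI) (auto simp: module_hom_closed module_hom_add module_hom_smult)

lemma module_hom_finsum:
  assumes "f \<in> module_hom R M N" "abelian_group M" "abelian_group N"
    and "finite A" "v \<in> A \<rightarrow> carrier M"
  shows "f (finsum M v A) = finsum N (\<lambda>i. f (v i)) A"
proof -
  interpret M: abelian_group M by fact
  interpret N: abelian_group N by fact
  show ?thesis using assms(4,5)
    by (induction A rule: finite_induct)
       (auto simp: Pi_iff module_hom_zero[OF assms(1-3)] module_hom_add[OF assms(1)]
         module_hom_closed[OF assms(1)])
qed

lemma (in abelian_group) minus_eq_zero_iff:
  "\<lbrakk>a \<in> carrier G; b \<in> carrier G\<rbrakk> \<Longrightarrow> a \<ominus> b = \<zero> \<longleftrightarrow> a = b"
  by (simp add: add.inv_solve_right' minus_eq)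

lemma (in abelian_group) minus_plus_minus:
  "\<lbrakk>a \<in> carrier G; b \<in> carrier G; c \<in> carrier G; d \<in> carrier G\<rbrakk> \<Longrightarrow>
    (a \<oplus> b) \<ominus> (c \<oplus> d) = (a \<ominus> c) \<oplus> (b \<ominus> d)"
  by (simp add: minus_eq minus_add a_ac)

lemma module_hom_add_hom:
  assumes "left_module R N" "f \<in> module_hom R M N" "g \<in> module_hom R M N"
  shows "(\<lambda>x. f x \<oplus>\<^bsub>N\<^esub> g x) \<in> module_hom R M N"
proof -
  interpret N: left_module R N by fact
  show ?thesis using assms(2,3) 
    by (auto intro!: module_homI simp: module_hom_closed module_hom_add module_hom_smult
        N.smult_r_distr N.M.a_ac)
qed

lemma module_hom_minus_hom:
  assumes "left_module R N" "f \<in> module_hom R M N" "g \<in> module_hom R M N"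
  shows "(\<lambda>x. f x \<ominus>\<^bsub>N\<^esub> g x) \<in> module_hom R M N"
proof -
  interpret N: left_module R N by fact
  show ?thesis using assms(2,3) 
    by (intro module_homI) 
       (auto simp: module_hom_closed module_hom_add module_hom_smult
        N.smult_r_distr N.M.minus_plus_minus N.smult_uminus_right a_minus_def N.M.minus_add N.M.a_ac)
qed

section \<open>Projective modules are summands of free modules\<close>

text \<open>The free module on \<open>S\<close>. For \<open>S\<close> the carrier of a module \<open>P\<close> its elements have exactly the type
over which the modules that test projectivity of \<open>P\<close> range.\<close>

definition free_left_module :: "('r, 'x) ring_scheme \<Rightarrow> 'b set \<Rightarrow> ('r, 'b \<Rightarrow> 'r) module" where
  "free_left_module R S =
     \<lparr>carrier = {c. (\<forall>b\<in>S. c b \<in> carrier R) \<and> (\<forall>b. b \<notin> S \<longrightarrow> c b = \<zero>\<^bsub>R\<^esub>) \<and> finite {b. c b \<noteq> \<zero>\<^bsub>R\<^esub>}},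
      monoid.mult = undefined, one = undefined,
      zero = (\<lambda>b. \<zero>\<^bsub>R\<^esub>),
      add = (\<lambda>c c' b. c b \<oplus>\<^bsub>R\<^esub> c' b),
      smult = (\<lambda>r c b. r \<otimes>\<^bsub>R\<^esub> c b)\<rparr>"

definition linear_combination ::
  "('r, 'x) ring_scheme \<Rightarrow> ('r, 'a, 'y) module_scheme \<Rightarrow> ('b \<Rightarrow> 'a) \<Rightarrow> ('b \<Rightarrow> 'r) \<Rightarrow> 'a" where
  "linear_combination R N v c = finsum N (\<lambda>b. c b \<odot>\<^bsub>N\<^esub> v b) {b. c b \<noteq> \<zero>\<^bsub>R\<^esub>}"

lemma carrier_free_left_moduleD:
  assumes "ring R" "c \<in> carrier (free_left_module R S)"
  shows "c b \<in> carrier R" "finite {b. c b \<noteq> \<zero>\<^bsub>R\<^esub>}" "{b. c b \<noteq> \<zero>\<^bsub>R\<^esub>} \<subseteq> S"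
  using assms ring.ring_simprules(2)[OF assms(1)] by (auto simp: free_left_module_def)

lemma left_module_free_left_module:
  fixes R :: "('r, 'x) ring_scheme" and S :: "'b set"
  assumes "ring R"
  shows "left_module R (free_left_module R S)"
proof -
  interpret R: ring R by fact
  have fin: "finite {b. c b \<oplus>\<^bsub>R\<^esub> c' b \<noteq> \<zero>\<^bsub>R\<^esub>}"
    if "finite {b. c b \<noteq> \<zero>\<^bsub>R\<^esub>}" "finite {b. c' b \<noteq> \<zero>\<^bsub>R\<^esub>}" for c c' :: "'b \<Rightarrow> 'r"
    by (rule finite_subset[of _ "{b. c b \<noteq> \<zero>\<^bsub>R\<^esub>} \<union> {b. c' b \<noteq> \<zero>\<^bsub>R\<^esub>}"]) (use that in auto)
  have closed: "c b \<in> carrier R" if "\<forall>b\<in>S. c b \<in> carrier R" "\<forall>b. b \<notin> S \<longrightarrow> c b = \<zero>\<^bsub>R\<^esub>" for c b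
    using that by (cases "b \<in> S") auto
  have "abelian_group (free_left_module R S)"
  proof (rule abelian_groupI)
    fix x assume "x \<in> carrier (free_left_module R S)"
    then show "\<exists>y\<in>carrier (free_left_module R S). y \<oplus>\<^bsub>free_left_module R S\<^esub> x = \<zero>\<^bsub>free_left_module R S\<^esub>"
      by (intro bexI[of _ "\<lambda>b. \<ominus>\<^bsub>R\<^esub> x b"])
        (auto simp: free_left_module_def fun_eq_iff R.l_neg closed
              elim!: finite_subset[rotated])
  qed (auto simp: free_left_module_def closed fin R.a_ac)
  then show ?thesis
  proof (intro left_module.intro left_module_axioms.intro assms)
    fix a x assume a: "a \<in> carrier R" and x: "x \<in> carrier (free_left_module R S)"
    have "finite {b. a \<otimes>\<^bsub>R\<^esub> x b \<noteq> \<zero>\<^bsub>R\<^esub>}"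
      by (rule finite_subset[OF _ carrier_free_left_moduleD(2)[OF assms x]]) (use a in auto)
    then show "a \<odot>\<^bsub>free_left_module R S\<^esub> x \<in> carrier (free_left_module R S)"
      using a x by (auto simp: free_left_module_def)
  qed (auto simp: free_left_module_def closed R.l_distr R.r_distr R.m_assoc)
qed

lemma linear_combination_eq_finsum:
  assumes "left_module R N" "c \<in> carrier (free_left_module R S)" "v \<in> S \<rightarrow> carrier N"
    and "finite B" "{b. c b \<noteq> \<zero>\<^bsub>R\<^esub>} \<subseteq> B" "B \<subseteq> S"
  shows "linear_combination R N v c = finsum N (\<lambda>b. c b \<odot>\<^bsub>N\<^esub> v b) B"
proof -
  interpret N: left_module R N by fact
  note c = carrier_free_left_moduleD[OF N.R.ring_axioms assms(2)]
  show ?thesis unfolding linear_combination_def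
    by (rule N.M.add.finprod_mono_neutral_cong_left) (use assms c in \<open>auto simp: Pi_iff\<close>)
qed

lemma linear_combination_hom:
  assumes "left_module R N" and v: "v \<in> S \<rightarrow> carrier N"
  shows "linear_combination R N v \<in> module_hom R (free_left_module R S) N"
proof -
  interpret N: left_module R N by fact
  note R = N.R.ring_axioms
  interpret F: left_module R "free_left_module R S" by (rule left_module_free_left_module[OF R])
  note supp = carrier_free_left_moduleD[OF R, of _ S]
  show ?thesis
  proof (rule module_homI)
    fix c assume "c \<in> carrier (free_left_module R S)"
    then show "linear_combination R N v c \<in> carrier N"
      using supp[of c] v unfolding linear_combination_def
      by (intro N.M.finsum_closed) auto
  next
    fix c c' assume c: "c \<in> carrier (free_left_module R S)" and c': "c' \<in> carrier (free_left_module R S)"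
    let ?B = "{b. c b \<noteq> \<zero>\<^bsub>R\<^esub>} \<union> {b. c' b \<noteq> \<zero>\<^bsub>R\<^esub>}"
    note s = supp[OF c] supp[OF c']
    have B: "finite ?B" "?B \<subseteq> S" using s by auto
    have [simp]: "(c \<oplus>\<^bsub>free_left_module R S\<^esub> c') b = c b \<oplus>\<^bsub>R\<^esub> c' b" for b
      by (simp add: free_left_module_def)
    have v': "b \<in> ?B \<Longrightarrow> v b \<in> carrier N" for b using B(2) v by blast
    have "linear_combination R N v (c \<oplus>\<^bsub>free_left_module R S\<^esub> c')
        = finsum N (\<lambda>b. (c b \<oplus>\<^bsub>R\<^esub> c' b) \<odot>\<^bsub>N\<^esub> v b) ?B"
      by (subst linear_combination_eq_finsum[OF assms(1) F.M.a_closed[OF c c'] v B(1) _ B(2)]) auto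
    also have "\<dots> = finsum N (\<lambda>b. c b \<odot>\<^bsub>N\<^esub> v b \<oplus>\<^bsub>N\<^esub> c' b \<odot>\<^bsub>N\<^esub> v b) ?B"
      by (rule N.M.finsum_cong') (use v' s in \<open>auto intro!: N.smult_l_distr\<close>)
    also have "\<dots> = finsum N (\<lambda>b. c b \<odot>\<^bsub>N\<^esub> v b) ?B \<oplus>\<^bsub>N\<^esub> finsum N (\<lambda>b. c' b \<odot>\<^bsub>N\<^esub> v b) ?B"
      by (rule N.M.finsum_addf) (use v' s in auto)
    finally show "linear_combination R N v (c \<oplus>\<^bsub>free_left_module R S\<^esub> c')
        = linear_combination R N v c \<oplus>\<^bsub>N\<^esub> linear_combination R N v c'"
      using linear_combination_eq_finsum[OF assms(1) c v B(1) _ B(2)]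
        linear_combination_eq_finsum[OF assms(1) c' v B(1) _ B(2)] by simp
  next
    fix a c assume a: "a \<in> carrier R" and c: "c \<in> carrier (free_left_module R S)"
    let ?B = "{b. c b \<noteq> \<zero>\<^bsub>R\<^esub>}"
    note s = supp[OF c]
    have v': "b \<in> ?B \<Longrightarrow> v b \<in> carrier N" for b using s(3) v by blast
    have [simp]: "(a \<odot>\<^bsub>free_left_module R S\<^esub> c) b = a \<otimes>\<^bsub>R\<^esub> c b" for b
      by (simp add: free_left_module_def)
    have "linear_combination R N v (a \<odot>\<^bsub>free_left_module R S\<^esub> c)
        = finsum N (\<lambda>b. (a \<otimes>\<^bsub>R\<^esub> c b) \<odot>\<^bsub>N\<^esub> v b) ?B"
      using a by (subst linear_combination_eq_finsum[OF assms(1) F.smult_closed[OF a c] v s(2) _ s(3)]) auto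
    also have "\<dots> = finsum N (\<lambda>b. a \<odot>\<^bsub>N\<^esub> (c b \<odot>\<^bsub>N\<^esub> v b)) ?B"
      by (rule N.M.finsum_cong') (use v' s a in \<open>auto intro!: N.smult_assoc1\<close>)
    also have "\<dots> = a \<odot>\<^bsub>N\<^esub> linear_combination R N v c" unfolding linear_combination_def
      by (rule N.smult_finsum[symmetric]) (use v' s a in auto)
    finally show "linear_combination R N v (a \<odot>\<^bsub>free_left_module R S\<^esub> c)
        = a \<odot>\<^bsub>N\<^esub> linear_combination R N v c" .
  qed
qed

lemma module_hom_linear_combination:
  assumes N: "left_module R N" and L: "left_module R L"
    and f: "f \<in> module_hom R N L" and v: "v \<in> S \<rightarrow> carrier N"
    and c: "c \<in> carrier (free_left_module R S)"
  shows "f (linear_combination R N v c) = linear_combination R L (\<lambda>b. f (v b)) c"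
proof -
  interpret N: left_module R N by fact
  interpret L: left_module R L by fact
  note s = carrier_free_left_moduleD[OF N.R.ring_axioms c]
  have v': "b \<in> {b. c b \<noteq> \<zero>\<^bsub>R\<^esub>} \<Longrightarrow> v b \<in> carrier N" for b using s(3) v by blast
  have "f (linear_combination R N v c) = finsum L (\<lambda>b. f (c b \<odot>\<^bsub>N\<^esub> v b)) {b. c b \<noteq> \<zero>\<^bsub>R\<^esub>}"
    unfolding linear_combination_def
    by (rule module_hom_finsum[OF f N.M.abelian_group_axioms L.M.abelian_group_axioms s(2)])
       (use s v' in auto)
  also have "\<dots> = linear_combination R L (\<lambda>b. f (v b)) c"
    unfolding linear_combination_def
    by (rule L.M.finsum_cong') (use s v' f in \<open>auto simp: module_hom_smult module_hom_closed\<close>)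
  finally show ?thesis .
qed

text \<open>Projectivity is defined by lifting against modules of one fixed element type. The free module on
the carrier of \<open>P\<close> is among them, so its canonical projection onto \<open>P\<close> splits. Linear maps out of a
free module can be prescribed on the basis, whatever the element types of \<open>N\<close> and \<open>L\<close>, and
composing with the splitting carries the lifting property over to \<open>P\<close>.\<close>

lemma projective_module_lift:
  fixes P :: "('r, 'p) module"
  assumes "projective_module R P" and N: "left_module R N" and L: "left_module R L"
    and e: "e \<in> module_hom R N L" and f: "f \<in> module_hom R P L"
    and im: "f ` carrier P \<subseteq> e ` carrier N"
  obtains h where "h \<in> module_hom R P N" "\<And>x. x \<in> carrier P \<Longrightarrow> e (h x) = f x"
proof -
  let ?F = "free_left_module R (carrier P)" and ?\<pi> = "linear_combination R P (\<lambda>x. x)"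
  have P: "left_module R P" using assms(1) by (simp add: projective_module_def)
  interpret P: left_module R P by fact
  interpret N: left_module R N by fact
  interpret L: left_module R L by fact
  have F: "left_module R ?F" by (rule left_module_free_left_module) (rule P.R.ring_axioms)
  have \<pi>: "?\<pi> \<in> module_hom R ?F P"
    by (rule linear_combination_hom[OF P]) auto
  have "?\<pi> ` carrier ?F = carrier P"
  proof
    show "?\<pi> ` carrier ?F \<subseteq> carrier P" using \<pi> by (auto simp: module_hom_def)
    show "carrier P \<subseteq> ?\<pi> ` carrier ?F"
    proof
      fix x assume x: "x \<in> carrier P"
      let ?c = "\<lambda>y. if y = x then \<one>\<^bsub>R\<^esub> else \<zero>\<^bsub>R\<^esub>"
      have c: "?c \<in> carrier ?F" using x by (auto simp: free_left_module_def)
      have "?\<pi> ?c = finsum P (\<lambda>b. ?c b \<odot>\<^bsub>P\<^esub> b) {x}"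
        by (rule linear_combination_eq_finsum[OF P c]) (use x in auto)
      also have "\<dots> = x" using x by simp
      finally show "x \<in> ?\<pi> ` carrier ?F" using c by (metis image_eqI)
    qed
  qed
  moreover have "(\<lambda>x. x) \<in> module_hom R P P" by (rule module_homI) auto
  ultimately obtain h where h: "h \<in> module_hom R P ?F" and \<pi>h: "\<forall>x\<in>carrier P. ?\<pi> (h x) = x"
    using assms(1) P F \<pi> unfolding projective_module_def by meson
  have "\<forall>x\<in>carrier P. \<exists>y\<in>carrier N. e y = f x"
    using im by (metis image_iff image_subset_iff)
  then obtain v where v: "\<And>x. x \<in> carrier P \<Longrightarrow> v x \<in> carrier N \<and> e (v x) = f x" by metis
  let ?\<Sigma> = "linear_combination R N v"
  have \<Sigma>: "?\<Sigma> \<in> module_hom R ?F N" by (rule linear_combination_hom[OF N]) (use v in auto)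
  have "e (?\<Sigma> (h x)) = f x" if x: "x \<in> carrier P" for x
  proof -
    have hx: "h x \<in> carrier ?F" using h x by (rule module_hom_closed)
    have "e (?\<Sigma> (h x)) = linear_combination R L (\<lambda>b. e (v b)) (h x)"
      by (rule module_hom_linear_combination[OF N L e _ hx]) (use v in auto)
    also have "\<dots> = linear_combination R L f (h x)"
      unfolding linear_combination_def
    proof (rule L.M.finsum_cong')
      note hx' = carrier_free_left_moduleD[OF P.R.ring_axioms hx]
      show "h x b \<odot>\<^bsub>L\<^esub> e (v b) = h x b \<odot>\<^bsub>L\<^esub> f b" if "b \<in> {b. h x b \<noteq> \<zero>\<^bsub>R\<^esub>}" for b
        using hx'(3) v that by auto
      show "(\<lambda>b. h x b \<odot>\<^bsub>L\<^esub> f b) \<in> {b. h x b \<noteq> \<zero>\<^bsub>R\<^esub>} \<rightarrow> carrier L"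
        using hx'(1,3) f by (auto intro!: L.smult_closed module_hom_closed[OF f])
    qed simp
    also have "\<dots> = f (?\<pi> (h x))"
      by (rule module_hom_linear_combination[OF P L f _ hx, symmetric]) auto
    finally show ?thesis using \<pi>h x by simp
  qed
  with that[OF module_hom_comp[OF h \<Sigma>]] show ?thesis by blast
qed

section \<open>A split first syzygy kills Ext in degrees at least two\<close>

text \<open>If \<open>s\<close> is a section of \<open>d 0\<close> over its image, then \<open>\<sigma> = s \<circ> d 0\<close> has the three properties assumed here;
this form avoids maps that are defined on a submodule only. A map \<open>\<rho>\<close> on \<open>P (n + 1)\<close> with
\<open>d n \<circ> \<rho> = d n\<close> that vanishes on cycles makes \<open>x - \<rho> x\<close> a cycle for every \<open>x\<close>, hence a boundary, and
projectivity turns this into a map \<open>\<theta>\<close> with \<open>d (n + 1) (\<theta> x) = x - \<rho> x\<close>. On cycles \<open>\<theta>\<close> is then a section,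
and \<open>\<theta> \<circ> d (n + 1)\<close> serves as \<open>\<rho>\<close> in the next degree.\<close>

lemma contraction_exists:
  assumes res: "projective_resolution R M P d \<epsilon>"
    and \<sigma>: "\<sigma> \<in> module_hom R (P 1) (P 1)"
      "\<And>x. x \<in> carrier (P 1) \<Longrightarrow> d 0 (\<sigma> x) = d 0 x"
      "\<And>x. \<lbrakk>x \<in> carrier (P 1); d 0 x = \<zero>\<^bsub>P 0\<^esub>\<rbrakk> \<Longrightarrow> \<sigma> x = \<zero>\<^bsub>P 1\<^esub>"
  shows "\<exists>\<theta>\<in>module_hom R (P (Suc n)) (P (Suc (Suc n))).
    \<forall>x\<in>carrier (P (Suc n)). d n x = \<zero>\<^bsub>P n\<^esub> \<longrightarrow> d (Suc n) (\<theta> x) = x"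
proof -
  have proj: "projective_module R (P n)" for n
    using res by (simp add: projective_resolution_def)
  have P: "left_module R (P n)" for n
    using proj by (simp add: projective_module_def)
  note ab = left_module.axioms(2)[OF P]
  have d: "d n \<in> module_hom R (P (Suc n)) (P n)" for n
    using res by (simp add: projective_resolution_def)
  have exact: "d (Suc n) ` carrier (P (Suc (Suc n))) = {x \<in> carrier (P (Suc n)). d n x = \<zero>\<^bsub>P n\<^esub>}" for n
    using res by (simp add: projective_resolution_def)
  have lift: "\<exists>\<theta>\<in>module_hom R (P (Suc n)) (P (Suc (Suc n))).
      \<forall>x\<in>carrier (P (Suc n)). d n x = \<zero>\<^bsub>P n\<^esub> \<longrightarrow> d (Suc n) (\<theta> x) = x"
    if \<rho>: "\<rho> \<in> module_hom R (P (Suc n)) (P (Suc n))"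
      and \<rho>1: "\<And>x. x \<in> carrier (P (Suc n)) \<Longrightarrow> d n (\<rho> x) = d n x"
      and \<rho>2: "\<And>x. \<lbrakk>x \<in> carrier (P (Suc n)); d n x = \<zero>\<^bsub>P n\<^esub>\<rbrakk> \<Longrightarrow> \<rho> x = \<zero>\<^bsub>P (Suc n)\<^esub>" for n \<rho>
  proof -
    interpret Pn: abelian_group "P n" by (rule ab)
    interpret PS: abelian_group "P (Suc n)" by (rule ab)
    let ?f = "\<lambda>x. x \<ominus>\<^bsub>P (Suc n)\<^esub> \<rho> x"
    have id: "(\<lambda>x. x) \<in> module_hom R (P (Suc n)) (P (Suc n))" by (rule module_homI) auto
    have f: "?f \<in> module_hom R (P (Suc n)) (P (Suc n))"
      by (rule module_hom_minus_hom[OF P id \<rho>])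
    have "?f x \<in> d (Suc n) ` carrier (P (Suc (Suc n)))" if "x \<in> carrier (P (Suc n))" for x
      unfolding exact using that \<rho>1[OF that]
      by (simp add: module_hom_closed[OF f] module_hom_closed[OF \<rho>] module_hom_closed[OF d]
          module_hom_minus[OF d ab ab] Pn.r_neg Pn.minus_eq)
    then have "?f ` carrier (P (Suc n)) \<subseteq> d (Suc n) ` carrier (P (Suc (Suc n)))" by blast
    from projective_module_lift[OF proj P P d f this] obtain \<theta>
      where \<theta>: "\<theta> \<in> module_hom R (P (Suc n)) (P (Suc (Suc n)))"
        and "\<And>x. x \<in> carrier (P (Suc n)) \<Longrightarrow> d (Suc n) (\<theta> x) = ?f x" by blast
    then show ?thesis using \<rho>2 by (intro bexI[OF _ \<theta>]) (simp add: PS.minus_eq)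
  qed
  show ?thesis
  proof (induction n)
    case 0
    show ?case using lift[of \<sigma> 0] \<sigma> by simp
  next
    case (Suc n)
    then obtain \<theta> where \<theta>: "\<theta> \<in> module_hom R (P (Suc n)) (P (Suc (Suc n)))"
      and d\<theta>: "\<And>x. \<lbrakk>x \<in> carrier (P (Suc n)); d n x = \<zero>\<^bsub>P n\<^esub>\<rbrakk> \<Longrightarrow> d (Suc n) (\<theta> x) = x" by blast
    show ?case
    proof (rule lift[of "\<lambda>x. \<theta> (d (Suc n) x)"])
      show "(\<lambda>x. \<theta> (d (Suc n) x)) \<in> module_hom R (P (Suc (Suc n))) (P (Suc (Suc n)))"
        by (rule module_hom_comp[OF d \<theta>])
      show "d (Suc n) (\<theta> (d (Suc n) x)) = d (Suc n) x" if "x \<in> carrier (P (Suc (Suc n)))" for x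
        using exact[of n] that by (intro d\<theta>) auto
      show "\<theta> (d (Suc n) x) = \<zero>\<^bsub>P (Suc (Suc n))\<^esub>" if "d (Suc n) x = \<zero>\<^bsub>P (Suc n)\<^esub>" for x
        using that module_hom_zero[OF \<theta> ab ab] by simp
    qed
  qed
qed

lemma module_hom_restrict:
  assumes "left_module R M" "f \<in> module_hom R M N"
  shows "(\<lambda>x\<in>carrier M. f x) \<in> module_hom R M N"
proof -
  interpret M: left_module R M by fact
  show ?thesis using assms(2)
    by (intro module_homI) (auto simp: module_hom_closed module_hom_add module_hom_smult)
qed

lemma comm_group_Hom_group:
  assumes "left_module R M" "left_module R N"
  shows "comm_group (Hom_group R M N)"
proof -
  interpret M: left_module R M by fact
  interpret N: left_module R N by fact
  have zero: "(\<lambda>x. \<zero>\<^bsub>N\<^esub>) \<in> module_hom R M N" by (rule module_homI) auto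
  note restr = module_hom_restrict[OF assms(1)]
  show ?thesis
  proof (rule comm_groupI)
    fix f g assume "f \<in> carrier (Hom_group R M N)" "g \<in> carrier (Hom_group R M N)"
    then show "f \<otimes>\<^bsub>Hom_group R M N\<^esub> g \<in> carrier (Hom_group R M N)"
      by (auto simp: Hom_group_def intro!: restr module_hom_add_hom[OF assms(2)])
  next
    show "\<one>\<^bsub>Hom_group R M N\<^esub> \<in> carrier (Hom_group R M N)"
      using restr[OF zero] by (simp add: Hom_group_def)
  next
    fix f assume f: "f \<in> carrier (Hom_group R M N)"
    have "(\<lambda>x\<in>carrier M. \<zero>\<^bsub>N\<^esub> \<ominus>\<^bsub>N\<^esub> f x) \<in> carrier (Hom_group R M N)"
      using f restr[OF module_hom_minus_hom[OF assms(2) zero]] by (simp add: Hom_group_def)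
    moreover have "(\<lambda>x\<in>carrier M. \<zero>\<^bsub>N\<^esub> \<ominus>\<^bsub>N\<^esub> f x) \<otimes>\<^bsub>Hom_group R M N\<^esub> f = \<one>\<^bsub>Hom_group R M N\<^esub>"
      using f by (auto simp: Hom_group_def N.M.minus_eq N.M.l_neg module_hom_closed)
    ultimately show "\<exists>h\<in>carrier (Hom_group R M N). h \<otimes>\<^bsub>Hom_group R M N\<^esub> f = \<one>\<^bsub>Hom_group R M N\<^esub>"
      by blast
  qed (auto simp: Hom_group_def module_hom_closed N.M.a_ac extensional_def fun_eq_iff)
qed

lemma (in group) trivial_group_self_quotient: "trivial_group (G Mod carrier G)"
proof -
  have "group (G Mod carrier G)"
    by (rule normal.factorgroup_is_group) (rule normal_invI[OF subgroup_self], simp)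
  moreover have "carrier (G Mod carrier G) = {\<one>\<^bsub>G Mod carrier G\<^esub>}"
    using coset_join2[OF _ subgroup_self] by (auto simp: FactGroup_def RCOSETS_def)
  ultimately show ?thesis by (simp add: trivial_group_def)
qed

text \<open>Let \<open>\<theta>\<close> be the contraction into degree \<open>r\<close>. For a cocycle \<open>f\<close> the map \<open>f \<circ> \<theta>\<close> has coboundary \<open>f\<close>:
the difference \<open>\<theta> (d y) - y\<close> is a cycle, hence a boundary, and \<open>f\<close> vanishes on boundaries.\<close>

lemma Ext_group_trivial_if_syzygy_splits:
  assumes A: "left_module R A" and res: "projective_resolution R M P d \<epsilon>"
    and \<sigma>: "\<sigma> \<in> module_hom R (P 1) (P 1)"
      "\<And>x. x \<in> carrier (P 1) \<Longrightarrow> d 0 (\<sigma> x) = d 0 x"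
      "\<And>x. \<lbrakk>x \<in> carrier (P 1); d 0 x = \<zero>\<^bsub>P 0\<^esub>\<rbrakk> \<Longrightarrow> \<sigma> x = \<zero>\<^bsub>P 1\<^esub>"
    and "r > 1"
  shows "trivial_group (Ext_group R P d r A)"
proof -
  from \<open>r > 1\<close> obtain n where r: "r = Suc (Suc n)"
    by (auto dest!: less_imp_Suc_add)
  have P: "left_module R (P n)" for n
    using res by (simp add: projective_resolution_def projective_module_def)
  note ab = left_module.axioms(2)[OF P]
  interpret A: left_module R A by (rule A)
  interpret Pn: abelian_group "P n" by (rule ab)
  interpret P1: abelian_group "P (Suc n)" by (rule ab)
  interpret P2: abelian_group "P (Suc (Suc n))" by (rule ab)
  have d: "d n \<in> module_hom R (P (Suc n)) (P n)" for n
    using res by (simp add: projective_resolution_def)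
  have exact: "d (Suc n) ` carrier (P (Suc (Suc n))) = {x \<in> carrier (P (Suc n)). d n x = \<zero>\<^bsub>P n\<^esub>}" for n
    using res by (simp add: projective_resolution_def)
  obtain \<theta> where \<theta>: "\<theta> \<in> module_hom R (P (Suc n)) (P (Suc (Suc n)))"
    and d\<theta>: "\<And>x. \<lbrakk>x \<in> carrier (P (Suc n)); d n x = \<zero>\<^bsub>P n\<^esub>\<rbrakk> \<Longrightarrow> d (Suc n) (\<theta> x) = x"
    using bexE[OF contraction_exists[OF res \<sigma>, where n = n]] by metis
  let ?H = "Hom_group R (P (Suc (Suc n))) A" and ?Z = "Ext_cocycles R P d r A"
  interpret H: comm_group ?H by (rule comm_group_Hom_group[OF P A])
  have Z: "subgroup ?Z ?H"
  proof
    show "?Z \<subseteq> carrier ?H" by (auto simp: Ext_cocycles_def r)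
    show "\<one>\<^bsub>?H\<^esub> \<in> ?Z"
      using H.one_closed by (auto simp: Ext_cocycles_def r Hom_group_def module_hom_closed[OF d])
    fix f g assume f: "f \<in> ?Z" and g: "g \<in> ?Z"
    then have "f \<otimes>\<^bsub>?H\<^esub> g \<in> carrier ?H" by (intro H.m_closed) (auto simp: Ext_cocycles_def r)
    then show "f \<otimes>\<^bsub>?H\<^esub> g \<in> ?Z"
      using f g by (auto simp: Ext_cocycles_def r Hom_group_def module_hom_closed[OF d])
  next
    fix f assume f: "f \<in> ?Z"
    then have fH: "f \<in> carrier ?H" by (auto simp: Ext_cocycles_def r)
    have "(inv\<^bsub>?H\<^esub> f) (d (Suc (Suc n)) x) = \<zero>\<^bsub>A\<^esub>" if x: "x \<in> carrier (P (Suc (Suc (Suc n))))" for x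
    proof -
      note dx = module_hom_closed[OF d x]
      have "((inv\<^bsub>?H\<^esub> f) \<otimes>\<^bsub>?H\<^esub> f) (d (Suc (Suc n)) x) = \<zero>\<^bsub>A\<^esub>"
        using H.l_inv[OF fH] dx by (simp add: Hom_group_def)
      moreover have "f (d (Suc (Suc n)) x) = \<zero>\<^bsub>A\<^esub>" using f x by (auto simp: Ext_cocycles_def r)
      moreover have "(inv\<^bsub>?H\<^esub> f) (d (Suc (Suc n)) x) \<in> carrier A"
        using H.inv_closed[OF fH] dx by (auto simp: Hom_group_def module_hom_closed)
      ultimately show ?thesis using dx by (simp add: Hom_group_def)
    qed
    then show "inv\<^bsub>?H\<^esub> f \<in> ?Z" using H.inv_closed[OF fH] by (auto simp: Ext_cocycles_def r)
  qed
  have "Ext_coboundaries R P d r A = ?Z"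
  proof
    show "Ext_coboundaries R P d r A \<subseteq> ?Z"
    proof
      fix f assume "f \<in> Ext_coboundaries R P d r A"
      then obtain g where g: "g \<in> module_hom R (P (Suc n)) A"
        and f: "f = (\<lambda>x\<in>carrier (P (Suc (Suc n))). g (d (Suc n) x))"
        by (auto simp: Ext_coboundaries_def r Hom_group_def)
      have "f \<in> module_hom R (P (Suc (Suc n))) A" unfolding f
        by (rule module_hom_restrict[OF P module_hom_comp[OF d g]])
      moreover have "f (d (Suc (Suc n)) x) = \<zero>\<^bsub>A\<^esub>" if x: "x \<in> carrier (P (Suc (Suc (Suc n))))" for x
      proof -
        have "d (Suc (Suc n)) x \<in> {x \<in> carrier (P (Suc (Suc n))). d (Suc n) x = \<zero>\<^bsub>P (Suc n)\<^esub>}"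
          using exact[of "Suc n"] x by blast
        then show ?thesis
          by (simp add: f module_hom_zero[OF g P1.abelian_group_axioms A.M.abelian_group_axioms])
      qed
      ultimately show "f \<in> ?Z" by (auto simp: Ext_cocycles_def r Hom_group_def f)
    qed
    show "?Z \<subseteq> Ext_coboundaries R P d r A"
    proof
      fix f assume "f \<in> ?Z"
      then have f: "f \<in> module_hom R (P (Suc (Suc n))) A" and ext: "f \<in> extensional (carrier (P (Suc (Suc n))))"
        and fd: "\<And>x. x \<in> carrier (P (Suc (Suc (Suc n)))) \<Longrightarrow> f (d (Suc (Suc n)) x) = \<zero>\<^bsub>A\<^esub>"
        by (auto simp: Ext_cocycles_def r Hom_group_def)
      define g where "g = (\<lambda>x\<in>carrier (P (Suc n)). f (\<theta> x))"
      have "g \<in> module_hom R (P (Suc n)) A"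
        unfolding g_def by (rule module_hom_restrict[OF P module_hom_comp[OF \<theta> f]])
      then have "g \<in> carrier (Hom_group R (P (Suc n)) A)" by (simp add: Hom_group_def g_def)
      moreover have "f = (\<lambda>x\<in>carrier (P (Suc (Suc n))). g (d (Suc n) x))"
      proof (rule extensionalityI[OF ext])
        fix y assume y: "y \<in> carrier (P (Suc (Suc n)))"
        note dy = module_hom_closed[OF d y]
        note \<theta>dy = module_hom_closed[OF \<theta> dy]
        have "d n (d (Suc n) y) = \<zero>\<^bsub>P n\<^esub>" using exact[of n] y by blast
        then have "d (Suc n) (\<theta> (d (Suc n) y) \<ominus>\<^bsub>P (Suc (Suc n))\<^esub> y) = \<zero>\<^bsub>P (Suc n)\<^esub>"
          using module_hom_minus[OF d ab ab \<theta>dy y] d\<theta>[OF dy] dy by (simp add: P1.minus_eq P1.r_neg)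
        then have "\<theta> (d (Suc n) y) \<ominus>\<^bsub>P (Suc (Suc n))\<^esub> y \<in> d (Suc (Suc n)) ` carrier (P (Suc (Suc (Suc n))))"
          unfolding exact using \<theta>dy y by simp
        then have "f (\<theta> (d (Suc n) y) \<ominus>\<^bsub>P (Suc (Suc n))\<^esub> y) = \<zero>\<^bsub>A\<^esub>" using fd by auto
        then have "f (\<theta> (d (Suc n) y)) \<ominus>\<^bsub>A\<^esub> f y = \<zero>\<^bsub>A\<^esub>"
          using module_hom_minus[OF f ab A.M.abelian_group_axioms \<theta>dy y] by simp
        then have "f (\<theta> (d (Suc n) y)) = f y"
          using module_hom_closed[OF f] \<theta>dy y by (simp add: A.M.minus_eq_zero_iff)
        then show "f y = (\<lambda>x\<in>carrier (P (Suc (Suc n))). g (d (Suc n) x)) y"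
          using y dy by (simp add: g_def)
      qed simp
      ultimately show "f \<in> Ext_coboundaries R P d r A"
        by (auto simp: Ext_coboundaries_def r)
    qed
  qed
  then show ?thesis
    using group.trivial_group_self_quotient[OF H.subgroup_imp_group[OF Z]]
    by (simp add: Ext_group_def r)
qed

section \<open>Linear extensions and permutation modules\<close>

lemma frag_extend_fun_diff:
  "frag_extend (\<lambda>x. f x - g x) c = frag_extend f c - frag_extend g c"
  using subset_UNIV[of "Poly_Mapping.keys c"]
  by (induction c rule: frag_induction) (auto simp: frag_extend_diff)

lemma frag_extend_fun_add:
  "frag_extend (\<lambda>x. f x + g x) c = frag_extend f c + frag_extend g c"
  using subset_UNIV[of "Poly_Mapping.keys c"]
  by (induction c rule: frag_induction) (auto simp: frag_extend_diff)

lemma frag_extend_frag_extend: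
  "frag_extend f (frag_extend g c) = frag_extend (\<lambda>x. frag_extend f (g x)) c"
  using subset_UNIV[of "Poly_Mapping.keys c"]
  by (induction c rule: frag_induction) (auto simp: frag_extend_diff)

lemma keys_diff_subset: "\<lbrakk>Poly_Mapping.keys a \<subseteq> S; Poly_Mapping.keys b \<subseteq> S\<rbrakk> \<Longrightarrow> Poly_Mapping.keys (a - b) \<subseteq> S"
  using keys_diff by fastforce

lemma keys_add_subset: "\<lbrakk>Poly_Mapping.keys a \<subseteq> S; Poly_Mapping.keys b \<subseteq> S\<rbrakk> \<Longrightarrow> Poly_Mapping.keys (a + b) \<subseteq> S"
  using Poly_Mapping.keys_add by fastforce

lemma keys_frag_extend_subset:
  "\<lbrakk>Poly_Mapping.keys c \<subseteq> S; \<And>x. x \<in> S \<Longrightarrow> Poly_Mapping.keys (f x) \<subseteq> T\<rbrakk> \<Longrightarrow>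
    Poly_Mapping.keys (frag_extend f c) \<subseteq> T"
  using keys_frag_extend by fastforce

text \<open>The bilinear extension of \<open>act\<close>. Multiplication in a group ring and the scalar multiplication of a
permutation module are both of this form.\<close>

definition linear_action :: "('g \<Rightarrow> 'y \<Rightarrow> 'y) \<Rightarrow> ('g \<Rightarrow>\<^sub>0 int) \<Rightarrow> ('y \<Rightarrow>\<^sub>0 int) \<Rightarrow> ('y \<Rightarrow>\<^sub>0 int)" where
  "linear_action act r a = frag_extend (\<lambda>g. frag_extend (\<lambda>y. frag_of (act g y)) a) r"

lemma linear_action_add_left: "linear_action act (r + s) a = linear_action act r a + linear_action act s a"
  and linear_action_diff_left: "linear_action act (r - s) a = linear_action act r a - linear_action act s a"
  and linear_action_add_right: "linear_action act r (a + b) = linear_action act r a + linear_action act r b"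
  and linear_action_diff_right: "linear_action act r (a - b) = linear_action act r a - linear_action act r b"
  and linear_action_zero_left [simp]: "linear_action act 0 a = 0"
  and linear_action_zero_right [simp]: "linear_action act r 0 = 0"
  and linear_action_of: "linear_action act (frag_of g) a = frag_extend (\<lambda>y. frag_of (act g y)) a"
  by (auto simp: linear_action_def frag_extend_add frag_extend_diff frag_extend_fun_add
      frag_extend_fun_diff frag_extend_eq_0)

lemma keys_linear_action:
  assumes "Poly_Mapping.keys r \<subseteq> S" "Poly_Mapping.keys a \<subseteq> Y"
    and "\<And>g y. \<lbrakk>g \<in> S; y \<in> Y\<rbrakk> \<Longrightarrow> act g y \<in> Z"
  shows "Poly_Mapping.keys (linear_action act r a) \<subseteq> Z"
  unfolding linear_action_def using assms by (intro keys_frag_extend_subset) auto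

text \<open>With \<open>act\<close> the group multiplication this is associativity of the group ring; in general it is the
module axiom for a permutation module.\<close>

lemma linear_action_assoc:
  assumes "Poly_Mapping.keys r \<subseteq> S" "Poly_Mapping.keys s \<subseteq> S" "Poly_Mapping.keys a \<subseteq> Y"
    and "\<And>g h y. \<lbrakk>g \<in> S; h \<in> S; y \<in> Y\<rbrakk> \<Longrightarrow> act (m g h) y = act g (act h y)"
  shows "linear_action act (linear_action m r s) a = linear_action act r (linear_action act s a)"
  using assms(1)
proof (induction r rule: frag_induction)
  case (one g)
  from assms(2) show ?case
  proof (induction s rule: frag_induction)
    case (one h)
    from assms(3) show ?case
      by (induction a rule: frag_induction)
        (use one \<open>g \<in> S\<close> assms(4) in \<open>auto simp: linear_action_of frag_extend_diff\<close>)
  qed (auto simp: linear_action_diff_left linear_action_diff_right)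
qed (auto simp: linear_action_diff_left)

lemma group_ring_simps [simp]:
  "carrier (group_ring G) = {a. Poly_Mapping.keys a \<subseteq> carrier G}"
  "\<one>\<^bsub>group_ring G\<^esub> = frag_of \<one>\<^bsub>G\<^esub>"
  "\<zero>\<^bsub>group_ring G\<^esub> = 0"
  "a \<oplus>\<^bsub>group_ring G\<^esub> b = a + b"
  "a \<otimes>\<^bsub>group_ring G\<^esub> b = linear_action (\<lambda>g h. g \<otimes>\<^bsub>G\<^esub> h) a b"
  by (auto simp: group_ring_def free_Abelian_group_def linear_action_def)

lemma linear_action_one:
  assumes "Poly_Mapping.keys a \<subseteq> Y" "\<And>y. y \<in> Y \<Longrightarrow> act g y = y"
  shows "linear_action act (frag_of g) a = a"
  using assms(1) by (induction a rule: frag_induction)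
    (auto simp: linear_action_of frag_extend_diff assms(2))

lemma ring_group_ring:
  assumes "group G"
  shows "ring (group_ring G)"
proof -
  interpret G: group G by fact
  show ?thesis
  proof (rule ringI)
    show "abelian_group (group_ring G)"
    proof (rule abelian_groupI)
      fix a assume "a \<in> carrier (group_ring G)"
      then show "\<exists>b\<in>carrier (group_ring G). b \<oplus>\<^bsub>group_ring G\<^esub> a = \<zero>\<^bsub>group_ring G\<^esub>"
        by (intro bexI[of _ "- a"]) auto
    qed (auto simp: keys_add_subset dest!: subsetD[OF Poly_Mapping.keys_add])
    show "monoid (group_ring G)"
    proof (rule monoidI)
      fix a assume "a \<in> carrier (group_ring G)"
      then have a: "Poly_Mapping.keys a \<subseteq> carrier G" by simp
      then show "\<one>\<^bsub>group_ring G\<^esub> \<otimes>\<^bsub>group_ring G\<^esub> a = a"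
        by (auto intro: linear_action_one)
      from a show "a \<otimes>\<^bsub>group_ring G\<^esub> \<one>\<^bsub>group_ring G\<^esub> = a"
        by (induction a rule: frag_induction) (auto simp: linear_action_diff_left linear_action_of)
    qed (auto intro!: linear_action_assoc[where S = "carrier G"] G.m_assoc
         dest!: subsetD[OF keys_linear_action[where S = "carrier G" and Y = "carrier G" and Z = "carrier G"], rotated -1])
  qed (auto simp: linear_action_add_left linear_action_add_right)
qed

lemma
  assumes "left_module (group_ring H) M" "x \<in> carrier M"
  shows smult_group_ring_diff:
      "\<lbrakk>Poly_Mapping.keys a \<subseteq> carrier H; Poly_Mapping.keys b \<subseteq> carrier H\<rbrakk> \<Longrightarrow>
        (a - b) \<odot>\<^bsub>M\<^esub> x = a \<odot>\<^bsub>M\<^esub> x \<ominus>\<^bsub>M\<^esub> b \<odot>\<^bsub>M\<^esub> x"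
    and smult_frag_of_mult:
      "\<lbrakk>g \<in> carrier H; h \<in> carrier H\<rbrakk> \<Longrightarrow>
        frag_of (g \<otimes>\<^bsub>H\<^esub> h) \<odot>\<^bsub>M\<^esub> x = frag_of g \<odot>\<^bsub>M\<^esub> (frag_of h \<odot>\<^bsub>M\<^esub> x)"
    and smult_frag_of_one: "frag_of \<one>\<^bsub>H\<^esub> \<odot>\<^bsub>M\<^esub> x = x"
    and smult_frag_of_closed: "g \<in> carrier H \<Longrightarrow> frag_of g \<odot>\<^bsub>M\<^esub> x \<in> carrier M"
proof -
  interpret M: left_module "group_ring H" M by fact
  show "(a - b) \<odot>\<^bsub>M\<^esub> x = a \<odot>\<^bsub>M\<^esub> x \<ominus>\<^bsub>M\<^esub> b \<odot>\<^bsub>M\<^esub> x"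
    if "Poly_Mapping.keys a \<subseteq> carrier H" "Poly_Mapping.keys b \<subseteq> carrier H"
  proof -
    have "a \<odot>\<^bsub>M\<^esub> x = (a - b) \<odot>\<^bsub>M\<^esub> x \<oplus>\<^bsub>M\<^esub> b \<odot>\<^bsub>M\<^esub> x"
      using M.smult_l_distr[of "a - b" b x] that assms(2) by (simp add: keys_diff_subset)
    then show ?thesis
      using that assms(2) by (simp add: M.M.minus_eq M.M.a_assoc M.M.r_neg keys_diff_subset)
  qed
  show "frag_of (g \<otimes>\<^bsub>H\<^esub> h) \<odot>\<^bsub>M\<^esub> x = frag_of g \<odot>\<^bsub>M\<^esub> (frag_of h \<odot>\<^bsub>M\<^esub> x)"
    if "g \<in> carrier H" "h \<in> carrier H"
    using M.smult_assoc1[of "frag_of g" "frag_of h" x] that assms(2) by (simp add: linear_action_of)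
  show "frag_of \<one>\<^bsub>H\<^esub> \<odot>\<^bsub>M\<^esub> x = x" using M.smult_one assms(2) by simp
  show "g \<in> carrier H \<Longrightarrow> frag_of g \<odot>\<^bsub>M\<^esub> x \<in> carrier M" using assms(2) by simp
qed

lemma module_hom_group_ringI:
  assumes M: "left_module (group_ring H) M" and N: "left_module (group_ring H) N"
    and closed: "\<And>x. x \<in> carrier M \<Longrightarrow> f x \<in> carrier N"
    and add: "\<And>x y. \<lbrakk>x \<in> carrier M; y \<in> carrier M\<rbrakk> \<Longrightarrow> f (x \<oplus>\<^bsub>M\<^esub> y) = f x \<oplus>\<^bsub>N\<^esub> f y"
    and equivariant: "\<And>g x. \<lbrakk>g \<in> carrier H; x \<in> carrier M\<rbrakk> \<Longrightarrow>
      f (frag_of g \<odot>\<^bsub>M\<^esub> x) = frag_of g \<odot>\<^bsub>N\<^esub> f x"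
  shows "f \<in> module_hom (group_ring H) M N"
proof (rule module_homI[OF closed add])
  interpret M: left_module "group_ring H" M by fact
  interpret N: left_module "group_ring H" N by fact
  interpret f: abelian_group_hom M N f
    using closed add
    by (intro abelian_group_homI group_hom.intro group_hom_axioms.intro M.M.a_group N.M.a_group
        M.M.abelian_group_axioms N.M.abelian_group_axioms) (auto simp: hom_def)
  fix a x assume "a \<in> carrier (group_ring H)" and x: "x \<in> carrier M"
  then have "Poly_Mapping.keys a \<subseteq> carrier H" by simp
  then have "Poly_Mapping.keys a \<subseteq> carrier H \<and> f (a \<odot>\<^bsub>M\<^esub> x) = a \<odot>\<^bsub>N\<^esub> f x"
  proof (induction a rule: frag_induction)
    case zero
    then show ?case using M.smult_zero_left[OF x] N.smult_zero_left[OF closed[OF x]] by simp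
  next
    case (one g)
    then show ?case using equivariant x by simp
  next
    case (diff a b)
    then show ?case
      using smult_group_ring_diff[OF M x, of a b] smult_group_ring_diff[OF N closed[OF x], of a b] x
      by (simp add: keys_diff_subset M.M.minus_eq N.M.minus_eq closed)
  qed
  then show "f (a \<odot>\<^bsub>M\<^esub> x) = a \<odot>\<^bsub>N\<^esub> f x" by simp
qed

lemma additive_extension:
  assumes "abelian_group N" "f \<in> Y \<rightarrow> carrier N"
  obtains F where "F \<in> hom (free_Abelian_group Y) (add_monoid N)" "\<And>y. y \<in> Y \<Longrightarrow> F (frag_of y) = f y"
proof -
  interpret N: comm_group "add_monoid N" by (rule abelian_group.a_comm_group[OF assms(1)])
  show ?thesis
    using N.free_Abelian_group_universal[of f Y] assms(2) that by (auto simp: image_subset_iff_funcset)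
qed

lemma
  assumes N: "abelian_group N" and F: "F \<in> hom (free_Abelian_group Y) (add_monoid N)"
  shows additive_closed: "Poly_Mapping.keys c \<subseteq> Y \<Longrightarrow> F c \<in> carrier N"
    and additive_add: "\<lbrakk>Poly_Mapping.keys c \<subseteq> Y; Poly_Mapping.keys c' \<subseteq> Y\<rbrakk> \<Longrightarrow> F (c + c') = F c \<oplus>\<^bsub>N\<^esub> F c'"
    and additive_zero: "F 0 = \<zero>\<^bsub>N\<^esub>"
    and additive_diff: "\<lbrakk>Poly_Mapping.keys c \<subseteq> Y; Poly_Mapping.keys c' \<subseteq> Y\<rbrakk> \<Longrightarrow> F (c - c') = F c \<ominus>\<^bsub>N\<^esub> F c'"
proof -
  interpret N: abelian_group N by fact
  show cl: "F c \<in> carrier N" if "Poly_Mapping.keys c \<subseteq> Y" for c using F that by (auto simp: hom_def)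
  show add: "F (c + c') = F c \<oplus>\<^bsub>N\<^esub> F c'"
    if "Poly_Mapping.keys c \<subseteq> Y" "Poly_Mapping.keys c' \<subseteq> Y" for c c'
    using F that by (auto simp: hom_def)
  show "F 0 = \<zero>\<^bsub>N\<^esub>"
    using hom_one[OF F group_free_Abelian_group N.a_group] by simp
  show "F (c - c') = F c \<ominus>\<^bsub>N\<^esub> F c'"
    if "Poly_Mapping.keys c \<subseteq> Y" "Poly_Mapping.keys c' \<subseteq> Y"
    using add[of "c - c'" c'] that cl[of c'] cl[of "c - c'"]
    by (simp add: keys_diff_subset N.minus_eq N.a_assoc N.r_neg)
qed

lemma additive_eqI:
  assumes N: "abelian_group N"
    and F: "F \<in> hom (free_Abelian_group Y) (add_monoid N)" "F' \<in> hom (free_Abelian_group Y) (add_monoid N)"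
    and "\<And>y. y \<in> Y \<Longrightarrow> F (frag_of y) = F' (frag_of y)" and "Poly_Mapping.keys c \<subseteq> Y"
  shows "F c = F' c"
proof -
  have "Poly_Mapping.keys c \<subseteq> Y \<and> F c = F' c" using assms(5)
    by (induction c rule: frag_induction)
      (auto simp: additive_zero[OF N F(1)] additive_zero[OF N F(2)] assms(4)
        additive_diff[OF N F(1)] additive_diff[OF N F(2)] intro: keys_diff_subset[THEN subsetD])
  then show ?thesis ..
qed

lemma additive_sum:
  assumes N: "abelian_group N"
    and F: "F \<in> hom (free_Abelian_group Y) (add_monoid N)" "F' \<in> hom (free_Abelian_group Y) (add_monoid N)"
  shows "(\<lambda>c. F c \<oplus>\<^bsub>N\<^esub> F' c) \<in> hom (free_Abelian_group Y) (add_monoid N)"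
proof -
  interpret N: abelian_group N by fact
  show ?thesis
    by (auto simp: hom_def additive_closed[OF N F(1)] additive_closed[OF N F(2)]
      additive_add[OF N F(1)] additive_add[OF N F(2)] N.a_ac)
qed

lemma additive_comp:
  assumes F: "F \<in> hom (free_Abelian_group Y) (add_monoid N)" and f: "f \<in> module_hom R N L"
  shows "(\<lambda>c. f (F c)) \<in> hom (free_Abelian_group Y) (add_monoid L)"
  using F f by (auto simp: hom_def Pi_iff module_hom_closed module_hom_add)

lemma additive_frag_extend:
  assumes F: "F \<in> hom (free_Abelian_group Y) (add_monoid N)"
    and "\<And>x. x \<in> X \<Longrightarrow> Poly_Mapping.keys (f x) \<subseteq> Y"
  shows "(\<lambda>c. F (frag_extend f c)) \<in> hom (free_Abelian_group X) (add_monoid N)"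
  using F keys_frag_extend_subset[of _ X f Y, OF _ assms(2)]
  by (auto simp: hom_def Pi_iff frag_extend_add)

definition permutation_module ::
  "('h \<Rightarrow> 'y \<Rightarrow> 'y) \<Rightarrow> 'y set \<Rightarrow> ('h \<Rightarrow>\<^sub>0 int, 'y \<Rightarrow>\<^sub>0 int) module" where
  "permutation_module act Y =
     \<lparr>carrier = {c. Poly_Mapping.keys c \<subseteq> Y},
      monoid.mult = undefined, one = undefined,
      zero = 0, add = (+), smult = linear_action act\<rparr>"

lemma permutation_module_simps [simp]:
  "carrier (permutation_module act Y) = {c. Poly_Mapping.keys c \<subseteq> Y}"
  "\<zero>\<^bsub>permutation_module act Y\<^esub> = 0"
  "a \<oplus>\<^bsub>permutation_module act Y\<^esub> b = a + b"
  "r \<odot>\<^bsub>permutation_module act Y\<^esub> a = linear_action act r a"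
  by (auto simp: permutation_module_def)

locale group_set = group H for H :: "('h, 'm) monoid_scheme" (structure) +
  fixes act :: "'h \<Rightarrow> 'x \<Rightarrow> 'x" and X :: "'x set"
  assumes act_closed [simp]: "\<lbrakk>g \<in> carrier H; x \<in> X\<rbrakk> \<Longrightarrow> act g x \<in> X"
    and act_one [simp]: "x \<in> X \<Longrightarrow> act \<one> x = x"
    and act_mult: "\<lbrakk>g \<in> carrier H; h \<in> carrier H; x \<in> X\<rbrakk> \<Longrightarrow> act (g \<otimes> h) x = act g (act h x)"
begin

lemma left_module_permutation_module: "left_module (group_ring H) (permutation_module act X)"
proof (intro left_module.intro left_module_axioms.intro ring_group_ring group_axioms)
  show "abelian_group (permutation_module act X)"
  proof (rule abelian_groupI)
    fix a assume "a \<in> carrier (permutation_module act X)"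
    then show "\<exists>b\<in>carrier (permutation_module act X).
        b \<oplus>\<^bsub>permutation_module act X\<^esub> a = \<zero>\<^bsub>permutation_module act X\<^esub>"
      by (intro bexI[of _ "- a"]) auto
  qed (auto dest!: subsetD[OF Poly_Mapping.keys_add])
qed (auto simp: linear_action_add_left linear_action_add_right intro!: linear_action_one
      linear_action_assoc[where S = "carrier H" and Y = X] act_mult
      dest!: subsetD[OF keys_linear_action[where S = "carrier H" and Y = X and Z = X], rotated -1])

lemma permutation_module_hom:
  assumes N: "left_module (group_ring H) N"
    and F: "F \<in> hom (free_Abelian_group X) (add_monoid N)"
    and eq: "\<And>g x. \<lbrakk>g \<in> carrier H; x \<in> X\<rbrakk> \<Longrightarrow> F (frag_of (act g x)) = frag_of g \<odot>\<^bsub>N\<^esub> F (frag_of x)"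
  shows "F \<in> module_hom (group_ring H) (permutation_module act X) N"
proof (rule module_hom_group_ringI[OF left_module_permutation_module N])
  interpret N: left_module "group_ring H" N by fact
  note ab = N.M.abelian_group_axioms
  show "F c \<in> carrier N" if "c \<in> carrier (permutation_module act X)" for c
    using additive_closed[OF ab F] that by simp
  show "F (c \<oplus>\<^bsub>permutation_module act X\<^esub> c') = F c \<oplus>\<^bsub>N\<^esub> F c'"
    if "c \<in> carrier (permutation_module act X)" "c' \<in> carrier (permutation_module act X)" for c c'
    using additive_add[OF ab F] that by simp
  fix g c assume g: "g \<in> carrier H" and "c \<in> carrier (permutation_module act X)"
  then have c: "Poly_Mapping.keys c \<subseteq> X" by simp
  have "(\<lambda>c. frag_of g \<odot>\<^bsub>N\<^esub> F c) \<in> hom (free_Abelian_group X) (add_monoid N)"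
    using F g by (auto simp: hom_def N.smult_r_distr Pi_iff)
  from additive_eqI[OF ab additive_frag_extend[OF F] this _ c, of "\<lambda>x. frag_of (act g x)"]
  show "F (frag_of g \<odot>\<^bsub>permutation_module act X\<^esub> c) = frag_of g \<odot>\<^bsub>N\<^esub> F c"
    using g eq by (simp add: linear_action_of)
qed

end

section \<open>Derivations on infinite cyclic groups\<close>

text \<open>Crossed homomorphisms into \<open>N\<close>. Those of the form \<open>k \<mapsto> k p - p\<close> are the inner ones.\<close>

definition derivation ::
  "('h, 'm) monoid_scheme \<Rightarrow> 'h set \<Rightarrow> ('h \<Rightarrow>\<^sub>0 int, 'b, 'y) module_scheme \<Rightarrow> ('h \<Rightarrow> 'b) \<Rightarrow> bool" where
  "derivation H S N F \<longleftrightarrow> (\<forall>k\<in>S. F k \<in> carrier N) \<and>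
     (\<forall>k\<in>S. \<forall>l\<in>S. F (k \<otimes>\<^bsub>H\<^esub> l) = F k \<oplus>\<^bsub>N\<^esub> frag_of k \<odot>\<^bsub>N\<^esub> F l)"

definition infinite_order :: "('h, 'm) monoid_scheme \<Rightarrow> 'h \<Rightarrow> bool" where
  "infinite_order H c \<longleftrightarrow> inj (\<lambda>n::int. c [^]\<^bsub>H\<^esub> n)"

text \<open>Summation over integer intervals, read with the opposite sign to the left of \<open>0\<close>.\<close>

lemma (in abelian_group) int_indexed_primitive:
  fixes f :: "int \<Rightarrow> 'a"
  assumes f: "\<And>n. f n \<in> carrier G"
  obtains u where "\<And>n. u n \<in> carrier G" "u 0 = \<zero>" "\<And>n. u (n + 1) = u n \<oplus> f n"
proof
  define u where "u n = (if n \<ge> 0 then finsum G f {0..<n} else \<ominus> finsum G f {n..<0})" for n :: int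
  have fin: "finsum G f {a..<b} \<in> carrier G" for a b using f by auto
  show "u n \<in> carrier G" for n using fin by (simp add: u_def)
  show "u 0 = \<zero>" by (simp add: u_def)
  show "u (n + 1) = u n \<oplus> f n" for n
  proof (cases "n \<ge> 0")
    case True
    then have "{0..<n + 1} = insert n {0..<n}" by auto
    then show ?thesis using True f by (simp add: u_def a_comm)
  next
    case False
    then have split: "{n..<0} = insert n {n + 1..<0}" by auto
    have "u n = \<ominus> (f n \<oplus> finsum G f {n + 1..<0})"
      using False f by (simp add: u_def split)
    moreover have "u (n + 1) = \<ominus> finsum G f {n + 1..<0}"
      using False by (cases "n = -1") (auto simp: u_def minus_equality[of \<zero> \<zero>])
    ultimately show ?thesis using f fin by (simp add: minus_add a_ac r_neg2)
  qed
qed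

text \<open>A derivation may take any value \<open>q\<close> on a generator of infinite order, because its values on the
powers are forced to be the partial sums \<open>q + c q + \<dots> + c\<^sup>n\<^sup>-\<^sup>1 q\<close>, continued to negative \<open>n\<close>, and no relation
between the powers has to be respected.\<close>

lemma derivation_on_cyclic:
  assumes H: "group H" and N: "left_module (group_ring H) N"
    and c: "c \<in> carrier H" "infinite_order H c" and q: "q \<in> carrier N"
  obtains F where "derivation H (range (\<lambda>n::int. c [^]\<^bsub>H\<^esub> n)) N F" "F c = q"
proof -
  interpret H: group H by fact
  interpret N: left_module "group_ring H" N by fact
  note cl = smult_frag_of_closed[OF N]
  let ?p = "\<lambda>n::int. c [^]\<^bsub>H\<^esub> n"
  obtain u where u: "\<And>n. u n \<in> carrier N" "u 0 = \<zero>\<^bsub>N\<^esub>" "\<And>n. u (n + 1) = u n \<oplus>\<^bsub>N\<^esub> frag_of (?p n) \<odot>\<^bsub>N\<^esub> q"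
    using N.M.int_indexed_primitive[of "\<lambda>n. frag_of (?p n) \<odot>\<^bsub>N\<^esub> q"] cl q c by auto
  have step: "u (m + n) = u m \<oplus>\<^bsub>N\<^esub> frag_of (?p m) \<odot>\<^bsub>N\<^esub> u n \<longleftrightarrow>
      u (m + (n + 1)) = u m \<oplus>\<^bsub>N\<^esub> frag_of (?p m) \<odot>\<^bsub>N\<^esub> u (n + 1)" for m n
  proof -
    have e: "frag_of (?p m) \<odot>\<^bsub>N\<^esub> u (n + 1) = frag_of (?p m) \<odot>\<^bsub>N\<^esub> u n \<oplus>\<^bsub>N\<^esub> frag_of (?p (m + n)) \<odot>\<^bsub>N\<^esub> q"
      using c u q by (simp add: N.smult_r_distr cl H.int_pow_mult smult_frag_of_mult[OF N])
    have "u (m + (n + 1)) = u (m + n) \<oplus>\<^bsub>N\<^esub> frag_of (?p (m + n)) \<odot>\<^bsub>N\<^esub> q"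
      using u(3)[of "m + n"] by (simp add: add.assoc)
    then show ?thesis
      unfolding e using u c q cl by (simp flip: N.M.a_assoc)
  qed
  have mult: "u (m + n) = u m \<oplus>\<^bsub>N\<^esub> frag_of (?p m) \<odot>\<^bsub>N\<^esub> u n" for m n
  proof (induction n rule: int_induct[where k = 0])
    case base
    show ?case using u c by simp
  next
    case (step1 n)
    then show ?case using step[of m n] by simp
  next
    case (step2 n)
    then show ?case using step[of m "n - 1"] by simp
  qed
  define F where "F k = u (inv_into UNIV ?p k)" for k
  have F: "F (?p n) = u n" for n
    using c(2) by (simp add: F_def infinite_order_def)
  show ?thesis
  proof
    show "derivation H (range ?p) N F"
      unfolding derivation_def using u(1) mult c by (auto simp: F simp flip: H.int_pow_mult)
    show "F c = q" using F[of 1] u(2) u(3)[of 0] c q by (simp add: smult_frag_of_one[OF N])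
  qed
qed

lemma derivation_eqI_cyclic:
  assumes H: "group H" and N: "left_module (group_ring H) N" and c: "c \<in> carrier H"
    and F: "derivation H (range (\<lambda>n::int. c [^]\<^bsub>H\<^esub> n)) N F"
    and F': "derivation H (range (\<lambda>n::int. c [^]\<^bsub>H\<^esub> n)) N F'"
    and "F c = F' c" and "k \<in> range (\<lambda>n::int. c [^]\<^bsub>H\<^esub> n)"
  shows "F k = F' k"
proof -
  interpret H: group H by fact
  interpret N: left_module "group_ring H" N by fact
  note cl = smult_frag_of_closed[OF N]
  let ?p = "\<lambda>n::int. c [^]\<^bsub>H\<^esub> n"
  have D: "D (?p n) \<in> carrier N" "D \<one>\<^bsub>H\<^esub> = \<zero>\<^bsub>N\<^esub>"
    "D (?p (n + 1)) = D (?p n) \<oplus>\<^bsub>N\<^esub> frag_of (?p n) \<odot>\<^bsub>N\<^esub> D c"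
    if D: "derivation H (range ?p) N D" for D n
  proof -
    show cl': "D (?p n) \<in> carrier N" for n using D by (simp add: derivation_def)
    have mult: "D (?p m \<otimes>\<^bsub>H\<^esub> ?p n) = D (?p m) \<oplus>\<^bsub>N\<^esub> frag_of (?p m) \<odot>\<^bsub>N\<^esub> D (?p n)" for m n
      using D by (simp add: derivation_def)
    show "D \<one>\<^bsub>H\<^esub> = \<zero>\<^bsub>N\<^esub>"
      using mult[of 0 0] cl'[of 0] by (simp add: smult_frag_of_one[OF N])
    show "D (?p (n + 1)) = D (?p n) \<oplus>\<^bsub>N\<^esub> frag_of (?p n) \<odot>\<^bsub>N\<^esub> D c"
      using mult[of n 1] c by (simp add: H.int_pow_mult)
  qed
  have Dc: "D c \<in> carrier N" if D': "derivation H (range ?p) N D" for D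
    using D(1)[OF D', of 1] c by simp
  have "F (?p n) = F' (?p n)" for n
  proof (induction n rule: int_induct[where k = 0])
    case base
    show ?case using D(2)[OF F] D(2)[OF F'] by simp
  next
    case (step1 n)
    then show ?case using D(3)[OF F] D(3)[OF F'] assms(6) by simp
  next
    case (step2 n)
    then have "F (?p (n - 1)) \<oplus>\<^bsub>N\<^esub> frag_of (?p (n - 1)) \<odot>\<^bsub>N\<^esub> F c
      = F' (?p (n - 1)) \<oplus>\<^bsub>N\<^esub> frag_of (?p (n - 1)) \<odot>\<^bsub>N\<^esub> F c"
      using D(3)[OF F, of "n - 1"] D(3)[OF F', of "n - 1"] assms(6) by simp
    then show ?case using D(1)[OF F] D(1)[OF F'] cl Dc[OF F] c by simp
  qed
  then show ?thesis using assms(7) by auto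
qed

lemma inner_derivation:
  assumes "group H" "left_module (group_ring H) L" "p \<in> carrier L" "S \<subseteq> carrier H"
  shows "derivation H S L (\<lambda>k. frag_of k \<odot>\<^bsub>L\<^esub> p \<ominus>\<^bsub>L\<^esub> p)"
proof -
  interpret L: left_module "group_ring H" L by fact
  note cl = smult_frag_of_closed[OF assms(2)]
  have "frag_of (k \<otimes>\<^bsub>H\<^esub> l) \<odot>\<^bsub>L\<^esub> p \<ominus>\<^bsub>L\<^esub> p =
      (frag_of k \<odot>\<^bsub>L\<^esub> p \<ominus>\<^bsub>L\<^esub> p) \<oplus>\<^bsub>L\<^esub> frag_of k \<odot>\<^bsub>L\<^esub> (frag_of l \<odot>\<^bsub>L\<^esub> p \<ominus>\<^bsub>L\<^esub> p)"
    if "k \<in> carrier H" "l \<in> carrier H" for k l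
  proof -
    let ?a = "frag_of k \<odot>\<^bsub>L\<^esub> (frag_of l \<odot>\<^bsub>L\<^esub> p)" and ?b = "frag_of k \<odot>\<^bsub>L\<^esub> p"
    have "?a \<ominus>\<^bsub>L\<^esub> p = (?b \<ominus>\<^bsub>L\<^esub> p) \<oplus>\<^bsub>L\<^esub> (?a \<ominus>\<^bsub>L\<^esub> ?b)"
      using that cl assms(3) by (simp add: L.M.minus_eq L.M.a_ac L.M.r_neg1 L.M.r_neg2)
    then show ?thesis
      using that assms(3) cl
      by (simp add: smult_frag_of_mult[OF assms(2)] L.M.minus_eq L.smult_r_distr L.smult_uminus_right)
  qed
  then show ?thesis using assms(3,4) cl by (auto simp: derivation_def subset_iff)
qed

lemma derivation_image:
  assumes "derivation H S N F" "e \<in> module_hom (group_ring H) N L"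
    "left_module (group_ring H) N" "S \<subseteq> carrier H"
  shows "derivation H S L (\<lambda>k. e (F k))"
  using assms smult_frag_of_closed[OF assms(3)]
  by (auto simp: derivation_def module_hom_closed module_hom_add module_hom_smult subset_iff)

text \<open>On an infinite cyclic group every inner derivation of \<open>L\<close> whose value on the generator comes from \<open>N\<close>
lifts to \<open>N\<close>: choose any lift of that single value. This is what cohomological dimension one of the
stabilizers amounts to here.\<close>

lemma inner_derivation_lifts:
  assumes H: "group H" and N: "left_module (group_ring H) N" and L: "left_module (group_ring H) L"
    and e: "e \<in> module_hom (group_ring H) N L"
    and c: "c \<in> carrier H" "infinite_order H c \<or> c = \<one>\<^bsub>H\<^esub>"
    and S: "S = range (\<lambda>n::int. c [^]\<^bsub>H\<^esub> n)" and p: "p \<in> carrier L"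
    and im: "frag_of c \<odot>\<^bsub>L\<^esub> p \<ominus>\<^bsub>L\<^esub> p \<in> e ` carrier N"
  obtains F where "derivation H S N F" "\<And>k. k \<in> S \<Longrightarrow> e (F k) = frag_of k \<odot>\<^bsub>L\<^esub> p \<ominus>\<^bsub>L\<^esub> p"
proof -
  interpret H: group H by fact
  interpret N: left_module "group_ring H" N by fact
  interpret L: left_module "group_ring H" L by fact
  show ?thesis
  proof (cases "c = \<one>\<^bsub>H\<^esub>")
    case True
    have "S = {\<one>\<^bsub>H\<^esub>}" by (auto simp: S True)
    moreover have "e \<zero>\<^bsub>N\<^esub> = \<zero>\<^bsub>L\<^esub>"
      by (rule module_hom_zero[OF e N.M.abelian_group_axioms L.M.abelian_group_axioms])
    ultimately show ?thesis using p
      by (intro that[of "\<lambda>_. \<zero>\<^bsub>N\<^esub>"])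
         (auto simp: derivation_def smult_frag_of_one[OF N] smult_frag_of_one[OF L] L.M.minus_eq L.M.r_neg)
  next
    case False
    obtain q where q: "q \<in> carrier N" "e q = frag_of c \<odot>\<^bsub>L\<^esub> p \<ominus>\<^bsub>L\<^esub> p"
      using im by (metis imageE)
    obtain F where F: "derivation H S N F" "F c = q"
      using derivation_on_cyclic[OF H N c(1) _ q(1)] c(2) False unfolding S by blast
    have sub: "S \<subseteq> carrier H" using c by (auto simp: S)
    show ?thesis
    proof (rule that[OF F(1)])
      fix k assume "k \<in> S"
      then show "e (F k) = frag_of k \<odot>\<^bsub>L\<^esub> p \<ominus>\<^bsub>L\<^esub> p"
        using derivation_eqI_cyclic[OF H L c(1) derivation_image[OF F(1) e N sub, unfolded S]
            inner_derivation[OF H L p sub, unfolded S]] F(2) q(2)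
        unfolding S by simp
    qed
  qed
qed

section \<open>The kernel of a free cover of a permutation module\<close>

text \<open>For a set of orbit representatives \<open>t\<close>, the free module on them covers \<open>\<int>[X]\<close> by \<open>(h, t) \<mapsto> h t\<close>. Its kernel
is a direct sum of modules induced from the augmentation ideals of the stabilizers. When these are
trivial or infinite cyclic the kernel is free; what is needed, and proved below, is that homomorphisms
on the kernel lift along epimorphisms.\<close>

locale cyclic_stabilizers = group_set H act X
  for H :: "('h, 'm) monoid_scheme" (structure) and act :: "'h \<Rightarrow> 'x \<Rightarrow> 'x" and X :: "'x set" +
  assumes stabilizer:
    "x \<in> X \<Longrightarrow> \<exists>c\<in>carrier H. (infinite_order H c \<or> c = \<one>) \<and>
       {g \<in> carrier H. act g x = x} = range (\<lambda>n::int. c [^] n)"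
begin

definition orbit :: "'x \<Rightarrow> 'x set" where
  "orbit x = {act g x | g. g \<in> carrier H}"

definition orbit_rep :: "'x \<Rightarrow> 'x" where
  "orbit_rep x = (SOME y. y \<in> orbit x)"

definition transporter :: "'x \<Rightarrow> 'h" where
  "transporter x = (SOME g. g \<in> carrier H \<and> act g (orbit_rep x) = x)"

lemma act_inv: "\<lbrakk>g \<in> carrier H; x \<in> X\<rbrakk> \<Longrightarrow> act (inv g) (act g x) = x"
  using act_mult[of "inv g" g x] by simp

lemma orbit_act:
  assumes "g \<in> carrier H" "x \<in> X"
  shows "orbit (act g x) = orbit x"
proof -
  have sub: "orbit (act k y) \<subseteq> orbit y" if "k \<in> carrier H" "y \<in> X" for k y
    using that by (auto simp: orbit_def simp flip: act_mult)
  show ?thesis using sub[OF assms] sub[of "inv g" "act g x"] assms by (auto simp: act_inv)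
qed

lemma orbit_rep_act: "\<lbrakk>g \<in> carrier H; x \<in> X\<rbrakk> \<Longrightarrow> orbit_rep (act g x) = orbit_rep x"
  by (simp add: orbit_rep_def orbit_act)

lemma orbit_rep_in_orbit: "x \<in> X \<Longrightarrow> orbit_rep x \<in> orbit x"
  unfolding orbit_rep_def by (rule someI[of _ x]) (auto simp: orbit_def intro!: exI[of _ \<one>])

lemma orbit_rep_closed [simp]: "x \<in> X \<Longrightarrow> orbit_rep x \<in> X"
  using orbit_rep_in_orbit[of x] by (auto simp: orbit_def)

lemma orbit_rep_orbit_rep [simp]: "x \<in> X \<Longrightarrow> orbit_rep (orbit_rep x) = orbit_rep x"
  using orbit_rep_in_orbit[of x] by (auto simp: orbit_def orbit_rep_act)

lemma
  assumes "x \<in> X"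
  shows transporter_closed [simp]: "transporter x \<in> carrier H" and act_transporter: "act (transporter x) (orbit_rep x) = x"
proof -
  obtain g where g: "g \<in> carrier H" "orbit_rep x = act g x"
    using orbit_rep_in_orbit[OF assms] by (auto simp: orbit_def)
  then have "inv g \<in> carrier H \<and> act (inv g) (orbit_rep x) = x" using assms by (simp add: act_inv)
  from someI[of "\<lambda>g. g \<in> carrier H \<and> act g (orbit_rep x) = x", OF this]
  show "transporter x \<in> carrier H" "act (transporter x) (orbit_rep x) = x" by (auto simp: transporter_def)
qed

text \<open>Left translation of the first components makes this the integral basis of the free module on the orbit
representatives.\<close>

definition cover_basis :: "('h \<times> 'x) set" where
  "cover_basis = carrier H \<times> orbit_rep ` X"

definition cover_act :: "'h \<Rightarrow> 'h \<times> 'x \<Rightarrow> 'h \<times> 'x" where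
  "cover_act g = (\<lambda>(h, t). (g \<otimes> h, t))"

definition cover_map :: "('h \<times> 'x \<Rightarrow>\<^sub>0 int) \<Rightarrow> ('x \<Rightarrow>\<^sub>0 int)" where
  "cover_map = frag_extend (\<lambda>(h, t). frag_of (act h t))"

sublocale cover: group_set H cover_act cover_basis
  by unfold_locales (auto simp: cover_act_def cover_basis_def m_assoc)

lemma keys_cover_map: "Poly_Mapping.keys c \<subseteq> cover_basis \<Longrightarrow> Poly_Mapping.keys (cover_map c) \<subseteq> X"
  unfolding cover_map_def
  by (rule keys_frag_extend_subset[where S = cover_basis]) (auto simp: cover_basis_def)

lemma cover_map_hom:
  "cover_map \<in> module_hom (group_ring H) (permutation_module cover_act cover_basis) (permutation_module act X)"
proof (rule cover.permutation_module_hom[OF left_module_permutation_module])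
  show "cover_map \<in> hom (free_Abelian_group cover_basis) (add_monoid (permutation_module act X))"
    using keys_cover_map by (auto simp: hom_def cover_map_def frag_extend_add)
qed (auto simp: cover_map_def cover_basis_def cover_act_def linear_action_of act_mult)

lemma cover_map_surj:
  "cover_map ` carrier (permutation_module cover_act cover_basis) = carrier (permutation_module act X)"
proof
  show "cover_map ` carrier (permutation_module cover_act cover_basis) \<subseteq> carrier (permutation_module act X)"
    using keys_cover_map by auto
  show "carrier (permutation_module act X) \<subseteq> cover_map ` carrier (permutation_module cover_act cover_basis)"
  proof
    fix c assume "c \<in> carrier (permutation_module act X)"
    then have "Poly_Mapping.keys c \<subseteq> X" by simp
    then have "\<exists>z. Poly_Mapping.keys z \<subseteq> cover_basis \<and> cover_map z = c"
    proof (induction c rule: frag_induction)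
      case zero
      then show ?case by (intro exI[of _ 0]) (auto simp: cover_map_def)
    next
      case (one x)
      then show ?case
        by (intro exI[of _ "frag_of (transporter x, orbit_rep x)"]) (auto simp: cover_map_def cover_basis_def act_transporter)
    next
      case (diff a b)
      then obtain y z where "Poly_Mapping.keys y \<subseteq> cover_basis" "cover_map y = a"
        "Poly_Mapping.keys z \<subseteq> cover_basis" "cover_map z = b" by blast
      then show ?case
        by (intro exI[of _ "y - z"]) (auto simp: cover_map_def frag_extend_diff keys_diff_subset[THEN subsetD])
    qed
    then show "c \<in> cover_map ` carrier (permutation_module cover_act cover_basis)" by auto
  qed
qed

lemma cover_hom_extension:
  assumes L: "left_module (group_ring H) L" and p: "p \<in> orbit_rep ` X \<rightarrow> carrier L"
  obtains \<phi> where "\<phi> \<in> module_hom (group_ring H) (permutation_module cover_act cover_basis) L"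
    "\<And>h t. (h, t) \<in> cover_basis \<Longrightarrow> \<phi> (frag_of (h, t)) = frag_of h \<odot>\<^bsub>L\<^esub> p t"
proof -
  interpret L: left_module "group_ring H" L by fact
  let ?f = "\<lambda>(h, t). frag_of h \<odot>\<^bsub>L\<^esub> p t"
  have "?f \<in> cover_basis \<rightarrow> carrier L"
    using p by (auto simp: cover_basis_def intro!: smult_frag_of_closed[OF L])
  from additive_extension[OF L.M.abelian_group_axioms this] obtain \<phi>
    where \<phi>: "\<phi> \<in> hom (free_Abelian_group cover_basis) (add_monoid L)"
      "\<And>y. y \<in> cover_basis \<Longrightarrow> \<phi> (frag_of y) = ?f y" by blast
  have "\<phi> \<in> module_hom (group_ring H) (permutation_module cover_act cover_basis) L"
  proof (rule cover.permutation_module_hom[OF L \<phi>(1)])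
    fix g y assume gy: "g \<in> carrier H" "y \<in> cover_basis"
    then show "\<phi> (frag_of (cover_act g y)) = frag_of g \<odot>\<^bsub>L\<^esub> \<phi> (frag_of y)"
      using \<phi>(2)[OF gy(2)] \<phi>(2)[OF cover.act_closed[OF gy]] p
      by (auto simp: cover_act_def cover_basis_def smult_frag_of_mult[OF L] Pi_iff)
  qed
  with \<phi>(2) that show ?thesis by auto
qed

text \<open>Over \<open>x = h t\<close> write \<open>h = s k\<close>, where \<open>s\<close> is the chosen element carrying \<open>t\<close> to \<open>x\<close> and \<open>k\<close> fixes \<open>t\<close>, and
send \<open>(h, t)\<close> to \<open>s (F k)\<close>, where the derivation \<open>F\<close> lifts \<open>k \<mapsto> k p - p\<close> for the value \<open>p\<close> of \<open>\<phi>\<close> at \<open>t\<close>. The additive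
extension \<open>\<Theta>\<close> is neither a lift of \<open>\<phi>\<close> nor equivariant, but both defects depend on \<open>(h, t)\<close> through \<open>x\<close>
alone. Hence they factor through the cover map and vanish on its kernel.\<close>

lemma kernel_lift:
  assumes N: "left_module (group_ring H) N" and L: "left_module (group_ring H) L"
    and e: "e \<in> module_hom (group_ring H) N L"
    and \<phi>: "\<phi> \<in> module_hom (group_ring H) (permutation_module cover_act cover_basis) L"
    and p: "p \<in> orbit_rep ` X \<rightarrow> carrier L"
    and \<phi>p: "\<And>h t. (h, t) \<in> cover_basis \<Longrightarrow> \<phi> (frag_of (h, t)) = frag_of h \<odot>\<^bsub>L\<^esub> p t"
    and im: "\<And>t k. \<lbrakk>t \<in> orbit_rep ` X; k \<in> carrier H; act k t = t\<rbrakk> \<Longrightarrow>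
      frag_of k \<odot>\<^bsub>L\<^esub> p t \<ominus>\<^bsub>L\<^esub> p t \<in> e ` carrier N"
  shows "\<exists>\<Theta>\<in>hom (free_Abelian_group cover_basis) (add_monoid N).
    \<forall>z. Poly_Mapping.keys z \<subseteq> cover_basis \<and> cover_map z = 0 \<longrightarrow> e (\<Theta> z) = \<phi> z \<and>
      (\<forall>g\<in>carrier H. \<Theta> (linear_action cover_act (frag_of g) z) = frag_of g \<odot>\<^bsub>N\<^esub> \<Theta> z)"
proof -
  interpret N: left_module "group_ring H" N by fact
  interpret L: left_module "group_ring H" L by fact
  note abN = N.M.abelian_group_axioms and abL = L.M.abelian_group_axioms
  note cl = smult_frag_of_closed[OF N] smult_frag_of_closed[OF L]
  let ?S = "\<lambda>t. {g \<in> carrier H. act g t = t}"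
  have "\<forall>t\<in>orbit_rep ` X. \<exists>F. derivation H (?S t) N F \<and>
      (\<forall>k\<in>?S t. e (F k) = frag_of k \<odot>\<^bsub>L\<^esub> p t \<ominus>\<^bsub>L\<^esub> p t)"
  proof
    fix t assume t: "t \<in> orbit_rep ` X"
    have tX: "t \<in> X" using t by auto
    obtain c where c: "c \<in> carrier H" "infinite_order H c \<or> c = \<one>" "?S t = range (\<lambda>n::int. c [^] n)"
      using stabilizer[OF tX] by blast
    have "c [^] (1::int) \<in> ?S t" unfolding c(3) by (rule rangeI)
    then have "act c t = t" using c(1) by simp
    from im[OF t c(1) this] have im': "frag_of c \<odot>\<^bsub>L\<^esub> p t \<ominus>\<^bsub>L\<^esub> p t \<in> e ` carrier N" .
    have pt: "p t \<in> carrier L" using p t by (rule funcset_mem)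
    show "\<exists>F. derivation H (?S t) N F \<and> (\<forall>k\<in>?S t. e (F k) = frag_of k \<odot>\<^bsub>L\<^esub> p t \<ominus>\<^bsub>L\<^esub> p t)"
      by (rule inner_derivation_lifts[OF group_axioms N L e c pt im']) blast
  qed
  from bchoice[OF this] obtain F where FeF: "\<forall>t\<in>orbit_rep ` X. derivation H (?S t) N (F t) \<and>
      (\<forall>k\<in>?S t. e (F t k) = frag_of k \<odot>\<^bsub>L\<^esub> p t \<ominus>\<^bsub>L\<^esub> p t)" ..
  have F: "derivation H (?S t) N (F t)" if "t \<in> orbit_rep ` X" for t
    using bspec[OF FeF that] by (rule conjunct1)
  have eF: "e (F t k) = frag_of k \<odot>\<^bsub>L\<^esub> p t \<ominus>\<^bsub>L\<^esub> p t" if "t \<in> orbit_rep ` X" "k \<in> ?S t" for t k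
    using bspec[OF conjunct2[OF bspec[OF FeF that(1)]] that(2)] .
  have Fcl: "F t k \<in> carrier N" if "t \<in> orbit_rep ` X" "k \<in> ?S t" for t k
    using F[OF that(1)] that(2) by (simp add: derivation_def)
  have stab: "inv (transporter (act h t)) \<otimes> h \<in> ?S t" if "(h, t) \<in> cover_basis" for h t
  proof -
    have h: "h \<in> carrier H" and t: "t \<in> X" "orbit_rep t = t" using that by (auto simp: cover_basis_def)
    have x: "act h t \<in> X" "orbit_rep (act h t) = t" using h t by (auto simp: orbit_rep_act)
    have "act (inv (transporter (act h t))) (act h t) = t"
      using act_inv[of "transporter (act h t)" t] act_transporter[OF x(1)] x t by simp
    then show ?thesis using h t x by (simp add: act_mult)
  qed
  let ?\<theta> = "\<lambda>(h, t). frag_of (transporter (act h t)) \<odot>\<^bsub>N\<^esub> F t (inv (transporter (act h t)) \<otimes> h)"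
  have transporter': "transporter (act h t) \<in> carrier H" if "(h, t) \<in> cover_basis" for h t
    using that by (auto simp: cover_basis_def)
  have "?\<theta> \<in> cover_basis \<rightarrow> carrier N"
  proof clarify
    fix h t assume ht: "(h, t) \<in> cover_basis"
    then have "t \<in> orbit_rep ` X" by (simp add: cover_basis_def)
    from cl(1)[OF Fcl[OF this stab[OF ht]] transporter'[OF ht]]
    show "frag_of (transporter (act h t)) \<odot>\<^bsub>N\<^esub> F t (inv (transporter (act h t)) \<otimes> h) \<in> carrier N" .
  qed
  from additive_extension[OF abN this] obtain \<Theta>
    where \<Theta>: "\<Theta> \<in> hom (free_Abelian_group cover_basis) (add_monoid N)"
      and \<Theta>': "\<And>y. y \<in> cover_basis \<Longrightarrow> \<Theta> (frag_of y) = ?\<theta> y" by blast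
  have cover_map_keys: "Poly_Mapping.keys (case y of (h, t) \<Rightarrow> frag_of (act h t)) \<subseteq> X" if "y \<in> cover_basis" for y
    using that by (auto simp: cover_basis_def)
  show ?thesis
  proof (intro bexI[OF _ \<Theta>] allI impI conjI ballI; elim conjE)
    fix z assume z: "Poly_Mapping.keys z \<subseteq> cover_basis" "cover_map z = 0"
    \<comment> \<open>The defect of \<open>\<Theta>\<close> as a lift of \<open>\<phi>\<close>, as a function on \<open>X\<close>.\<close>
    have "(\<lambda>x. frag_of (transporter x) \<odot>\<^bsub>L\<^esub> p (orbit_rep x)) \<in> X \<rightarrow> carrier L"
      using p by (auto intro!: cl)
    from additive_extension[OF abL this] obtain D
      where D: "D \<in> hom (free_Abelian_group X) (add_monoid L)"
        and D': "\<And>x. x \<in> X \<Longrightarrow> D (frag_of x) = frag_of (transporter x) \<odot>\<^bsub>L\<^esub> p (orbit_rep x)" by blast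
    have "e (\<Theta> z) \<oplus>\<^bsub>L\<^esub> D (cover_map z) = \<phi> z"
      unfolding cover_map_def
    proof (rule additive_eqI[OF abL additive_sum[OF abL additive_comp[OF \<Theta> e]
            additive_frag_extend[OF D cover_map_keys]] _ _ z(1)])
      show "\<phi> \<in> hom (free_Abelian_group cover_basis) (add_monoid L)"
        using \<phi> by (auto simp: hom_def module_hom_def)
      fix y assume y: "y \<in> cover_basis"
      obtain h t where yht: "y = (h, t)" by fastforce
      with y have ht: "(h, t) \<in> cover_basis" by simp
      then have h: "h \<in> carrier H" and t: "t \<in> X" "orbit_rep t = t" "t \<in> orbit_rep ` X"
        by (auto simp: cover_basis_def)
      have pt: "p t \<in> carrier L" using p t by auto
      let ?s = "transporter (act h t)"
      note s = transporter'[OF ht] and k = stab[OF ht]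
      have "e (\<Theta> (frag_of y)) = frag_of ?s \<odot>\<^bsub>L\<^esub> e (F t (inv ?s \<otimes> h))"
        using \<Theta>'[OF y] module_hom_smult[OF e Fcl[OF t(3) k]] s by (simp add: yht)
      also have "\<dots> = frag_of ?s \<odot>\<^bsub>L\<^esub> (frag_of (inv ?s \<otimes> h) \<odot>\<^bsub>L\<^esub> p t) \<ominus>\<^bsub>L\<^esub> frag_of ?s \<odot>\<^bsub>L\<^esub> p t"
        using eF[OF t(3) k] k pt s cl(2)
        by (simp add: L.M.minus_eq L.smult_r_distr L.smult_uminus_right)
      also have "frag_of ?s \<odot>\<^bsub>L\<^esub> (frag_of (inv ?s \<otimes> h) \<odot>\<^bsub>L\<^esub> p t) = frag_of h \<odot>\<^bsub>L\<^esub> p t"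
        using s h pt by (simp flip: smult_frag_of_mult[OF L] m_assoc)
      finally have "e (\<Theta> (frag_of y)) = frag_of h \<odot>\<^bsub>L\<^esub> p t \<ominus>\<^bsub>L\<^esub> frag_of ?s \<odot>\<^bsub>L\<^esub> p t" .
      then show "e (\<Theta> (frag_of y)) \<oplus>\<^bsub>L\<^esub> D (frag_extend (\<lambda>(h, t). frag_of (act h t)) (frag_of y)) = \<phi> (frag_of y)"
        using D'[of "act h t"] h t \<phi>p[OF ht] cl(2)[OF pt] s
        by (simp add: yht orbit_rep_act L.M.minus_eq L.M.a_assoc L.M.l_neg)
    qed
    then show "e (\<Theta> z) = \<phi> z"
      using additive_zero[OF abL D] additive_closed[OF abN \<Theta> z(1)] e z(2)
      by (simp add: module_hom_closed)
  next
    fix g z assume g: "g \<in> carrier H" and z: "Poly_Mapping.keys z \<subseteq> cover_basis" "cover_map z = 0"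
    \<comment> \<open>Applying \<open>g\<close> over \<open>x\<close> multiplies the stabilizer component from the left by \<open>?m x\<close>. By the product rule for
      derivations this changes the value of \<open>\<Theta>\<close> by a term that depends on \<open>x\<close> only.\<close>
    let ?m = "\<lambda>x. inv (transporter (act g x)) \<otimes> g \<otimes> transporter x"
    have m: "?m x \<in> ?S (orbit_rep x)" if x: "x \<in> X" for x
      using stab[of "g \<otimes> transporter x" "orbit_rep x"] x g by (simp add: cover_basis_def act_mult act_transporter m_assoc)
    have "(\<lambda>x. frag_of (transporter (act g x)) \<odot>\<^bsub>N\<^esub> F (orbit_rep x) (?m x)) \<in> X \<rightarrow> carrier N"
      using g m by (auto intro!: cl Fcl)
    from additive_extension[OF abN this] obtain D
      where D: "D \<in> hom (free_Abelian_group X) (add_monoid N)"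
        and D': "\<And>x. x \<in> X \<Longrightarrow> D (frag_of x) = frag_of (transporter (act g x)) \<odot>\<^bsub>N\<^esub> F (orbit_rep x) (?m x)" by blast
    have g_hom: "(\<lambda>c. frag_of g \<odot>\<^bsub>N\<^esub> \<Theta> c) \<in> hom (free_Abelian_group cover_basis) (add_monoid N)"
      using \<Theta> g by (auto simp: hom_def N.smult_r_distr Pi_iff)
    have "\<Theta> (frag_extend (\<lambda>y. frag_of (cover_act g y)) z) = D (cover_map z) \<oplus>\<^bsub>N\<^esub> frag_of g \<odot>\<^bsub>N\<^esub> \<Theta> z"
      unfolding cover_map_def
    proof (rule additive_eqI[OF abN additive_frag_extend[OF \<Theta>] additive_sum[OF abN
            additive_frag_extend[OF D cover_map_keys] g_hom] _ z(1)])
      fix y assume y: "y \<in> cover_basis"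
      show "Poly_Mapping.keys (frag_of (cover_act g y)) \<subseteq> cover_basis" using y g by simp
      obtain h t where yht: "y = (h, t)" by fastforce
      with y have ht: "(h, t) \<in> cover_basis" by simp
      then have h: "h \<in> carrier H" and t: "t \<in> X" "orbit_rep t = t" "t \<in> orbit_rep ` X"
        by (auto simp: cover_basis_def)
      let ?x = "act h t"
      let ?s = "transporter ?x" and ?s' = "transporter (act g ?x)"
      have x: "?x \<in> X" "orbit_rep ?x = t" using h t by (auto simp: orbit_rep_act)
      note s = transporter'[OF ht] and k = stab[OF ht]
      have s': "?s' \<in> carrier H" using x g by simp
      have mx: "?m ?x \<in> ?S t" using m[OF x(1)] x(2) by simp
      have "?s \<otimes> (inv ?s \<otimes> h) = h" using s h by (simp add: m_assoc[symmetric])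
      then have "inv ?s' \<otimes> (g \<otimes> h) = ?m ?x \<otimes> (inv ?s \<otimes> h)"
        using s s' g h by (simp add: m_assoc)
      then have "F t (inv ?s' \<otimes> (g \<otimes> h)) = F t (?m ?x) \<oplus>\<^bsub>N\<^esub> frag_of (?m ?x) \<odot>\<^bsub>N\<^esub> F t (inv ?s \<otimes> h)"
        using F[OF t(3)] mx k by (simp add: derivation_def)
      moreover have "frag_of ?s' \<odot>\<^bsub>N\<^esub> (frag_of (?m ?x) \<odot>\<^bsub>N\<^esub> F t (inv ?s \<otimes> h))
          = frag_of g \<odot>\<^bsub>N\<^esub> (frag_of ?s \<odot>\<^bsub>N\<^esub> F t (inv ?s \<otimes> h))"
      proof -
        have "?s' \<otimes> ?m ?x = g \<otimes> ?s" using s s' g by (simp add: m_assoc[symmetric])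
        then show ?thesis
          using s s' g Fcl[OF t(3) k] mx by (simp flip: smult_frag_of_mult[OF N])
      qed
      ultimately have "?\<theta> (cover_act g y) = frag_of ?s' \<odot>\<^bsub>N\<^esub> F t (?m ?x) \<oplus>\<^bsub>N\<^esub> frag_of g \<odot>\<^bsub>N\<^esub> ?\<theta> y"
        using s s' g h t Fcl[OF t(3) k] Fcl[OF t(3) mx] mx cl(1)
        by (simp add: yht cover_act_def act_mult N.smult_r_distr)
      then show "\<Theta> (frag_extend (\<lambda>y. frag_of (cover_act g y)) (frag_of y)) =
          D (frag_extend (\<lambda>(h, t). frag_of (act h t)) (frag_of y)) \<oplus>\<^bsub>N\<^esub> frag_of g \<odot>\<^bsub>N\<^esub> \<Theta> (frag_of y)"
        using \<Theta>'[OF y] \<Theta>'[OF cover.act_closed[OF g y]] D'[OF x(1)] x(2) by (simp add: yht)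
    qed
    then show "\<Theta> (linear_action cover_act (frag_of g) z) = frag_of g \<odot>\<^bsub>N\<^esub> \<Theta> z"
      using additive_zero[OF abN D] additive_closed[OF abN \<Theta> z(1)] z(2) g cl(1)
      by (simp add: linear_action_of)
  qed
qed

text \<open>The argument of Schanuel's lemma. Let \<open>Q\<close> be the free cover of \<open>M\<close>, and let \<open>\<phi> : Q \<rightarrow> P 0\<close> and
\<open>\<psi> : P 0 \<rightarrow> Q\<close> be maps over \<open>M\<close>. On the syzygy of \<open>P\<close>, the part \<open>\<phi> \<circ> \<psi>\<close> of the identity factors through the kernel
of the cover and lifts to \<open>P 1\<close> by \<open>\<Theta>\<close>; the remaining part \<open>x - \<phi> (\<psi> x)\<close> is defined on all of \<open>P 0\<close> and lifts
to \<open>P 1\<close> by projectivity.\<close>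

lemma syzygy_splits:
  assumes M: "left_module (group_ring H) M"
    and \<iota>: "\<iota> \<in> module_hom (group_ring H) (permutation_module act X) M"
    and bij: "bij_betw \<iota> (carrier (permutation_module act X)) (carrier M)"
    and res: "projective_resolution (group_ring H) M P d \<epsilon>"
  shows "\<exists>\<sigma>\<in>module_hom (group_ring H) (P 1) (P 1). \<forall>x\<in>carrier (P 1).
    d 0 (\<sigma> x) = d 0 x \<and> (d 0 x = \<zero>\<^bsub>P 0\<^esub> \<longrightarrow> \<sigma> x = \<zero>\<^bsub>P 1\<^esub>)"
proof -
  note [simp del] = One_nat_def
  let ?R = "group_ring H" and ?Q = "permutation_module cover_act cover_basis"
  have proj: "projective_module ?R (P n)" for n
    using res by (simp add: projective_resolution_def)
  have P: "left_module ?R (P n)" for n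
    using proj by (simp add: projective_module_def)
  note ab = left_module.axioms(2)[OF P]
  interpret M: left_module ?R M by (rule M)
  interpret P0: left_module ?R "P 0" by (rule P)
  interpret P1: left_module ?R "P 1" by (rule P)
  note Q = cover.left_module_permutation_module
  note abM = M.M.abelian_group_axioms and abQ = left_module.axioms(2)[OF Q]
  note abX = left_module.axioms(2)[OF left_module_permutation_module]
  have d: "d 0 \<in> module_hom ?R (P 1) (P 0)"
    using res by (simp add: projective_resolution_def One_nat_def)
  have \<epsilon>: "\<epsilon> \<in> module_hom ?R (P 0) M" and \<epsilon>_surj: "\<epsilon> ` carrier (P 0) = carrier M"
    and exact: "d 0 ` carrier (P 1) = {x \<in> carrier (P 0). \<epsilon> x = \<zero>\<^bsub>M\<^esub>}"
    using res by (simp_all add: projective_resolution_def One_nat_def)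
  note d_cl = module_hom_closed[OF d] and \<epsilon>_cl = module_hom_closed[OF \<epsilon>]
  let ?\<pi> = "\<lambda>z. \<iota> (cover_map z)"
  have \<pi>: "?\<pi> \<in> module_hom ?R ?Q M" by (rule module_hom_comp[OF cover_map_hom \<iota>])
  have "?\<pi> ` carrier ?Q = \<iota> ` (cover_map ` carrier ?Q)" by (rule image_image[symmetric])
  then have \<pi>_surj: "?\<pi> ` carrier ?Q = carrier M"
    using bij unfolding cover_map_surj by (simp add: bij_betw_def)
  have \<pi>_ker: "cover_map z = 0" if "z \<in> carrier ?Q" "?\<pi> z = \<zero>\<^bsub>M\<^esub>" for z
  proof -
    have "\<iota> 0 = \<zero>\<^bsub>M\<^esub>" using module_hom_zero[OF \<iota> abX abM] by simp
    then show ?thesis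
      using bij that module_hom_closed[OF cover_map_hom that(1)]
      by (auto simp: bij_betw_def dest!: inj_onD[of _ _ "cover_map z" 0])
  qed
  have "\<exists>y. y \<in> carrier (P 0) \<and> \<epsilon> y = \<iota> (frag_of t)" if "t \<in> orbit_rep ` X" for t
  proof -
    have "\<iota> (frag_of t) \<in> \<epsilon> ` carrier (P 0)"
      unfolding \<epsilon>_surj using that by (intro module_hom_closed[OF \<iota>]) auto
    then show ?thesis by force
  qed
  then obtain p where p: "p \<in> orbit_rep ` X \<rightarrow> carrier (P 0)"
    and \<epsilon>p: "\<And>t. t \<in> orbit_rep ` X \<Longrightarrow> \<epsilon> (p t) = \<iota> (frag_of t)"
    by (metis Pi_I)
  have \<epsilon>hp: "\<epsilon> (frag_of h \<odot>\<^bsub>P 0\<^esub> p t) = \<iota> (frag_of (act h t))" if "h \<in> carrier H" "t \<in> orbit_rep ` X" for h t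
    using that module_hom_smult[OF \<epsilon> funcset_mem[OF p], of t "frag_of h"]
      module_hom_smult[OF \<iota>, of "frag_of t" "frag_of h"] \<epsilon>p[OF that(2)]
    by (auto simp: linear_action_of)
  obtain \<phi> where \<phi>: "\<phi> \<in> module_hom ?R ?Q (P 0)"
    and \<phi>p: "\<And>h t. (h, t) \<in> cover_basis \<Longrightarrow> \<phi> (frag_of (h, t)) = frag_of h \<odot>\<^bsub>P 0\<^esub> p t"
    using cover_hom_extension[OF P p] by blast
  have \<epsilon>\<phi>: "\<epsilon> (\<phi> z) = ?\<pi> z" if "Poly_Mapping.keys z \<subseteq> cover_basis" for z
  proof (rule additive_eqI[OF abM _ _ _ that])
    show "(\<lambda>z. \<epsilon> (\<phi> z)) \<in> hom (free_Abelian_group cover_basis) (add_monoid M)"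
      using module_hom_comp[OF \<phi> \<epsilon>] by (auto simp: hom_def module_hom_def)
    show "?\<pi> \<in> hom (free_Abelian_group cover_basis) (add_monoid M)"
      using \<pi> by (auto simp: hom_def module_hom_def)
    show "\<epsilon> (\<phi> (frag_of y)) = ?\<pi> (frag_of y)" if "y \<in> cover_basis" for y
      using that \<epsilon>hp \<phi>p by (auto simp: cover_basis_def cover_map_def)
  qed
  obtain \<psi> where \<psi>: "\<psi> \<in> module_hom ?R (P 0) ?Q"
    and \<pi>\<psi>: "\<And>x. x \<in> carrier (P 0) \<Longrightarrow> ?\<pi> (\<psi> x) = \<epsilon> x"
    using projective_module_lift[OF proj Q M \<pi> \<epsilon>] \<epsilon>_surj \<pi>_surj by auto
  \<comment> \<open>Both \<open>\<phi>\<close> and \<open>\<psi>\<close> are maps over \<open>M\<close>, so this difference takes values in the syzygy.\<close>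
  let ?f = "\<lambda>x. x \<ominus>\<^bsub>P 0\<^esub> \<phi> (\<psi> x)"
  have id: "(\<lambda>x. x) \<in> module_hom ?R (P 0) (P 0)" by (rule module_homI) auto
  note \<phi>\<psi> = module_hom_comp[OF \<psi> \<phi>]
  have f: "?f \<in> module_hom ?R (P 0) (P 0)" by (rule module_hom_minus_hom[OF P id \<phi>\<psi>])
  have "\<epsilon> (?f x) = \<zero>\<^bsub>M\<^esub>" if x: "x \<in> carrier (P 0)" for x
  proof -
    have "\<epsilon> (\<phi> (\<psi> x)) = \<epsilon> x"
      using \<epsilon>\<phi>[of "\<psi> x"] \<pi>\<psi>[OF x] module_hom_closed[OF \<psi> x] by simp
    then show ?thesis
      using module_hom_minus[OF \<epsilon> ab abM x module_hom_closed[OF \<phi>\<psi> x]] \<epsilon>_cl[OF x]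
      by (simp add: M.M.minus_eq_zero_iff)
  qed
  then have "?f ` carrier (P 0) \<subseteq> d 0 ` carrier (P 1)"
    unfolding exact using module_hom_closed[OF f] by blast
  from projective_module_lift[OF proj P P d f this] obtain \<theta>
    where \<theta>: "\<theta> \<in> module_hom ?R (P 0) (P 1)" and d\<theta>: "\<And>x. x \<in> carrier (P 0) \<Longrightarrow> d 0 (\<theta> x) = ?f x"
    by blast
  have im: "frag_of k \<odot>\<^bsub>P 0\<^esub> p t \<ominus>\<^bsub>P 0\<^esub> p t \<in> d 0 ` carrier (P 1)"
    if "t \<in> orbit_rep ` X" "k \<in> carrier H" "act k t = t" for t k
  proof -
    have pt: "p t \<in> carrier (P 0)" using p that(1) by (rule funcset_mem)
    note kpt = smult_frag_of_closed[OF P pt that(2)]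
    have "\<epsilon> (frag_of k \<odot>\<^bsub>P 0\<^esub> p t \<ominus>\<^bsub>P 0\<^esub> p t) = \<zero>\<^bsub>M\<^esub>"
      using module_hom_minus[OF \<epsilon> ab abM kpt pt] \<epsilon>hp[OF that(2,1)] \<epsilon>p[OF that(1)] that(3) \<epsilon>_cl[OF pt]
      by (simp add: M.M.minus_eq_zero_iff)
    then show ?thesis unfolding exact using kpt pt by simp
  qed
  have "\<exists>\<Theta>\<in>hom (free_Abelian_group cover_basis) (add_monoid (P 1)).
    \<forall>z. Poly_Mapping.keys z \<subseteq> cover_basis \<and> cover_map z = 0 \<longrightarrow> d 0 (\<Theta> z) = \<phi> z \<and>
      (\<forall>g\<in>carrier H. \<Theta> (linear_action cover_act (frag_of g) z) = frag_of g \<odot>\<^bsub>P 1\<^esub> \<Theta> z)"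
    by (rule kernel_lift[OF P P d \<phi> p \<phi>p im])
  then obtain \<Theta> where \<Theta>: "\<Theta> \<in> hom (free_Abelian_group cover_basis) (add_monoid (P 1))"
    and d\<Theta>: "\<And>z. \<lbrakk>Poly_Mapping.keys z \<subseteq> cover_basis; cover_map z = 0\<rbrakk> \<Longrightarrow> d 0 (\<Theta> z) = \<phi> z"
    and \<Theta>g: "\<And>g z. \<lbrakk>g \<in> carrier H; Poly_Mapping.keys z \<subseteq> cover_basis; cover_map z = 0\<rbrakk> \<Longrightarrow>
      \<Theta> (linear_action cover_act (frag_of g) z) = frag_of g \<odot>\<^bsub>P 1\<^esub> \<Theta> z"
    by blast
  let ?\<sigma> = "\<lambda>y. \<Theta> (\<psi> (d 0 y)) \<oplus>\<^bsub>P 1\<^esub> \<theta> (d 0 y)"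
  have ker: "Poly_Mapping.keys (\<psi> (d 0 y)) \<subseteq> cover_basis" "cover_map (\<psi> (d 0 y)) = 0"
    if y: "y \<in> carrier (P 1)" for y
  proof -
    note cl = module_hom_closed[OF \<psi> d_cl[OF y]]
    then show "Poly_Mapping.keys (\<psi> (d 0 y)) \<subseteq> cover_basis" by simp
    have "\<epsilon> (d 0 y) = \<zero>\<^bsub>M\<^esub>" using exact y by blast
    then show "cover_map (\<psi> (d 0 y)) = 0" using \<pi>\<psi>[OF d_cl[OF y]] by (intro \<pi>_ker[OF cl]) simp
  qed
  have \<Theta>cl: "\<Theta> (\<psi> (d 0 y)) \<in> carrier (P 1)" if "y \<in> carrier (P 1)" for y
    by (rule additive_closed[OF ab \<Theta> ker(1)[OF that]])
  have "(\<lambda>y. \<Theta> (\<psi> (d 0 y))) \<in> module_hom ?R (P 1) (P 1)"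
  proof (rule module_hom_group_ringI[OF P P \<Theta>cl])
    show "\<Theta> (\<psi> (d 0 (x \<oplus>\<^bsub>P 1\<^esub> y))) = \<Theta> (\<psi> (d 0 x)) \<oplus>\<^bsub>P 1\<^esub> \<Theta> (\<psi> (d 0 y))"
      if "x \<in> carrier (P 1)" "y \<in> carrier (P 1)" for x y
      using that additive_add[OF ab \<Theta> ker(1) ker(1)]
      by (simp add: module_hom_add[OF d] module_hom_add[OF \<psi>] d_cl)
    show "\<Theta> (\<psi> (d 0 (frag_of g \<odot>\<^bsub>P 1\<^esub> x))) = frag_of g \<odot>\<^bsub>P 1\<^esub> \<Theta> (\<psi> (d 0 x))"
      if "g \<in> carrier H" "x \<in> carrier (P 1)" for g x
      using that \<Theta>g[OF that(1) ker[OF that(2)]]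
      by (simp add: module_hom_smult[OF d] module_hom_smult[OF \<psi>] d_cl)
  qed
  from module_hom_add_hom[OF P this module_hom_comp[OF d \<theta>]]
  have \<sigma>: "?\<sigma> \<in> module_hom ?R (P 1) (P 1)" .
  show ?thesis
  proof (intro bexI[OF _ \<sigma>] ballI conjI impI)
    fix y assume y: "y \<in> carrier (P 1)"
    note dy = d_cl[OF y]
    have "d 0 (?\<sigma> y) = \<phi> (\<psi> (d 0 y)) \<oplus>\<^bsub>P 0\<^esub> ?f (d 0 y)"
      using module_hom_add[OF d \<Theta>cl[OF y] module_hom_closed[OF \<theta> dy]] d\<Theta>[OF ker[OF y]] d\<theta>[OF dy] by simp
    also have "\<dots> = d 0 y"
      using dy module_hom_closed[OF \<phi>\<psi> dy] by (simp add: P0.M.minus_eq P0.M.a_ac P0.M.r_neg2 P0.M.r_neg1 P0.M.r_neg)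
    finally show "d 0 (?\<sigma> y) = d 0 y" .
    show "?\<sigma> y = \<zero>\<^bsub>P 1\<^esub>" if "d 0 y = \<zero>\<^bsub>P 0\<^esub>"
      using that module_hom_zero[OF \<psi> ab abQ] module_hom_zero[OF \<theta> ab ab] additive_zero[OF ab \<Theta>] by simp
  qed
qed

lemma Ext_group_trivial:
  assumes "left_module (group_ring H) A" and M: "left_module (group_ring H) M"
    and \<iota>: "\<iota> \<in> module_hom (group_ring H) (permutation_module act X) M"
    and bij: "bij_betw \<iota> (carrier (permutation_module act X)) (carrier M)"
    and res: "projective_resolution (group_ring H) M P d \<epsilon>" and "r > 1"
  shows "trivial_group (Ext_group (group_ring H) P d r A)"
proof -
  obtain \<sigma> where \<sigma>: "\<sigma> \<in> module_hom (group_ring H) (P 1) (P 1)"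
      "\<And>x. x \<in> carrier (P 1) \<Longrightarrow> d 0 (\<sigma> x) = d 0 x"
      "\<And>x. \<lbrakk>x \<in> carrier (P 1); d 0 x = \<zero>\<^bsub>P 0\<^esub>\<rbrakk> \<Longrightarrow> \<sigma> x = \<zero>\<^bsub>P 1\<^esub>"
    using syzygy_splits[OF M \<iota> bij res] by blast
  show ?thesis
    by (rule Ext_group_trivial_if_syzygy_splits[OF assms(1) res \<sigma> \<open>r > 1\<close>])
qed

end

section \<open>Presented modules\<close>

locale presentation =
  fixes relators :: "('b \<Rightarrow>\<^sub>0 int) set" and gens :: "'b set" and act :: "'g \<Rightarrow> 'b \<Rightarrow> 'b"
  assumes relators_closed: "relators \<subseteq> carrier (free_Abelian_group gens)"
begin

abbreviation Free :: "('b \<Rightarrow>\<^sub>0 int) monoid" where "Free \<equiv> free_Abelian_group gens"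
abbreviation Rel :: "('b \<Rightarrow>\<^sub>0 int) set" where "Rel \<equiv> generate Free relators"
abbreviation PM :: "('g \<Rightarrow>\<^sub>0 int, ('b \<Rightarrow>\<^sub>0 int) set) module" where "PM \<equiv> presented_module relators act gens"

definition cls :: "('b \<Rightarrow>\<^sub>0 int) \<Rightarrow> ('b \<Rightarrow>\<^sub>0 int) set" where
  "cls u = Rel #>\<^bsub>Free\<^esub> u"

sublocale Free: comm_group Free by (rule abelian_free_Abelian_group)

lemma subgroup_Rel: "subgroup Rel Free"
  by (rule Free.generate_is_subgroup[OF relators_closed])

lemma Rel_subset: "u \<in> Rel \<Longrightarrow> Poly_Mapping.keys u \<subseteq> gens"
  using subgroup.mem_carrier[OF subgroup_Rel, of u] by simp

lemma normal_Rel: "Rel \<lhd> Free"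
  by (rule Free.normal_iff_subgroup[THEN iffD2, OF subgroup_Rel])

lemma carrier_PM: "carrier PM = cls ` {u. Poly_Mapping.keys u \<subseteq> gens}"
  by (auto simp: presented_module_def Let_def FactGroup_def RCOSETS_def cls_def)

lemma zero_PM: "\<zero>\<^bsub>PM\<^esub> = cls 0"
  using Free.coset_mult_one[OF subgroup.subset[OF subgroup_Rel]]
  by (simp add: presented_module_def Let_def FactGroup_def cls_def)

lemma cls_add:
  "\<lbrakk>Poly_Mapping.keys u \<subseteq> gens; Poly_Mapping.keys v \<subseteq> gens\<rbrakk> \<Longrightarrow> cls u \<oplus>\<^bsub>PM\<^esub> cls v = cls (u + v)"
  using normal.rcos_sum[OF normal_Rel, of u v]
  by (simp add: presented_module_def Let_def FactGroup_def cls_def)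

lemma cls_closed: "Poly_Mapping.keys u \<subseteq> gens \<Longrightarrow> cls u \<in> carrier PM"
  by (auto simp: carrier_PM)

lemma mem_cls: "u \<in> cls v \<longleftrightarrow> (\<exists>k\<in>Rel. u = k + v)"
  by (auto simp: cls_def r_coset_def)

lemma self_mem_cls: "u \<in> cls u"
  unfolding mem_cls using subgroup.one_closed[OF subgroup_Rel] by force

lemma cls_eq_zeroI: "u \<in> Rel \<Longrightarrow> cls u = \<zero>\<^bsub>PM\<^esub>"
  using Free.coset_join2[OF _ subgroup_Rel, of u] Rel_subset[of u]
  by (simp add: presented_module_def Let_def FactGroup_def cls_def)

lemma cls_eq_zeroD:
  assumes "Poly_Mapping.keys u \<subseteq> gens" "cls u = \<zero>\<^bsub>PM\<^esub>"
  shows "u \<in> Rel"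
proof -
  have "u \<in> cls 0" using self_mem_cls[of u] assms(2) by (simp add: zero_PM)
  then show ?thesis by (simp add: mem_cls)
qed

lemma abelian_group_PM: "abelian_group PM"
proof (rule abelian_groupI)
  show "x \<oplus>\<^bsub>PM\<^esub> y \<in> carrier PM" if "x \<in> carrier PM" "y \<in> carrier PM" for x y
    using that by (auto simp: carrier_PM cls_add intro!: imageI dest!: subsetD[OF Poly_Mapping.keys_add])
  show "\<zero>\<^bsub>PM\<^esub> \<in> carrier PM" by (simp add: zero_PM cls_closed)
  show "x \<oplus>\<^bsub>PM\<^esub> y \<oplus>\<^bsub>PM\<^esub> z = x \<oplus>\<^bsub>PM\<^esub> (y \<oplus>\<^bsub>PM\<^esub> z)"
    if "x \<in> carrier PM" "y \<in> carrier PM" "z \<in> carrier PM" for x y z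
    using that by (auto simp: carrier_PM cls_add keys_add_subset add.assoc)
  show "x \<oplus>\<^bsub>PM\<^esub> y = y \<oplus>\<^bsub>PM\<^esub> x" if "x \<in> carrier PM" "y \<in> carrier PM" for x y
    using that by (auto simp: carrier_PM cls_add add.commute)
  show "\<zero>\<^bsub>PM\<^esub> \<oplus>\<^bsub>PM\<^esub> x = x" if "x \<in> carrier PM" for x
    using that by (auto simp: carrier_PM zero_PM cls_add)
  show "\<exists>y\<in>carrier PM. y \<oplus>\<^bsub>PM\<^esub> x = \<zero>\<^bsub>PM\<^esub>" if x: "x \<in> carrier PM" for x
  proof -
    obtain u where "x = cls u" "Poly_Mapping.keys u \<subseteq> gens" using x by (auto simp: carrier_PM)
    then show ?thesis
      by (intro bexI[of _ "cls (- u)"]) (auto simp: zero_PM cls_add cls_closed)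
  qed
qed

lemma Rel_induct [consumes 1, case_names zero relator diff]:
  assumes u: "u \<in> Rel" and "P 0" and "\<And>u. u \<in> relators \<Longrightarrow> P u"
    and diff: "\<And>u v. \<lbrakk>P u; P v\<rbrakk> \<Longrightarrow> P (u - v)"
  shows "P u"
  using u
proof (induction rule: generate.induct)
  case (inv h)
  then have "P (0 - h)" by (intro diff assms)
  then show ?case using inv relators_closed by auto
next
  case (eng h1 h2)
  have "P (0 - h2)" by (rule diff[OF assms(2) eng.IH(2)])
  from diff[OF eng.IH(1) this] show ?case by simp
qed (use assms in auto)

lemma Rel_uminus: "u \<in> Rel \<Longrightarrow> - u \<in> Rel"
  using subgroup.m_inv_closed[OF subgroup_Rel, of u] Rel_subset[of u] by simp

lemma Rel_add: "\<lbrakk>u \<in> Rel; v \<in> Rel\<rbrakk> \<Longrightarrow> u + v \<in> Rel"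
  using subgroup.m_closed[OF subgroup_Rel, of u v] by simp

lemma cls_diff:
  assumes "Poly_Mapping.keys u \<subseteq> gens" "Poly_Mapping.keys v \<subseteq> gens"
  shows "cls (u - v) = cls u \<ominus>\<^bsub>PM\<^esub> cls v"
proof -
  interpret abelian_group PM by (rule abelian_group_PM)
  have "cls u \<ominus>\<^bsub>PM\<^esub> cls v = (cls (u - v) \<oplus>\<^bsub>PM\<^esub> cls v) \<ominus>\<^bsub>PM\<^esub> cls v"
    using assms by (simp add: cls_add keys_diff_subset)
  then show ?thesis
    using assms by (simp add: cls_closed keys_diff_subset minus_eq a_assoc r_neg)
qed

text \<open>The action on a coset is defined as a union over its representatives. All these cosets coincide as
soon as the action preserves the set of relators.\<close>

lemma smult_cls:
  assumes act: "\<And>b. b \<in> gens \<Longrightarrow> act g b \<in> gens"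
    and rel: "\<And>u. u \<in> relators \<Longrightarrow> linear_action act (frag_of g) u \<in> relators"
    and u: "Poly_Mapping.keys u \<subseteq> gens"
  shows "frag_of g \<odot>\<^bsub>PM\<^esub> cls u = cls (linear_action act (frag_of g) u)"
proof -
  let ?f = "linear_action act (frag_of g)"
  have f_keys: "Poly_Mapping.keys (?f v) \<subseteq> gens" if "Poly_Mapping.keys v \<subseteq> gens" for v
    by (rule keys_linear_action[where S = "{g}", OF _ that]) (auto simp: act)
  have f_Rel: "?f k \<in> Rel" if "k \<in> Rel" for k
    using that
  proof (induction rule: Rel_induct)
    case (diff u v)
    then show ?case
      using Rel_add[OF diff(1) Rel_uminus[OF diff(2)]] by (simp add: linear_action_diff_right)
  qed (use rel subgroup.one_closed[OF subgroup_Rel] in \<open>auto intro: generate.incl\<close>)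
  have "cls (?f v) = cls (?f u)" if v: "v \<in> cls u" for v
  proof -
    obtain k where k: "k \<in> Rel" "v = k + u" using v by (auto simp: mem_cls)
    interpret abelian_group PM by (rule abelian_group_PM)
    have "cls (?f v) = cls (?f k) \<oplus>\<^bsub>PM\<^esub> cls (?f u)"
      using k u by (simp add: linear_action_add_right cls_add f_keys Rel_subset)
    then show ?thesis using u by (simp add: cls_eq_zeroI[OF f_Rel[OF k(1)]] cls_closed f_keys)
  qed
  then have "(\<Union>v\<in>cls u. cls (?f v)) = (\<Union>v\<in>cls u. cls (?f u))" by (rule SUP_cong[OF refl])
  also have "\<dots> = cls (?f u)" using self_mem_cls[of u] by (intro SUP_const) blast
  finally show ?thesis by (simp add: presented_module_def Let_def cls_def linear_action_def)
qed

end

section \<open>Integer-valued linear functionals\<close>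

definition pairing :: "('b \<Rightarrow> int) \<Rightarrow> ('b \<Rightarrow>\<^sub>0 int) \<Rightarrow> int" where
  "pairing f a = (\<Sum>k\<in>Poly_Mapping.keys a. Poly_Mapping.lookup a k * f k)"

text \<open>Linearity of the functional is inherited from linear extension into the free abelian group on one
point.\<close>

lemma pairing_eq_lookup:
  "pairing f a = Poly_Mapping.lookup (frag_extend (\<lambda>k. frag_cmul (f k) (frag_of ())) a) ()"
  by (simp add: pairing_def frag_extend_def lookup_sum)

lemma pairing_zero [simp]: "pairing f 0 = 0"
  and pairing_of [simp]: "pairing f (frag_of k) = f k"
  and pairing_add: "pairing f (a + b) = pairing f a + pairing f b"
  and pairing_diff: "pairing f (a - b) = pairing f a - pairing f b"
  by (auto simp: pairing_eq_lookup frag_extend_add frag_extend_diff lookup_add lookup_minus)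

lemma pairing_frag_extend: "pairing f (frag_extend g c) = pairing (\<lambda>x. pairing f (g x)) c"
  using subset_UNIV[of "Poly_Mapping.keys c"]
  by (induction c rule: frag_induction) (auto simp: frag_extend_diff pairing_diff)

lemma pairing_cong: "(\<And>k. k \<in> Poly_Mapping.keys a \<Longrightarrow> f k = g k) \<Longrightarrow> pairing f a = pairing g a"
  by (simp add: pairing_def)

lemma pairing_indicator: "pairing (\<lambda>k. if k = k0 then 1 else 0) a = Poly_Mapping.lookup a k0"
  by (simp add: pairing_def in_keys_iff if_distrib cong: if_cong)

lemma augmentation_eq_pairing: "augmentation a = pairing (\<lambda>_. 1) a"
  by (simp add: augmentation_def pairing_def)

lemma frag_extend_const: "frag_extend (\<lambda>_. b) a = frag_cmul (augmentation a) b"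
  using subset_UNIV[of "Poly_Mapping.keys a"]
  by (induction a rule: frag_induction)
     (auto simp: frag_extend_diff augmentation_eq_pairing pairing_diff frag_cmul_diff_distrib)

lemma (in presentation) pairing_Rel:
  assumes "\<And>u. u \<in> relators \<Longrightarrow> pairing f u = 0" "u \<in> Rel"
  shows "pairing f u = 0"
  using assms(2) by (induction rule: Rel_induct) (auto simp: assms(1) pairing_diff)

section \<open>The tensor product of the group ring with powers of the augmentation ideal\<close>

lemma group_ring_bimodule_simps [simp]:
  "carrier (group_ring_bimodule G) = {a. Poly_Mapping.keys a \<subseteq> carrier G}"
  "\<zero>\<^bsub>group_ring_bimodule G\<^esub> = 0"
  "a \<oplus>\<^bsub>group_ring_bimodule G\<^esub> b = a + b"
  by (auto simp: group_ring_bimodule_def)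

lemma augmentation_ideal_simps [simp]:
  "carrier (augmentation_ideal G) = {a. Poly_Mapping.keys a \<subseteq> carrier G \<and> augmentation a = 0}"
  "\<zero>\<^bsub>augmentation_ideal G\<^esub> = 0"
  "a \<oplus>\<^bsub>augmentation_ideal G\<^esub> b = a + b"
  "r \<odot>\<^bsub>augmentation_ideal G\<^esub> a = r \<odot>\<^bsub>group_ring_bimodule G\<^esub> a"
  by (auto simp: augmentation_ideal_def group_ring_bimodule_def)

lemma smult_group_ring_bimodule:
  "frag_of k \<odot>\<^bsub>group_ring_bimodule G\<^esub> a =
    frag_extend (\<lambda>y. frag_of (fst k \<otimes>\<^bsub>G\<^esub> y \<otimes>\<^bsub>G\<^esub> inv\<^bsub>G\<^esub> (snd k))) a"
  by (simp add: group_ring_bimodule_def case_prod_unfold linear_action_def frag_extend_frag_extend)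

lemma augmentation_zero [simp]: "augmentation 0 = 0"
  and augmentation_of [simp]: "augmentation (frag_of k) = 1"
  and augmentation_add: "augmentation (a + b) = augmentation a + augmentation b"
  and augmentation_diff: "augmentation (a - b) = augmentation a - augmentation b"
  by (auto simp: augmentation_eq_pairing pairing_add pairing_diff)

lemma keys_relator:
  "\<lbrakk>x \<in> S; y \<in> S; z \<in> S\<rbrakk> \<Longrightarrow> Poly_Mapping.keys (frag_of x - frag_of y - frag_of z) \<subseteq> S"
  by (intro keys_diff_subset) auto

lemma tensor_power_relatorE:
  assumes "u \<in> tensor_power_relators (augmentation_ideal G) s"
  obtains us x x' vs
    where "u = frag_of (us @ (x + x') # vs) - frag_of (us @ x # vs) - frag_of (us @ x' # vs)"
      and "set us \<subseteq> carrier (augmentation_ideal G)" "x \<in> carrier (augmentation_ideal G)"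
        "x' \<in> carrier (augmentation_ideal G)" "set vs \<subseteq> carrier (augmentation_ideal G)"
        "Suc (length us + length vs) = s"
  using assms unfolding tensor_power_relators_def augmentation_ideal_simps(3) by blast

text \<open>Both tensor products are handled through their presentations. \<open>T.cls\<close> and \<open>M.cls\<close> send a formal combination of generators of
\<open>I\<^sup>s\<close> and \<open>\<int>[\<pi>] \<otimes> I\<^sup>s\<close>, respectively, to its class.\<close>

locale tensor_with_powers = group G for G :: "('g, 'm) monoid_scheme" (structure) +
  fixes s :: nat
begin

abbreviation "B \<equiv> group_ring_bimodule G"
abbreviation "I \<equiv> augmentation_ideal G"
abbreviation "Is \<equiv> tensor_power I s"
abbreviation "M \<equiv> tensor_product B Is"

definition "lists_I = {xs. set xs \<subseteq> carrier I \<and> length xs = s}"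
definition "pairs_M = carrier B \<times> carrier Is"

lemma smult_B_closed:
  assumes "k \<in> carrier (G \<times>\<times> G)" "Poly_Mapping.keys a \<subseteq> carrier G"
  shows "Poly_Mapping.keys (frag_of k \<odot>\<^bsub>B\<^esub> a) \<subseteq> carrier G"
  unfolding smult_group_ring_bimodule using assms(1)
  by (intro keys_frag_extend_subset[OF assms(2)]) (auto simp: DirProd_def)

lemma smult_B_add: "frag_of k \<odot>\<^bsub>B\<^esub> (a + b) = frag_of k \<odot>\<^bsub>B\<^esub> a + frag_of k \<odot>\<^bsub>B\<^esub> b"
  and smult_B_diff: "frag_of k \<odot>\<^bsub>B\<^esub> (a - b) = frag_of k \<odot>\<^bsub>B\<^esub> a - frag_of k \<odot>\<^bsub>B\<^esub> b"
  and smult_B_of: "frag_of k \<odot>\<^bsub>B\<^esub> frag_of y = frag_of (fst k \<otimes> y \<otimes> inv (snd k))"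
  by (simp_all add: smult_group_ring_bimodule frag_extend_add frag_extend_diff)

lemma smult_I_closed:
  assumes "k \<in> carrier (G \<times>\<times> G)" "a \<in> carrier I"
  shows "frag_of k \<odot>\<^bsub>B\<^esub> a \<in> carrier I"
proof -
  have "augmentation (frag_of k \<odot>\<^bsub>B\<^esub> a) = augmentation a"
    by (simp add: augmentation_eq_pairing smult_group_ring_bimodule pairing_frag_extend)
  then show ?thesis using assms smult_B_closed[OF assms(1)] by simp
qed

sublocale T: presentation "tensor_power_relators I s" lists_I "\<lambda>k. map (\<lambda>x. frag_of k \<odot>\<^bsub>I\<^esub> x)"
proof
  show "tensor_power_relators I s \<subseteq> carrier (free_Abelian_group lists_I)"
  proof
    fix u assume "u \<in> tensor_power_relators I s"
    then obtain us x x' vs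
      where u: "u = frag_of (us @ (x + x') # vs) - frag_of (us @ x # vs) - frag_of (us @ x' # vs)"
        and cl: "set us \<subseteq> carrier I" "x \<in> carrier I" "x' \<in> carrier I" "set vs \<subseteq> carrier I"
          "Suc (length us + length vs) = s"
      by (rule tensor_power_relatorE)
    moreover have "x + x' \<in> carrier I" using cl by (simp add: augmentation_add keys_add_subset)
    ultimately show "u \<in> carrier (free_Abelian_group lists_I)"
      by (simp add: u lists_I_def keys_relator)
  qed
qed

lemma T_PM: "presented_module (tensor_power_relators I s) (\<lambda>k. map (\<lambda>x. frag_of k \<odot>\<^bsub>I\<^esub> x)) lists_I = Is"
  by (simp only: tensor_power_def lists_I_def)

lemmas abelian_group_Is = T.abelian_group_PM[unfolded T_PM]
lemmas carrier_Is = T.carrier_PM[unfolded T_PM]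
lemmas zero_Is = T.zero_PM[unfolded T_PM]
lemmas T_cls_closed = T.cls_closed[unfolded T_PM]
lemmas T_cls_add = T.cls_add[unfolded T_PM]
lemmas T_cls_diff = T.cls_diff[unfolded T_PM]
lemmas T_cls_eq_zeroI = T.cls_eq_zeroI[unfolded T_PM]

sublocale M: presentation "tensor_relators B Is" pairs_M
  "\<lambda>k (x, y). (frag_of k \<odot>\<^bsub>B\<^esub> x, frag_of k \<odot>\<^bsub>Is\<^esub> y)"
proof
  interpret T: abelian_group Is by (rule abelian_group_Is)
  show "tensor_relators B Is \<subseteq> carrier (free_Abelian_group pairs_M)"
    unfolding tensor_relators_def pairs_M_def
    by (rule subsetI, elim UnE CollectE exE conjE) (simp_all add: keys_relator keys_add_subset)
qed

lemma M_PM: "presented_module (tensor_relators B Is)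
    (\<lambda>k (x, y). (frag_of k \<odot>\<^bsub>B\<^esub> x, frag_of k \<odot>\<^bsub>Is\<^esub> y)) pairs_M = M"
  by (simp only: tensor_product_def pairs_M_def)

lemmas abelian_group_M = M.abelian_group_PM[unfolded M_PM]
lemmas carrier_M = M.carrier_PM[unfolded M_PM]
lemmas zero_M = M.zero_PM[unfolded M_PM]
lemmas M_cls_closed = M.cls_closed[unfolded M_PM]
lemmas M_cls_add = M.cls_add[unfolded M_PM]
lemmas M_cls_diff = M.cls_diff[unfolded M_PM]
lemmas M_cls_eq_zeroI = M.cls_eq_zeroI[unfolded M_PM]
lemmas M_cls_eq_zeroD = M.cls_eq_zeroD[unfolded M_PM]

lemma T_add:
  assumes "set us \<subseteq> carrier I" "set vs \<subseteq> carrier I" "Suc (length us + length vs) = s"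
    and "a \<in> carrier I" "b \<in> carrier I"
  shows "T.cls (frag_of (us @ (a + b) # vs)) = T.cls (frag_of (us @ a # vs)) \<oplus>\<^bsub>Is\<^esub> T.cls (frag_of (us @ b # vs))"
proof -
  interpret T': abelian_group Is by (rule abelian_group_Is)
  let ?f = "\<lambda>x. frag_of (us @ x # vs)"
  have k: "Poly_Mapping.keys (?f x) \<subseteq> lists_I" if "x \<in> carrier I" for x
    using assms that by (auto simp: lists_I_def)
  have ab: "a + b \<in> carrier I"
    using assms by (simp add: augmentation_add keys_add_subset)
  have "?f (a + b) - ?f a - ?f b \<in> tensor_power_relators I s"
    unfolding tensor_power_relators_def using assms by auto
  then have "T.cls (?f (a + b) - ?f a - ?f b) = \<zero>\<^bsub>Is\<^esub>"
    by (rule T_cls_eq_zeroI[OF generate.incl])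
  moreover have "?f (a + b) = (?f (a + b) - ?f a - ?f b) + (?f a + ?f b)" by simp
  moreover have "Poly_Mapping.keys (?f (a + b) - ?f a - ?f b) \<subseteq> lists_I"
    using k[OF ab] k[OF assms(4)] k[OF assms(5)] by (intro keys_diff_subset)
  moreover have "Poly_Mapping.keys (?f a + ?f b) \<subseteq> lists_I"
    using k[OF assms(4)] k[OF assms(5)] by (intro keys_add_subset)
  ultimately have "T.cls (?f (a + b)) = \<zero>\<^bsub>Is\<^esub> \<oplus>\<^bsub>Is\<^esub> T.cls (?f a + ?f b)"
    using T_cls_add[of "?f (a + b) - ?f a - ?f b" "?f a + ?f b"] by simp
  moreover have "T.cls (?f a + ?f b) = T.cls (?f a) \<oplus>\<^bsub>Is\<^esub> T.cls (?f b)"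
    using T_cls_add[OF k[OF assms(4)] k[OF assms(5)]] by simp
  ultimately show ?thesis
    using T_cls_closed[OF k[OF assms(4)]] T_cls_closed[OF k[OF assms(5)]] by simp
qed

definition tensor :: "('g \<Rightarrow>\<^sub>0 int) \<Rightarrow> (('g \<Rightarrow>\<^sub>0 int) list \<Rightarrow>\<^sub>0 int) set \<Rightarrow>
    (('g \<Rightarrow>\<^sub>0 int) \<times> (('g \<Rightarrow>\<^sub>0 int) list \<Rightarrow>\<^sub>0 int) set \<Rightarrow>\<^sub>0 int) set" where
  "tensor a U = M.cls (frag_of (a, U))"

lemma tensor_closed: "\<lbrakk>a \<in> carrier B; U \<in> carrier Is\<rbrakk> \<Longrightarrow> tensor a U \<in> carrier M"
  unfolding tensor_def using M_cls_closed[of "frag_of (a, U)"] by (simp add: pairs_M_def)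

lemma M_relator:
  assumes "frag_of x - frag_of y - frag_of z \<in> tensor_relators B Is"
    and "x \<in> pairs_M" "y \<in> pairs_M" "z \<in> pairs_M"
  shows "M.cls (frag_of x) = M.cls (frag_of y) \<oplus>\<^bsub>M\<^esub> M.cls (frag_of z)"
proof -
  interpret M': abelian_group M by (rule abelian_group_M)
  have k: "Poly_Mapping.keys (frag_of x) \<subseteq> pairs_M" "Poly_Mapping.keys (frag_of y) \<subseteq> pairs_M"
     "Poly_Mapping.keys (frag_of z) \<subseteq> pairs_M" using assms by auto
  have "M.cls (frag_of x) = M.cls ((frag_of x - frag_of y - frag_of z) + (frag_of y + frag_of z))" by simp
  also have "\<dots> = \<zero>\<^bsub>M\<^esub> \<oplus>\<^bsub>M\<^esub> M.cls (frag_of y + frag_of z)"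
    using M_cls_eq_zeroI[OF generate.incl[OF assms(1)]]
      M_cls_add[OF keys_diff_subset[OF keys_diff_subset[OF k(1,2)] k(3)] keys_add_subset[OF k(2,3)]]
    by simp
  also have "\<dots> = M.cls (frag_of y) \<oplus>\<^bsub>M\<^esub> M.cls (frag_of z)"
    using M_cls_add[OF k(2,3)] M_cls_closed[OF keys_add_subset[OF k(2,3)]] by simp
  finally show ?thesis .
qed

lemma tensor_add_left:
  "\<lbrakk>a \<in> carrier B; b \<in> carrier B; U \<in> carrier Is\<rbrakk> \<Longrightarrow> tensor (a + b) U = tensor a U \<oplus>\<^bsub>M\<^esub> tensor b U"
  unfolding tensor_def
  by (rule M_relator) (auto simp: tensor_relators_def pairs_M_def keys_add_subset)

lemma tensor_add_right:
  assumes "a \<in> carrier B" "U \<in> carrier Is" "V \<in> carrier Is"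
  shows "tensor a (U \<oplus>\<^bsub>Is\<^esub> V) = tensor a U \<oplus>\<^bsub>M\<^esub> tensor a V"
proof -
  interpret T': abelian_group Is by (rule abelian_group_Is)
  show ?thesis unfolding tensor_def
    using assms by (intro M_relator) (auto simp: tensor_relators_def pairs_M_def)
qed

lemma smult_T:
  assumes k: "k \<in> carrier (G \<times>\<times> G)" and u: "Poly_Mapping.keys u \<subseteq> lists_I"
  shows "frag_of k \<odot>\<^bsub>Is\<^esub> T.cls u = T.cls (linear_action (\<lambda>k. map (\<lambda>x. frag_of k \<odot>\<^bsub>B\<^esub> x)) (frag_of k) u)"
proof -
  let ?act = "\<lambda>k. map (\<lambda>x. frag_of k \<odot>\<^bsub>I\<^esub> x)"
  have I: "frag_of k \<odot>\<^bsub>I\<^esub> x \<in> carrier I" if "x \<in> carrier I" for x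
    using smult_I_closed[OF k that] by simp
  have "frag_of k \<odot>\<^bsub>Is\<^esub> T.cls u = T.cls (linear_action ?act (frag_of k) u)"
  proof (rule T.smult_cls[unfolded T_PM, OF _ _ u])
    show "map (\<lambda>x. frag_of k \<odot>\<^bsub>I\<^esub> x) b \<in> lists_I" if "b \<in> lists_I" for b
      using that I by (auto simp: lists_I_def simp del: augmentation_ideal_simps)
    show "linear_action ?act (frag_of k) u \<in> tensor_power_relators I s"
      if rel: "u \<in> tensor_power_relators I s" for u
    proof -
      obtain us x x' vs where u: "u = frag_of (us @ (x + x') # vs) - frag_of (us @ x # vs) - frag_of (us @ x' # vs)"
        and cl: "set us \<subseteq> carrier I" "x \<in> carrier I" "x' \<in> carrier I" "set vs \<subseteq> carrier I"
        and len: "Suc (length us + length vs) = s"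
        using rel by (rule tensor_power_relatorE)
      let ?m = "map (\<lambda>x. frag_of k \<odot>\<^bsub>I\<^esub> x)" and ?k = "\<lambda>x. frag_of k \<odot>\<^bsub>I\<^esub> x"
      have "linear_action ?act (frag_of k) u = frag_of (?m us @ (?k x \<oplus>\<^bsub>I\<^esub> ?k x') # ?m vs)
          - frag_of (?m us @ ?k x # ?m vs) - frag_of (?m us @ ?k x' # ?m vs)"
        by (simp add: u linear_action_of frag_extend_diff smult_B_add)
      moreover have "set (?m us) \<subseteq> carrier I" "set (?m vs) \<subseteq> carrier I" "?k x \<in> carrier I" "?k x' \<in> carrier I"
        using cl I by (auto simp del: augmentation_ideal_simps)
      moreover have "Suc (length (?m us) + length (?m vs)) = s" using len by simp
      ultimately show ?thesis unfolding tensor_power_relators_def by blast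
    qed
  qed
  then show ?thesis by simp
qed

lemma smult_Is_closed:
  assumes "k \<in> carrier (G \<times>\<times> G)" "U \<in> carrier Is"
  shows "frag_of k \<odot>\<^bsub>Is\<^esub> U \<in> carrier Is"
    and "V \<in> carrier Is \<Longrightarrow> frag_of k \<odot>\<^bsub>Is\<^esub> (U \<oplus>\<^bsub>Is\<^esub> V) = frag_of k \<odot>\<^bsub>Is\<^esub> U \<oplus>\<^bsub>Is\<^esub> frag_of k \<odot>\<^bsub>Is\<^esub> V"
proof -
  let ?f = "linear_action (\<lambda>k. map (\<lambda>x. frag_of k \<odot>\<^bsub>B\<^esub> x)) (frag_of k)"
  have f: "Poly_Mapping.keys (?f u) \<subseteq> lists_I" if "Poly_Mapping.keys u \<subseteq> lists_I" for u
    by (rule keys_linear_action[where S = "{k}", OF _ that])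
       (use smult_I_closed[OF assms(1)] in \<open>auto simp: lists_I_def simp del: augmentation_ideal_simps\<close>)
  have U: "\<exists>u. Poly_Mapping.keys u \<subseteq> lists_I \<and> U = T.cls u" if "U \<in> carrier Is" for U
    using that unfolding carrier_Is by blast
  obtain u where u: "Poly_Mapping.keys u \<subseteq> lists_I" "U = T.cls u" using U[OF assms(2)] by blast
  show "frag_of k \<odot>\<^bsub>Is\<^esub> U \<in> carrier Is"
    using T_cls_closed[OF f[OF u(1)]] unfolding u(2) smult_T[OF assms(1) u(1)] .
  show "frag_of k \<odot>\<^bsub>Is\<^esub> (U \<oplus>\<^bsub>Is\<^esub> V) = frag_of k \<odot>\<^bsub>Is\<^esub> U \<oplus>\<^bsub>Is\<^esub> frag_of k \<odot>\<^bsub>Is\<^esub> V"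
    if V: "V \<in> carrier Is"
  proof -
    obtain v where v: "Poly_Mapping.keys v \<subseteq> lists_I" "V = T.cls v" using U[OF V] by blast
    show ?thesis
      using T_cls_add[OF u(1) v(1)] T_cls_add[OF f[OF u(1)] f[OF v(1)]] smult_T[OF assms(1) u(1)]
        smult_T[OF assms(1) v(1)] smult_T[OF assms(1) keys_add_subset[OF u(1) v(1)]]
      by (simp only: u(2) v(2) linear_action_add_right)
  qed
qed

lemma smult_M:
  assumes k: "k \<in> carrier (G \<times>\<times> G)" and w: "Poly_Mapping.keys w \<subseteq> pairs_M"
  shows "frag_of k \<odot>\<^bsub>M\<^esub> M.cls w =
    M.cls (linear_action (\<lambda>k (x, y). (frag_of k \<odot>\<^bsub>B\<^esub> x, frag_of k \<odot>\<^bsub>Is\<^esub> y)) (frag_of k) w)"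
proof (rule M.smult_cls[unfolded M_PM, OF _ _ w])
  interpret T': abelian_group Is by (rule abelian_group_Is)
  have B: "frag_of k \<odot>\<^bsub>B\<^esub> a \<in> carrier B" if "a \<in> carrier B" for a
    using smult_B_closed[OF k] that by simp
  show "(case b of (x, y) \<Rightarrow> (frag_of k \<odot>\<^bsub>B\<^esub> x, frag_of k \<odot>\<^bsub>Is\<^esub> y)) \<in> pairs_M"
    if "b \<in> pairs_M" for b
    using that B smult_Is_closed(1)[OF k] by (auto simp: pairs_M_def simp del: group_ring_bimodule_simps)
  let ?act = "\<lambda>k (x, y). (frag_of k \<odot>\<^bsub>B\<^esub> x, frag_of k \<odot>\<^bsub>Is\<^esub> y)"
  fix u assume "u \<in> tensor_relators B Is"
  then consider
      (left) x x' y where "u = frag_of (x + x', y) - frag_of (x, y) - frag_of (x', y)"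
        "x \<in> carrier B" "x' \<in> carrier B" "y \<in> carrier Is"
    | (right) x y y' where "u = frag_of (x, y \<oplus>\<^bsub>Is\<^esub> y') - frag_of (x, y) - frag_of (x, y')"
        "x \<in> carrier B" "y \<in> carrier Is" "y' \<in> carrier Is"
    unfolding tensor_relators_def group_ring_bimodule_simps(3) by blast
  then show "linear_action ?act (frag_of k) u \<in> tensor_relators B Is"
  proof cases
    case left
    let ?k = "\<lambda>x. frag_of k \<odot>\<^bsub>B\<^esub> x" and ?y = "frag_of k \<odot>\<^bsub>Is\<^esub> y"
    have "linear_action ?act (frag_of k) u =
        frag_of (?k x \<oplus>\<^bsub>B\<^esub> ?k x', ?y) - frag_of (?k x, ?y) - frag_of (?k x', ?y)"
      by (simp add: left(1) linear_action_of frag_extend_diff smult_B_add)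
    then show ?thesis unfolding tensor_relators_def
      using B[OF left(2)] B[OF left(3)] smult_Is_closed(1)[OF k left(4)]
      by blast
  next
    case right
    let ?x = "frag_of k \<odot>\<^bsub>B\<^esub> x" and ?k = "\<lambda>y. frag_of k \<odot>\<^bsub>Is\<^esub> y"
    have "linear_action ?act (frag_of k) u =
        frag_of (?x, ?k y \<oplus>\<^bsub>Is\<^esub> ?k y') - frag_of (?x, ?k y) - frag_of (?x, ?k y')"
      by (simp add: right(1) linear_action_of frag_extend_diff smult_Is_closed(2)[OF k right(3,4)])
    then show ?thesis unfolding tensor_relators_def
      using B[OF right(2)] smult_Is_closed(1)[OF k right(3)] smult_Is_closed(1)[OF k right(4)]
      by blast
  qed
qed

end

section \<open>The tensor product as a permutation module\<close>

lemma prod_list_frag_of: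
  assumes "length xs = length zs"
  shows "prod_list (map2 (\<lambda>x z. Poly_Mapping.lookup (frag_of x) z) xs zs) = (if xs = zs then 1 else (0::int))"
  using assms by (induction xs zs rule: list_induct2) auto

lemma prod_list_map2_append:
  fixes f :: "'a \<Rightarrow> 'b \<Rightarrow> int"
  assumes "Suc (length us + length vs) = length zs"
  obtains c where "\<And>x. prod_list (map2 f (us @ x # vs) zs) = f x (zs ! length us) * c"
proof
  let ?n = "length us"
  fix x
  have "zs = take ?n zs @ zs ! ?n # drop (Suc ?n) zs"
    using assms by (intro id_take_nth_drop) simp
  then have "map2 f (us @ x # vs) zs = map2 f (us @ x # vs) (take ?n zs @ zs ! ?n # drop (Suc ?n) zs)" by simp
  also have "\<dots> = map2 f us (take ?n zs) @ f x (zs ! ?n) # map2 f vs (drop (Suc ?n) zs)"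
    using assms by simp
  finally show "prod_list (map2 f (us @ x # vs) zs) =
      f x (zs ! ?n) * (prod_list (map2 f us (take ?n zs)) * prod_list (map2 f vs (drop (Suc ?n) zs)))"
    by simp
qed

lemma (in abelian_group) eq_minusI:
  "\<lbrakk>x \<in> carrier G; y \<in> carrier G; z = x \<oplus> y\<rbrakk> \<Longrightarrow> x = z \<ominus> y"
  by (simp add: minus_eq a_assoc r_neg)

context tensor_with_powers
begin

text \<open>A basis element \<open>(y, [z\<^sub>1, \<dots>, z\<^sub>s])\<close> stands for \<open>y \<otimes> (z\<^sub>1 - y) \<otimes> \<cdots> \<otimes> (z\<^sub>s - y)\<close>. The differences are taken from \<open>y\<close>
and not from the unit because the two-sided translations of the group permute these tensors: they
move the base point along with the group elements.\<close>

definition "basis = {(y, zs). y \<in> carrier G \<and> set zs \<subseteq> carrier G - {y} \<and> length zs = s}"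

definition translate :: "'g \<times> 'g \<Rightarrow> 'g \<Rightarrow> 'g" where
  "translate k x = fst k \<otimes> x \<otimes> inv (snd k)"

definition basis_act :: "'g \<times> 'g \<Rightarrow> 'g \<times> 'g list \<Rightarrow> 'g \<times> 'g list" where
  "basis_act k = (\<lambda>(y, zs). (translate k y, map (translate k) zs))"

definition differences :: "'g \<Rightarrow> 'g list \<Rightarrow> ('g \<Rightarrow>\<^sub>0 int) list" where
  "differences y zs = map (\<lambda>z. frag_of z - frag_of y) zs"

definition symbol :: "'g \<times> 'g list \<Rightarrow> (('g \<Rightarrow>\<^sub>0 int) \<times> (('g \<Rightarrow>\<^sub>0 int) list \<Rightarrow>\<^sub>0 int) set \<Rightarrow>\<^sub>0 int)" where
  "symbol = (\<lambda>(y, zs). frag_of (frag_of y, T.cls (frag_of (differences y zs))))"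

definition basis_map :: "('g \<times> 'g list \<Rightarrow>\<^sub>0 int) \<Rightarrow> (('g \<Rightarrow>\<^sub>0 int) \<times> (('g \<Rightarrow>\<^sub>0 int) list \<Rightarrow>\<^sub>0 int) set \<Rightarrow>\<^sub>0 int) set" where
  "basis_map c = M.cls (frag_extend symbol c)"

lemma group_GG: "group (G \<times>\<times> G)"
  by (rule DirProd_group) (rule group_axioms)+

lemma translate_closed [simp]: "\<lbrakk>k \<in> carrier (G \<times>\<times> G); x \<in> carrier G\<rbrakk> \<Longrightarrow> translate k x \<in> carrier G"
  by (auto simp: translate_def DirProd_def)

lemma translate_eq_iff [simp]:
  "\<lbrakk>k \<in> carrier (G \<times>\<times> G); x \<in> carrier G; y \<in> carrier G\<rbrakk> \<Longrightarrow> translate k x = translate k y \<longleftrightarrow> x = y"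
  by (auto simp: translate_def DirProd_def)

lemma translate_one: "x \<in> carrier G \<Longrightarrow> translate (\<one>, \<one>) x = x"
  by (simp add: translate_def)

lemma translate_mult:
  "\<lbrakk>g \<in> carrier G; h \<in> carrier G; g' \<in> carrier G; h' \<in> carrier G; x \<in> carrier G\<rbrakk> \<Longrightarrow>
    translate (g \<otimes> g', h \<otimes> h') x = translate (g, h) (translate (g', h') x)"
  by (simp add: translate_def m_assoc inv_mult_group)

lemma group_set_basis: "group_set (G \<times>\<times> G) basis_act basis"
proof (rule group_set.intro[OF group_GG], unfold_locales)
  show "basis_act k x \<in> basis" if k: "k \<in> carrier (G \<times>\<times> G)" and "x \<in> basis" for k x
  proof -
    obtain y zs where yzs: "x = (y, zs)" by fastforce
    have y: "y \<in> carrier G" and zs: "\<And>z. z \<in> set zs \<Longrightarrow> z \<in> carrier G \<and> z \<noteq> y" and "length zs = s"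
      using \<open>x \<in> basis\<close> by (auto simp: basis_def yzs)
    moreover have "set (map (translate k) zs) \<subseteq> carrier G - {translate k y}"
    proof
      fix t assume "t \<in> set (map (translate k) zs)"
      then obtain z where "z \<in> set zs" "t = translate k z" by auto
      with k y zs[of z] show "t \<in> carrier G - {translate k y}" by simp
    qed
    ultimately show ?thesis using k by (simp add: basis_act_def basis_def yzs)
  qed
  show "basis_act \<one>\<^bsub>G \<times>\<times> G\<^esub> x = x" if "x \<in> basis" for x
    using that by (auto simp: basis_act_def basis_def subset_iff translate_one intro!: map_idI)
  show "basis_act (k \<otimes>\<^bsub>G \<times>\<times> G\<^esub> l) x = basis_act k (basis_act l x)"
    if "k \<in> carrier (G \<times>\<times> G)" "l \<in> carrier (G \<times>\<times> G)" "x \<in> basis" for k l x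
    using that by (auto simp: basis_act_def basis_def subset_iff translate_mult)
qed

lemma difference_in_I: "\<lbrakk>y \<in> carrier G; z \<in> carrier G\<rbrakk> \<Longrightarrow> frag_of z - frag_of y \<in> carrier I"
  by (simp add: augmentation_diff keys_diff_subset)

lemma differences_in_lists_I:
  "\<lbrakk>y \<in> carrier G; set zs \<subseteq> carrier G; length zs = s\<rbrakk> \<Longrightarrow> differences y zs \<in> lists_I"
  using difference_in_I by (auto simp: differences_def lists_I_def subset_iff simp del: augmentation_ideal_simps)

lemma T_symbol_closed:
  "(y, zs) \<in> basis \<Longrightarrow> T.cls (frag_of (differences y zs)) \<in> carrier Is"
  by (rule T_cls_closed, simp, rule differences_in_lists_I) (auto simp: basis_def)

lemma symbol_keys: "x \<in> basis \<Longrightarrow> Poly_Mapping.keys (symbol x) \<subseteq> pairs_M"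
  using T_symbol_closed by (cases x) (auto simp: symbol_def pairs_M_def basis_def)

lemma symbol_extend_keys: "Poly_Mapping.keys c \<subseteq> basis \<Longrightarrow> Poly_Mapping.keys (frag_extend symbol c) \<subseteq> pairs_M"
  by (rule keys_frag_extend_subset[OF _ symbol_keys])

lemma basis_map_of: "basis_map (frag_of (y, zs)) = tensor (frag_of y) (T.cls (frag_of (differences y zs)))"
  by (simp add: basis_map_def symbol_def tensor_def)

lemma basis_map_additive: "basis_map \<in> hom (free_Abelian_group basis) (add_monoid M)"
  using M_cls_closed[OF symbol_extend_keys] M_cls_add[OF symbol_extend_keys symbol_extend_keys]
  by (auto simp: hom_def basis_map_def frag_extend_add)

lemma basis_map_hom:
  assumes M: "left_module (group_ring (G \<times>\<times> G)) M"
  shows "basis_map \<in> module_hom (group_ring (G \<times>\<times> G)) (permutation_module basis_act basis) M"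
proof (rule group_set.permutation_module_hom[OF group_set_basis M basis_map_additive])
  fix k x assume k: "k \<in> carrier (G \<times>\<times> G)" and x: "x \<in> basis"
  obtain y zs where yzs: "x = (y, zs)" by fastforce
  have y: "y \<in> carrier G" and zs: "set zs \<subseteq> carrier G" "length zs = s" using x by (auto simp: basis_def yzs)
  have "map (\<lambda>a. frag_of k \<odot>\<^bsub>B\<^esub> a) (differences y zs) = differences (translate k y) (map (translate k) zs)"
    by (simp add: differences_def smult_B_diff smult_B_of translate_def)
  then have "frag_of k \<odot>\<^bsub>Is\<^esub> T.cls (frag_of (differences y zs))
      = T.cls (frag_of (differences (translate k y) (map (translate k) zs)))"
    using smult_T[OF k, of "frag_of (differences y zs)"] differences_in_lists_I[OF y zs]
    by (simp add: linear_action_of)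
  moreover have "frag_of k \<odot>\<^bsub>M\<^esub> basis_map (frag_of x)
      = tensor (frag_of k \<odot>\<^bsub>B\<^esub> frag_of y) (frag_of k \<odot>\<^bsub>Is\<^esub> T.cls (frag_of (differences y zs)))"
    unfolding yzs basis_map_of tensor_def
    using smult_M[OF k, of "frag_of (frag_of y, T.cls (frag_of (differences y zs)))"]
      symbol_keys[OF x, unfolded yzs]
    by (simp add: linear_action_of symbol_def)
  ultimately show "basis_map (frag_of (basis_act k x)) = frag_of k \<odot>\<^bsub>M\<^esub> basis_map (frag_of x)"
    by (simp add: basis_act_def yzs basis_map_of smult_B_of translate_def)
qed

text \<open>Coefficient functionals, built up through the two presentations: \<open>y \<otimes> a\<^sub>1 \<otimes> \<cdots> \<otimes> a\<^sub>s\<close> is viewed in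
\<open>\<int>[\<pi>] \<otimes> \<int>[\<pi>] \<otimes> \<cdots> \<otimes> \<int>[\<pi>]\<close>, where the coefficient at a tuple is a product of coefficients. They are multiadditive
and hence vanish on the relators.\<close>

definition list_coeff :: "'g list \<Rightarrow> (('g \<Rightarrow>\<^sub>0 int) list \<Rightarrow>\<^sub>0 int) \<Rightarrow> int" where
  "list_coeff zs = pairing (\<lambda>as. prod_list (map2 Poly_Mapping.lookup as zs))"

definition T_coeff :: "'g list \<Rightarrow> (('g \<Rightarrow>\<^sub>0 int) list \<Rightarrow>\<^sub>0 int) set \<Rightarrow> int" where
  "T_coeff zs U = list_coeff zs (SOME u. u \<in> U)"

definition M_coeff :: "'g \<times> 'g list \<Rightarrow> (('g \<Rightarrow>\<^sub>0 int) \<times> (('g \<Rightarrow>\<^sub>0 int) list \<Rightarrow>\<^sub>0 int) set \<Rightarrow>\<^sub>0 int) \<Rightarrow> int" where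
  "M_coeff = (\<lambda>(y, zs). pairing (\<lambda>(a, U). Poly_Mapping.lookup a y * T_coeff zs U))"

lemma list_coeff_Rel:
  assumes "length zs = s" "u \<in> T.Rel"
  shows "list_coeff zs u = 0"
  unfolding list_coeff_def
proof (rule T.pairing_Rel[OF _ assms(2)])
  fix u assume "u \<in> tensor_power_relators I s"
  then obtain us x x' vs
    where u: "u = frag_of (us @ (x + x') # vs) - frag_of (us @ x # vs) - frag_of (us @ x' # vs)"
      and len: "Suc (length us + length vs) = s"
    by (rule tensor_power_relatorE)
  obtain c where "\<And>x. prod_list (map2 Poly_Mapping.lookup (us @ x # vs) zs)
      = Poly_Mapping.lookup x (zs ! length us) * c"
    using prod_list_map2_append[of us vs zs Poly_Mapping.lookup] len assms(1) by metis
  then show "pairing (\<lambda>as. prod_list (map2 Poly_Mapping.lookup as zs)) u = 0"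
    by (simp add: u pairing_diff lookup_add distrib_right)
qed

lemma T_coeff_cls:
  assumes "length zs = s"
  shows "T_coeff zs (T.cls u) = list_coeff zs u"
proof -
  have "(SOME v. v \<in> T.cls u) \<in> T.cls u" by (rule someI[of "\<lambda>v. v \<in> T.cls u", OF T.self_mem_cls])
  then obtain k where "k \<in> T.Rel" "(SOME v. v \<in> T.cls u) = k + u" unfolding T.mem_cls by blast
  then show ?thesis
    using list_coeff_Rel[OF assms] by (simp add: T_coeff_def list_coeff_def pairing_add)
qed

lemma T_coeff_add:
  assumes "length zs = s" "U \<in> carrier Is" "V \<in> carrier Is"
  shows "T_coeff zs (U \<oplus>\<^bsub>Is\<^esub> V) = T_coeff zs U + T_coeff zs V"
  using assms(2,3) unfolding carrier_Is
  by (auto simp: T_cls_add T_coeff_cls[OF assms(1)] list_coeff_def pairing_add)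

lemma M_coeff_Rel:
  assumes "length zs = s" "w \<in> M.Rel"
  shows "M_coeff (y, zs) w = 0"
  unfolding M_coeff_def prod.case
proof (rule M.pairing_Rel[OF _ assms(2)])
  fix w assume "w \<in> tensor_relators B Is"
  then show "pairing (\<lambda>(a, U). Poly_Mapping.lookup a y * T_coeff zs U) w = 0"
    unfolding tensor_relators_def
    by (auto simp: pairing_diff lookup_add T_coeff_add[OF assms(1)] distrib_left distrib_right)
qed

text \<open>Expanding \<open>(z\<^sub>1 - y) \<otimes> \<cdots> \<otimes> (z\<^sub>s - y)\<close> yields \<open>z\<^sub>1 \<otimes> \<cdots> \<otimes> z\<^sub>s\<close> and terms with some entry \<open>y\<close>. The latter do not
contribute to the coefficient at a basis tuple over \<open>y\<close>, in which \<open>y\<close> does not recur. So these functionals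
are dual to the basis.\<close>

lemma M_coeff_symbol:
  assumes "x \<in> basis" "x' \<in> basis"
  shows "M_coeff x' (symbol x) = (if x = x' then 1 else 0)"
proof -
  obtain y zs y' zs' where x: "x = (y, zs)" and x': "x' = (y', zs')" by fastforce
  have len: "length zs = s" "length zs' = s" and y': "y' \<notin> set zs'"
    using assms by (auto simp: basis_def x x')
  have e: "M_coeff x' (symbol x) = Poly_Mapping.lookup (frag_of y) y' *
      prod_list (map2 Poly_Mapping.lookup (differences y zs) zs')"
    by (simp add: M_coeff_def symbol_def x x' T_coeff_cls[OF len(2)] list_coeff_def)
  show ?thesis
  proof (cases "y = y'")
    case True
    have "map2 Poly_Mapping.lookup (differences y zs) zs' = map2 (\<lambda>x z. Poly_Mapping.lookup (frag_of x) z) zs zs'"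
      using y' len True
      by (intro nth_equalityI) (auto simp: differences_def lookup_minus nth_mem)
    then show ?thesis using prod_list_frag_of[of zs zs'] len True unfolding e by (simp add: x x')
  next
    case False
    then show ?thesis unfolding e by (simp add: x x')
  qed
qed

lemma basis_map_inj:
  assumes "Poly_Mapping.keys c \<subseteq> basis" "basis_map c = \<zero>\<^bsub>M\<^esub>"
  shows "c = 0"
proof (rule poly_mapping_eqI)
  fix x
  show "Poly_Mapping.lookup c x = Poly_Mapping.lookup 0 x"
  proof (cases "x \<in> basis")
    case True
    obtain y zs where x: "x = (y, zs)" by fastforce
    have len: "length zs = s" using True by (auto simp: basis_def x)
    have "frag_extend symbol c \<in> M.Rel"
      using M_cls_eq_zeroD[OF symbol_extend_keys[OF assms(1)]] assms(2) by (simp add: basis_map_def)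
    then have "M_coeff x (frag_extend symbol c) = 0" unfolding x by (rule M_coeff_Rel[OF len])
    moreover have "M_coeff x (frag_extend symbol c) = pairing (\<lambda>x'. M_coeff x (symbol x')) c"
      by (simp add: M_coeff_def x pairing_frag_extend)
    moreover have "\<dots> = pairing (\<lambda>x'. if x' = x then 1 else 0) c"
      by (rule pairing_cong, rule M_coeff_symbol[OF subsetD[OF assms(1)] True])
    ultimately show ?thesis by (simp add: pairing_indicator)
  next
    case False
    then show ?thesis using assms(1) by (auto simp: in_keys_iff)
  qed
qed

definition image_basis_map :: "(('g \<Rightarrow>\<^sub>0 int) \<times> (('g \<Rightarrow>\<^sub>0 int) list \<Rightarrow>\<^sub>0 int) set \<Rightarrow>\<^sub>0 int) set set" where
  "image_basis_map = basis_map ` {c. Poly_Mapping.keys c \<subseteq> basis}"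

lemma image_basis_map_zero: "\<zero>\<^bsub>M\<^esub> \<in> image_basis_map"
proof -
  have "basis_map 0 \<in> image_basis_map" unfolding image_basis_map_def by (rule imageI) simp
  then show ?thesis by (simp add: additive_zero[OF abelian_group_M basis_map_additive])
qed

lemma image_basis_map_diff:
  assumes "U \<in> image_basis_map" "V \<in> image_basis_map"
  shows "U \<ominus>\<^bsub>M\<^esub> V \<in> image_basis_map"
proof -
  obtain c c' where c: "Poly_Mapping.keys c \<subseteq> basis" "U = basis_map c"
    "Poly_Mapping.keys c' \<subseteq> basis" "V = basis_map c'"
    using assms unfolding image_basis_map_def by blast
  have "basis_map (c - c') \<in> image_basis_map"
    unfolding image_basis_map_def using keys_diff_subset[OF c(1,3)] by (intro imageI) simp
  then show ?thesis by (simp add: c(2,4) additive_diff[OF abelian_group_M basis_map_additive c(1,3)])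
qed

text \<open>An element \<open>a = \<Sum> a\<^sub>z z\<close> of the augmentation ideal equals \<open>\<Sum> a\<^sub>z (z - y)\<close> for every \<open>y\<close>, since its coefficients
sum to zero.\<close>

lemma frag_extend_differences:
  assumes "a \<in> carrier I"
  shows "frag_extend (\<lambda>z. frag_of z - frag_of y) a = a"
  using assms by (simp add: frag_extend_fun_diff frag_extend_const flip: frag_expansion)

lemma frag_extend_differences_in_I:
  assumes "y \<in> carrier G" "Poly_Mapping.keys c \<subseteq> carrier G"
  shows "frag_extend (\<lambda>z. frag_of z - frag_of y) c \<in> carrier I"
  using assms(2) 
proof (induction c rule: frag_induction)
  case (diff a b)
  then show ?case by (simp add: frag_extend_diff augmentation_diff keys_diff_subset)
qed (use difference_in_I[OF assms(1)] in auto)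

lemma tensor_zero_right:
  assumes "a \<in> carrier B"
  shows "tensor a \<zero>\<^bsub>Is\<^esub> = \<zero>\<^bsub>M\<^esub>"
proof -
  interpret T': abelian_group Is by (rule abelian_group_Is)
  interpret M': abelian_group M by (rule abelian_group_M)
  show ?thesis
    using tensor_add_right[OF assms T'.zero_closed T'.zero_closed] tensor_closed[OF assms T'.zero_closed]
      M'.add.l_cancel_one'[of "tensor a \<zero>\<^bsub>Is\<^esub>" "tensor a \<zero>\<^bsub>Is\<^esub>"] by simp
qed

lemma tensor_zero_left:
  assumes "U \<in> carrier Is"
  shows "tensor 0 U = \<zero>\<^bsub>M\<^esub>"
proof -
  interpret M': abelian_group M by (rule abelian_group_M)
  have z: "0 \<in> carrier B" by simp
  show ?thesis
    using tensor_add_left[OF z z assms] tensor_closed[OF z assms]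
      M'.add.l_cancel_one'[of "tensor 0 U" "tensor 0 U"] by simp
qed

lemma tensor_diff_left:
  assumes "a \<in> carrier B" "b \<in> carrier B" "U \<in> carrier Is"
  shows "tensor (a - b) U = tensor a U \<ominus>\<^bsub>M\<^esub> tensor b U"
proof -
  interpret M': abelian_group M by (rule abelian_group_M)
  have ab: "a - b \<in> carrier B" using assms by (simp add: keys_diff_subset)
  show ?thesis
    using tensor_add_left[OF ab assms(2,3)] tensor_closed[OF ab assms(3)] tensor_closed[OF assms(2,3)]
    by (intro M'.eq_minusI) simp_all
qed

lemma tensor_diff_right:
  assumes "a \<in> carrier B" "U \<in> carrier Is" "V \<in> carrier Is"
  shows "tensor a (U \<ominus>\<^bsub>Is\<^esub> V) = tensor a U \<ominus>\<^bsub>M\<^esub> tensor a V"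
proof -
  interpret T': abelian_group Is by (rule abelian_group_Is)
  interpret M': abelian_group M by (rule abelian_group_M)
  have UV: "U \<ominus>\<^bsub>Is\<^esub> V \<in> carrier Is" using assms by simp
  have "tensor a U = tensor a (U \<ominus>\<^bsub>Is\<^esub> V) \<oplus>\<^bsub>M\<^esub> tensor a V"
    using tensor_add_right[OF assms(1) UV assms(3)] assms
    by (simp add: T'.minus_eq T'.a_assoc T'.l_neg)
  then show ?thesis
    using tensor_closed[OF assms(1) UV] tensor_closed[OF assms(1,3)] by (intro M'.eq_minusI)
qed

text \<open>The entries from the augmentation ideal are expanded in differences from \<open>y\<close> one after the other.\<close>

lemma tensor_list_in_image:
  assumes y: "y \<in> carrier G"
  shows "\<lbrakk>set zs \<subseteq> carrier G - {y}; set vs \<subseteq> carrier I; length zs + length vs = s\<rbrakk> \<Longrightarrow>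
    tensor (frag_of y) (T.cls (frag_of (differences y zs @ vs))) \<in> image_basis_map"
proof (induction vs arbitrary: zs)
  case Nil
  then have "(y, zs) \<in> basis" using y by (simp add: basis_def)
  then have "basis_map (frag_of (y, zs)) \<in> image_basis_map" unfolding image_basis_map_def by (intro imageI) simp
  then show ?case by (simp add: basis_map_of)
next
  case (Cons a vs)
  interpret T': abelian_group Is by (rule abelian_group_Is)
  let ?us = "differences y zs"
  have yB: "frag_of y \<in> carrier B" using y by simp
  have us: "set ?us \<subseteq> carrier I" "Suc (length ?us + length vs) = s"
    using Cons.prems y difference_in_I[OF y]
    by (auto simp: differences_def simp del: augmentation_ideal_simps)
  have vs: "set vs \<subseteq> carrier I" using Cons.prems by simp
  let ?t = "\<lambda>x. T.cls (frag_of (?us @ x # vs))"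
  have t_closed: "?t x \<in> carrier Is" if "x \<in> carrier I" for x
    using that us vs by (intro T_cls_closed) (auto simp: lists_I_def)
  have t_zero: "?t 0 = \<zero>\<^bsub>Is\<^esub>"
  proof -
    have z: "0 \<in> carrier I" by simp
    show ?thesis
      using T_add[OF us(1) vs us(2) z z] T'.add.l_cancel_one'[OF t_closed[OF z] t_closed[OF z]] by simp
  qed
  have "tensor (frag_of y) (?t (frag_extend (\<lambda>z. frag_of z - frag_of y) c)) \<in> image_basis_map"
    if "Poly_Mapping.keys c \<subseteq> carrier G" for c
  proof -
    have "Poly_Mapping.keys c \<subseteq> carrier G \<and>
      tensor (frag_of y) (?t (frag_extend (\<lambda>z. frag_of z - frag_of y) c)) \<in> image_basis_map"
      using that
    proof (induction c rule: frag_induction)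
      case zero
      show ?case using t_zero tensor_zero_right[OF yB] image_basis_map_zero by simp
    next
      case (one z)
      show ?case
      proof (cases "z = y")
        case True
        then show ?thesis using one t_zero tensor_zero_right[OF yB] image_basis_map_zero by simp
      next
        case False
        then have "tensor (frag_of y) (T.cls (frag_of (differences y (zs @ [z]) @ vs))) \<in> image_basis_map"
          using Cons.prems one by (intro Cons.IH) auto
        then show ?thesis using one by (simp add: differences_def)
      qed
    next
      case (diff a b)
      let ?e = "frag_extend (\<lambda>z. frag_of z - frag_of y)"
      have e: "?e a \<in> carrier I" "?e b \<in> carrier I" "?e (a - b) \<in> carrier I"
        using diff frag_extend_differences_in_I[OF y] keys_diff_subset by blast+
      have "?t (?e a) = ?t (?e (a - b)) \<oplus>\<^bsub>Is\<^esub> ?t (?e b)"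
        using T_add[OF us(1) vs us(2) e(3,2)] by (simp add: frag_extend_diff)
      then have "?t (?e (a - b)) = ?t (?e a) \<ominus>\<^bsub>Is\<^esub> ?t (?e b)"
        using t_closed[OF e(3)] t_closed[OF e(2)] by (intro T'.eq_minusI)
      then have "tensor (frag_of y) (?t (?e (a - b)))
          = tensor (frag_of y) (?t (?e a)) \<ominus>\<^bsub>M\<^esub> tensor (frag_of y) (?t (?e b))"
        using tensor_diff_right[OF yB t_closed[OF e(1)] t_closed[OF e(2)]] by simp
      then show ?case using diff image_basis_map_diff keys_diff_subset by metis
    qed
    then show ?thesis ..
  qed
  from this[of a] show ?case
    using frag_extend_differences[of a y] Cons.prems by simp
qed

lemma tensor_in_image:
  assumes "a \<in> carrier B" "U \<in> carrier Is"
  shows "tensor a U \<in> image_basis_map"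
proof -
  have gen: "tensor (frag_of y) U \<in> image_basis_map" if y: "y \<in> carrier G" for y
  proof -
    have yB: "frag_of y \<in> carrier B" using y by simp
    obtain u where u: "Poly_Mapping.keys u \<subseteq> lists_I" "U = T.cls u"
      using assms(2) unfolding carrier_Is by blast
    have "Poly_Mapping.keys u \<subseteq> lists_I \<and> tensor (frag_of y) (T.cls u) \<in> image_basis_map"
      using u(1)
    proof (induction u rule: frag_induction)
      case zero
      show ?case using tensor_zero_right[OF yB] image_basis_map_zero by (simp add: zero_Is)
    next
      case (one as)
      then show ?case
        using tensor_list_in_image[OF y, of "[]" as] by (simp add: lists_I_def differences_def)
    next
      case (diff u v)
      then show ?case
        using image_basis_map_diff tensor_diff_right[OF yB T_cls_closed T_cls_closed, of u v]
        by (simp add: T_cls_diff keys_diff_subset)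
    qed
    then show ?thesis by (simp add: u(2))
  qed
  have "Poly_Mapping.keys a \<subseteq> carrier G" using assms(1) by simp
  then have "Poly_Mapping.keys a \<subseteq> carrier G \<and> tensor a U \<in> image_basis_map"
  proof (induction a rule: frag_induction)
    case zero
    show ?case using tensor_zero_left[OF assms(2)] image_basis_map_zero by simp
  next
    case (one y)
    then show ?case using gen by simp
  next
    case (diff a b)
    then show ?case
      using image_basis_map_diff tensor_diff_left[OF _ _ assms(2), of a b] by (simp add: keys_diff_subset)
  qed
  then show ?thesis ..
qed

lemma basis_map_surj: "carrier M \<subseteq> image_basis_map"
proof
  fix V assume "V \<in> carrier M"
  then obtain w where w: "Poly_Mapping.keys w \<subseteq> pairs_M" "V = M.cls w" unfolding carrier_M by blast
  have "Poly_Mapping.keys w \<subseteq> pairs_M \<and> M.cls w \<in> image_basis_map"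
    using w(1)
  proof (induction w rule: frag_induction)
    case zero
    show ?case using image_basis_map_zero by (simp add: zero_M)
  next
    case (one p)
    then show ?case using tensor_in_image by (auto simp: pairs_M_def tensor_def simp del: group_ring_bimodule_simps)
  next
    case (diff u v)
    then show ?case using image_basis_map_diff by (simp add: M_cls_diff keys_diff_subset)
  qed
  then show "V \<in> image_basis_map" by (simp add: w(2))
qed

lemma basis_map_bij: "bij_betw basis_map (carrier (permutation_module basis_act basis)) (carrier M)"
proof -
  have "inj_on basis_map {c. Poly_Mapping.keys c \<subseteq> basis}"
  proof (rule inj_onI)
    fix c c' assume c: "c \<in> {c. Poly_Mapping.keys c \<subseteq> basis}" "c' \<in> {c. Poly_Mapping.keys c \<subseteq> basis}"
      and eq: "basis_map c = basis_map c'"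
    interpret M': abelian_group M by (rule abelian_group_M)
    have "basis_map (c - c') = \<zero>\<^bsub>M\<^esub>"
      using additive_diff[OF abelian_group_M basis_map_additive, of c c'] c
        additive_closed[OF abelian_group_M basis_map_additive, of c'] eq
      by (simp add: M'.minus_eq M'.r_neg)
    then show "c = c'" using basis_map_inj[of "c - c'"] c by (simp add: keys_diff_subset)
  qed
  moreover have "image_basis_map \<subseteq> carrier M"
    using additive_closed[OF abelian_group_M basis_map_additive] by (auto simp: image_basis_map_def)
  ultimately show ?thesis using basis_map_surj by (auto simp: bij_betw_def image_basis_map_def)
qed

end

section \<open>Stabilizers are trivial or infinite cyclic\<close>

text \<open>Division with remainder by the least positive exponent that occurs in the subgroup.\<close>

lemma (in group) subgroup_of_cyclic:
  assumes S: "subgroup S G" and a: "a \<in> carrier G" and sub: "S \<subseteq> range (\<lambda>n::int. a [^] n)"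
  obtains c where "c \<in> S" "S = range (\<lambda>n::int. c [^] n)"
proof (cases "\<exists>n::nat. n > 0 \<and> a [^] (int n) \<in> S")
  case True
  define k where "k = (LEAST n::nat. n > 0 \<and> a [^] (int n) \<in> S)"
  have k: "k > 0" "a [^] (int k) \<in> S" using LeastI_ex[OF True] by (simp_all add: k_def)
  have min: "\<not> (n > 0 \<and> a [^] (int n) \<in> S)" if "n < k" for n
    using not_less_Least[of n "\<lambda>n. n > 0 \<and> a [^] (int n) \<in> S"] that by (simp add: k_def)
  have pow: "(a [^] (int k)) [^] n \<in> S" for n :: int by (rule subgroup_int_pow_closed[OF S k(2)])
  have "x \<in> range (\<lambda>n::int. (a [^] (int k)) [^] n)" if x: "x \<in> S" for x
  proof -
    obtain m :: int where m: "x = a [^] m" using x sub by blast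
    let ?q = "m div int k"
    have "a [^] (m mod int k) = a [^] (m - int k * ?q)" by (simp add: minus_mult_div_eq_mod)
    also have "\<dots> = x \<otimes> inv ((a [^] (int k)) [^] ?q)"
      using a by (simp add: m int_pow_diff int_pow_pow)
    also have "\<dots> \<in> S"
      by (intro subgroup.m_closed[OF S] subgroup.m_inv_closed[OF S] x pow)
    finally have "a [^] (int (nat (m mod int k))) \<in> S" using k(1) by simp
    moreover have "nat (m mod int k) < k" using k(1) by (simp add: nat_less_iff)
    ultimately have "nat (m mod int k) = 0" using min[of "nat (m mod int k)"] by (metis gr0I)
    moreover have "m mod int k \<ge> 0" using k(1) by simp
    ultimately have "m mod int k = 0" by simp
    then have "m = int k * ?q" using mult_div_mod_eq[of "int k" m] by simp
    then have "a [^] m = a [^] (int k * ?q)" by (rule arg_cong)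
    also have "\<dots> = (a [^] (int k)) [^] ?q" using int_pow_pow[OF a] by simp
    finally show ?thesis unfolding m by (rule range_eqI)
  qed
  then have "S = range (\<lambda>n::int. (a [^] (int k)) [^] n)"
    by (intro equalityI subsetI) (auto intro: pow)
  with k(2) show ?thesis by (rule that)
next
  case False
  have triv: "x \<in> {\<one>}" if x: "x \<in> S" for x
  proof -
    obtain m :: int where m: "x = a [^] m" using x sub by blast
    have no_pos: "\<not> n > 0" if "a [^] n \<in> S" for n :: int
    proof
      assume "n > 0"
      then have "nat n > 0 \<and> a [^] (int (nat n)) \<in> S" using that by simp
      with False show False by (metis (no_types))
    qed
    have "a [^] (- m) \<in> S"
      using subgroup.m_inv_closed[OF S x] a by (simp add: m int_pow_neg)
    from no_pos[OF this] no_pos[OF x[unfolded m]] have "m = 0" by linarith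
    then show ?thesis by (simp add: m)
  qed
  have one: "\<one> \<in> S" by (rule subgroup.one_closed[OF S])
  from triv have "S \<subseteq> {\<one>}" by (rule subsetI)
  with one have "S = {\<one>}" by auto
  also have "\<dots> = range (\<lambda>n::int. \<one> [^] n)" by simp
  finally show ?thesis by (rule that[OF one])
qed

lemma (in group) torsion_free_infinite_order:
  assumes "torsion_free G" "c \<in> carrier G" "c \<noteq> \<one>"
  shows "infinite_order G c"
proof -
  have eq: "m = n" if "m \<le> n" "c [^] m = c [^] n" for m n :: int
  proof (rule ccontr)
    assume "m \<noteq> n"
    define k where "k = nat (n - m)"
    then have k: "n = m + int k" "k > 0" using that(1) \<open>m \<noteq> n\<close> by simp_all
    have "c [^] n = c [^] m \<otimes> c [^] (int k)"
      unfolding k(1) by (rule int_pow_mult[OF assms(2)])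
    with that(2) have "c [^] m = c [^] m \<otimes> c [^] (int k)" by (rule trans)
    then have "c [^] (int k) = \<one>"
      using assms(2) l_cancel_one'[of "c [^] m" "c [^] (int k)"] by (simp only: int_pow_closed)
    then have "c [^] k = \<one>" by (simp only: int_pow_int)
    then show False using assms k(2) by (auto simp: torsion_free_def)
  qed
  show ?thesis unfolding infinite_order_def
  proof (rule injI)
    fix m n :: int assume "c [^] m = c [^] n"
    then show "m = n" using eq[of m n] eq[of n m] by (cases "m \<le> n") auto
  qed
qed

lemma (in group) subgroup_centralizer:
  assumes "g \<in> carrier G"
  shows "subgroup (centralizer G g) G"
proof (rule subgroupI)
  show "centralizer G g \<subseteq> carrier G" by (auto simp: centralizer_def)
  show "centralizer G g \<noteq> {}" using assms by (auto simp: centralizer_def)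
  fix x assume x: "x \<in> centralizer G g"
  then have c: "x \<in> carrier G" "x \<otimes> g = g \<otimes> x" by (auto simp: centralizer_def)
  have "inv x \<otimes> g \<otimes> x = inv x \<otimes> (x \<otimes> g)" using c assms by (simp add: m_assoc)
  also have "\<dots> = g" using c(1) assms by (simp flip: m_assoc)
  finally have "g \<otimes> inv x = (inv x \<otimes> g \<otimes> x) \<otimes> inv x" by simp
  also have "\<dots> = inv x \<otimes> g" using c(1) assms by (simp add: m_assoc)
  finally have "g \<otimes> inv x = inv x \<otimes> g" .
  then show "inv x \<in> centralizer G g" using c by (simp add: centralizer_def)
  fix y assume "y \<in> centralizer G g"
  then have d: "y \<in> carrier G" "y \<otimes> g = g \<otimes> y" by (auto simp: centralizer_def)
  have "x \<otimes> y \<otimes> g = x \<otimes> (g \<otimes> y)" using c d assms by (simp add: m_assoc)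
  also have "\<dots> = g \<otimes> (x \<otimes> y)" using c d assms by (simp flip: m_assoc)
  finally show "x \<otimes> y \<in> centralizer G g" using c d by (simp add: centralizer_def)
qed

lemma (in group_set) subgroup_stabilizer:
  assumes "x \<in> X"
  shows "subgroup {g \<in> carrier H. act g x = x} H"
proof (rule subgroupI)
  show "{g \<in> carrier H. act g x = x} \<noteq> {}" using assms by (auto intro!: exI[of _ \<one>])
  fix g assume "g \<in> {g \<in> carrier H. act g x = x}"
  then show "inv g \<in> {g \<in> carrier H. act g x = x}" using act_mult[of "inv g" g x] assms by simp
qed (use assms in \<open>auto simp: act_mult\<close>)

text \<open>If \<open>(g, h)\<close> fixes \<open>y\<close> then \<open>h = y\<^sup>-\<^sup>1 g y\<close>, so the stabilizer embeds into the group by its first component. If it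
also fixes \<open>z \<noteq> y\<close> then \<open>g\<close> commutes with \<open>z y\<^sup>-\<^sup>1 \<noteq> 1\<close>. Thus one entry \<open>z\<close> suffices to confine the stabilizer to an
infinite cyclic group.\<close>

lemma (in tensor_with_powers) cyclic_stabilizers_basis:
  assumes tf: "torsion_free G"
    and centr: "\<And>g. g \<in> carrier G \<Longrightarrow> g \<noteq> \<one> \<Longrightarrow> infinite_cyclic_group (G\<lparr>carrier := centralizer G g\<rparr>)"
    and s: "s \<ge> 1"
  shows "cyclic_stabilizers (G \<times>\<times> G) basis_act basis"
proof (rule cyclic_stabilizers.intro[OF group_set_basis], unfold_locales)
  interpret X: group_set "G \<times>\<times> G" basis_act basis by (rule group_set_basis)
  fix x assume x: "x \<in> basis"
  obtain y zs where yzs: "x = (y, zs)" by fastforce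
  have y: "y \<in> carrier G" and zs: "set zs \<subseteq> carrier G - {y}" "length zs = s"
    using x by (auto simp: basis_def yzs)
  obtain z zs' where z: "zs = z # zs'" using zs(2) s by (cases zs) auto
  have zG: "z \<in> carrier G" "z \<noteq> y" using zs(1) by (auto simp: z)
  \<comment> \<open>Any entry of the tuple would do; there is one because \<open>s \<ge> 1\<close>.\<close>
  define w where "w = z \<otimes> inv y"
  have wG: "w \<in> carrier G" using y zG by (simp add: w_def)
  have w1: "w \<noteq> \<one>" using y zG by (auto simp: w_def inv_solve_right')
  let ?C = "centralizer G w"
  interpret C: group "G\<lparr>carrier := ?C\<rparr>"
    by (rule subgroup.subgroup_is_group[OF subgroup_centralizer[OF wG] group_axioms])
  obtain a where a: "a \<in> ?C" "?C = range (\<lambda>n::int. a [^]\<^bsub>G\<lparr>carrier := ?C\<rparr>\<^esub> n)"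
    using centr[OF wG w1] unfolding infinite_cyclic_group_def C.cyclic_group by auto
  have aG: "a \<in> carrier G" using a(1) by (simp add: centralizer_def)
  have C: "?C = range (\<lambda>n::int. a [^] n)"
    using a(2) int_pow_consistent[OF subgroup_centralizer[OF wG] a(1)] by simp
  \<comment> \<open>The only candidate in the stabilizer of \<open>y\<close> with first component \<open>g\<close>.\<close>
  define j where "j g = (g, inv y \<otimes> g \<otimes> y)" for g
  have j_hom: "j \<in> hom G (G \<times>\<times> G)"
  proof (rule homI)
    fix g h assume g: "g \<in> carrier G" and h: "h \<in> carrier G"
    show "j g \<in> carrier (G \<times>\<times> G)" using g y by (simp add: j_def)
    have "y \<otimes> (inv y \<otimes> (h \<otimes> y)) = h \<otimes> y" using h y by (simp flip: m_assoc)
    then show "j (g \<otimes> h) = j g \<otimes>\<^bsub>G \<times>\<times> G\<^esub> j h" using g h y by (simp add: j_def m_assoc)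
  qed
  interpret j: group_hom G "G \<times>\<times> G" j
    by (intro group_hom.intro group_hom_axioms.intro group_axioms group_GG j_hom)
  let ?Stab = "{k \<in> carrier (G \<times>\<times> G). basis_act k x = x}"
  have Stab: "k = j (fst k) \<and> fst k \<in> ?C" if k: "k \<in> ?Stab" for k
  proof -
    obtain g h where gh: "k = (g, h)" "g \<in> carrier G" "h \<in> carrier G"
      using k by (cases k) auto
    have "g \<otimes> y \<otimes> inv h = y" "g \<otimes> z \<otimes> inv h = z"
      using k by (auto simp: basis_act_def translate_def yzs z gh(1))
    then have gy: "g \<otimes> y = y \<otimes> h" and gz: "g \<otimes> z = z \<otimes> h"
      using gh y zG by (auto simp: inv_solve_right')
    have h: "h = inv y \<otimes> g \<otimes> y" using gy gh y by (simp add: m_assoc inv_solve_left)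
    have "g \<otimes> w = z \<otimes> h \<otimes> inv y" using gz gh y zG by (simp add: w_def flip: m_assoc)
    also have "\<dots> = z \<otimes> inv y \<otimes> g" using gh(2) y zG by (simp add: h m_assoc)
    finally have "g \<otimes> w = w \<otimes> g" by (simp add: w_def)
    then show ?thesis using gh h by (simp add: j_def centralizer_def)
  qed
  let ?S = "{g \<in> carrier G. j g \<in> ?Stab}"
  note sg = X.subgroup_stabilizer[OF x]
  have S_sub: "subgroup ?S G"
  proof (rule subgroupI)
    have "j \<one> \<in> ?Stab" using subgroup.one_closed[OF sg] by simp
    then show "?S \<noteq> {}" by blast
    fix g assume g: "g \<in> ?S"
    then show "inv g \<in> ?S" using subgroup.m_inv_closed[OF sg, of "j g"] by simp
    fix h assume "h \<in> ?S"
    then show "g \<otimes> h \<in> ?S" using g subgroup.m_closed[OF sg, of "j g" "j h"] by simp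
  qed auto
  have "g \<in> ?C" if "g \<in> ?S" for g using Stab[of "j g"] that by (simp add: j_def)
  then have S_cyclic: "?S \<subseteq> range (\<lambda>n::int. a [^] n)" unfolding C[symmetric] by (rule subsetI)
  obtain c where c: "c \<in> ?S" "?S = range (\<lambda>n::int. c [^] n)"
    by (rule subgroup_of_cyclic[OF S_sub aG S_cyclic])
  have cG: "c \<in> carrier G" using c(1) by simp
  have "?Stab = j ` ?S"
  proof
    show "?Stab \<subseteq> j ` ?S"
    proof
      fix k assume k: "k \<in> ?Stab"
      then have "k = j (fst k)" "fst k \<in> carrier G" using Stab[OF k] by (auto simp: centralizer_def)
      then show "k \<in> j ` ?S" using k by (intro image_eqI[of _ _ "fst k"]) auto
    qed
  qed auto
  also have "\<dots> = range (\<lambda>n::int. j c [^]\<^bsub>G \<times>\<times> G\<^esub> n)"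
    unfolding c(2) using j.hom_int_pow[OF cG] by (simp add: image_image)
  finally have "?Stab = range (\<lambda>n::int. j c [^]\<^bsub>G \<times>\<times> G\<^esub> n)" .
  moreover have "infinite_order (G \<times>\<times> G) (j c) \<or> j c = \<one>\<^bsub>G \<times>\<times> G\<^esub>"
  proof (cases "c = \<one>")
    case False
    have "inj j" by (rule injI) (simp add: j_def)
    then show ?thesis
      using torsion_free_infinite_order[OF tf cG False] j.hom_int_pow[OF cG]
      by (auto simp: infinite_order_def inj_def)
  qed simp
  ultimately show "\<exists>c\<in>carrier (G \<times>\<times> G). (infinite_order (G \<times>\<times> G) c \<or> c = \<one>\<^bsub>G \<times>\<times> G\<^esub>) \<and>
      ?Stab = range (\<lambda>n::int. c [^]\<^bsub>G \<times>\<times> G\<^esub> n)"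
    using j.hom_closed[OF cG] by blast
qed

theorem corollary8p1:
  fixes G :: "('g, 'm) monoid_scheme"
    and A :: "('g \<times> 'g \<Rightarrow>\<^sub>0 int, 'a) module"
    and P :: "nat \<Rightarrow> ('g \<times> 'g \<Rightarrow>\<^sub>0 int, 'p) module"
    and d :: "nat \<Rightarrow> 'p \<Rightarrow> 'p"
    and r s :: nat
  assumes "group G"
    and "torsion_free G"
    and "\<And>g. g \<in> carrier G \<Longrightarrow> g \<noteq> \<one>\<^bsub>G\<^esub> \<Longrightarrow> infinite_cyclic_group (G\<lparr>carrier := centralizer G g\<rparr>)"
    and "left_module (group_ring (G \<times>\<times> G)) A"
    and "projective_resolution (group_ring (G \<times>\<times> G))
           (tensor_product (group_ring_bimodule G) (tensor_power (augmentation_ideal G) s)) P d \<epsilon>"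
    and "r > 1" and "s \<ge> 1"
  shows "trivial_group (Ext_group (group_ring (G \<times>\<times> G)) P d r A)"
proof -
  interpret tensor_with_powers G s by (intro tensor_with_powers.intro assms(1))
  have M: "left_module (group_ring (G \<times>\<times> G)) M"
    using assms(5) by (simp add: projective_resolution_def)
  have stab: "cyclic_stabilizers (G \<times>\<times> G) basis_act basis"
    by (rule cyclic_stabilizers_basis[OF assms(2,3,7)])
  show ?thesis
    by (rule cyclic_stabilizers.Ext_group_trivial
        [OF stab assms(4) M basis_map_hom[OF M] basis_map_bij assms(5,6)])
qed

end
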